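(* Let $(\mathcal{T}_0,\mathrm{ref}_{\mathcal{T}_0})$ be an (extended) conforming triangulation of a polygonal domain $\Omega\subset\mathbb{R}^2$, let $(\mathcal{T},\mathrm{ref}_{\mathcal{T}})$ be a conforming triangulation obtained by red-green-blue (RGB) refinement of $(\mathcal{T}_0,\mathrm{ref}_{\mathcal{T}_0})$, let $\mathcal{N}$ be the set of vertices of $\mathcal{T}$, and let $\mathcal{N}_{\mathrm{mark}}\subset\mathcal{N}$. Then the output of the procedure $\mathrm{COARSEN}(\mathcal{T},\mathrm{ref}_{\mathcal{T}},\mathcal{N}_{\mathrm{mark}})$ is a conforming and shape regular triangulation of $\Omega$.
   Context: **Triangulations.** Let $\Omega\subset\mathbb{R}^2$ be a polygonal domain. A triangulation $\mathcal{T}$ of $\Omega$ is a finite set of closed triangles (elements) of positive area, with pairwise disjoint interiors, whose union is $\overline{\Omega}$. It is conforming if any two distinct elements intersect in the empty set, a common vertex, or a common edge (so there are no hanging nodes). $\mathcal{N}=\mathcal{N}(\mathcal{T})$ is the set of vertices (nodes) of $\mathcal{T}$; $\mathcal{N}(T)$ and $\mathcal{E}(T)$ are the sets of vertices and edges of $T$. An extended conforming triangulation $(\mathcal{T},\mathrm{ref}_{\mathcal{T}})$ is a conforming triangulation with a map assigning to each $T\in\mathcal{T}$ a reference edge $\mathrm{ref}_{\mathcal{T}}(T)\in\mathcal{E}(T)$. Write $T=(v_1,v_2,v_3)$ for the triangle with vertices $v_1,v_2,v_3$ in counterclockwise order and reference edge $v_1v_2$. **RGB patterns.** For $T=(v_1,v_2,v_3)$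 let $m_{12},m_{23},m_{31}$ be the midpoints of $v_1v_2$, $v_2v_3$, $v_3v_1$. The allowed refinements of $T$ (the father) into its children are: - none: $T$ is unchanged; - red: $r_1=(v_1,m_{12},m_{31})$, $r_2=(m_{12},v_2,m_{23})$, $r_3=(m_{31},m_{23},v_3)$, $r_4=(m_{23},m_{31},m_{12})$; - green: $(v_3,v_1,m_{12})$, $(v_2,v_3,m_{12})$; - blue$_r$: $(v_3,v_1,m_{12})$, $(m_{12},v_2,m_{23})$, $(v_3,m_{12},m_{23})$; - blue$_\ell$: $(m_{12},v_3,m_{31})$, $(v_1,m_{12},m_{31})$, $(v_2,v_3,m_{12})$. A blue refinement equals a green refinement of $T$ followed by a green refinement of one of the two green children, and for genealogy (father/child relations) it is treated as these two successive green refinements. An RGB refinement step applies one of these patterns to each element of an extended conforming triangulation such that the result is again an extended conforming triangulation. "Obtained by RGB refinement of $\mathcal{T}_0$" means obtained by finitely many such steps. $\mathcal{N}_0$ is the set of vertices of $\mathcal{T}_0$. **Newest vertices.** The newest vertex of an element $T\in\mathcal{T}$ is the vertex opposite to its reference edge, with the exception that an element of type $r_3$ of a red refinement has no newest vertex (its vertex opposite to the reference edge is an old vertex of the father). Hence an unrefined red pattern has the newest vertices $m_{12},m_{23},m_{31}$, an unrefined green pattern has $m_{12}$, and nodes of $\mathcal{N}_0$ are never counted. **Red middle elements.** An element of $\mathcal{T}$ is a red middle element if it is the child $r_4$ of a red refinement of some father $F$ and all its siblings $r_1,r_2,r_3$ also belong to $\mathcal{T}$. **Procedure $\mathrm{COARSEN}(\mathcal{T},\mathrm{ref}_{\mathcal{T}},\mathcal{N}_{\mathrm{mark}})$.**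 1. $\mathcal{N}_{\mathrm{new}}:=\{v\in\mathcal{N}\setminus\mathcal{N}_0 : v \text{ is newest vertex of some } T\in\mathcal{T}\}$. 2. $\mathcal{M}:=\{T\in\mathcal{T}: T\text{ is a red middle element}\}$ and $\tilde{\mathcal{R}}_v:=\{T\in\mathcal{T}\setminus\mathcal{M}: v\in\mathcal{N}(T)\}$ for $v\in\mathcal{N}$. 3. $\mathcal{N}_{\mathrm{adm}}:=\{v\in\mathcal{N}_{\mathrm{new}}\cap\mathcal{N}_{\mathrm{mark}}: \#\tilde{\mathcal{R}}_v\in\{2,4\}\}$ and $\mathcal{N}_{\mathrm{block}}:=\mathcal{N}\setminus\mathcal{N}_{\mathrm{adm}}$. 4. Repeat until $\mathcal{N}_{\mathrm{block}}$ no longer changes: let $\mathcal{M}_{\mathrm{block}}:=\{T\in\mathcal{M}:\mathcal{N}(T)\cap\mathcal{N}_{\mathrm{block}}\neq\emptyset\}$ and add to $\mathcal{N}_{\mathrm{block}}$, for every $T\in\mathcal{M}_{\mathrm{block}}$, the vertex of $T$ opposite to $\mathrm{ref}_{\mathcal{T}}(T)$. 5. $\mathcal{N}_{\mathrm{hang}}:=\mathcal{N}_{\mathrm{block}}\cap\mathcal{N}_{\mathrm{new}}$ and replace $\mathcal{N}_{\mathrm{adm}}$ by $\mathcal{N}_{\mathrm{adm}}\setminus\mathcal{N}_{\mathrm{hang}}$. 6. Create the new elements and reference edges $(\hat{\mathcal{T}},\mathrm{ref}_{\hat{\mathcal{T}}})$ as follows. - For every red pattern $r_1,\dots,r_4\in\mathcal{T}$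 with red middle element $r_4\in\mathcal{M}$ and father $F=(v_1,v_2,v_3)$: if $m_{12},m_{23},m_{31}\in\mathcal{N}_{\mathrm{adm}}$, replace the four elements by $F$; if $m_{12}\in\mathcal{N}_{\mathrm{hang}}$ and $m_{23},m_{31}\in\mathcal{N}_{\mathrm{adm}}$, replace them by the green children of $F$; if $m_{12},m_{31}\in\mathcal{N}_{\mathrm{hang}}$ and $m_{23}\in\mathcal{N}_{\mathrm{adm}}$, by the blue$_\ell$ children of $F$; if $m_{12},m_{23}\in\mathcal{N}_{\mathrm{hang}}$ and $m_{31}\in\mathcal{N}_{\mathrm{adm}}$, by the blue$_r$ children of $F$; if $m_{12},m_{23},m_{31}\in\mathcal{N}_{\mathrm{hang}}$, keep the four elements. - For every pair of elements of $\mathcal{T}$ that are the two green children of a common father $F=(v_1,v_2,v_3)$: if $m_{12}\in\mathcal{N}_{\mathrm{adm}}$, replace the pair by $F$ (with reference edge $v_1v_2$); if $m_{12}\in\mathcal{N}_{\mathrm{hang}}$, keep the pair. - All other elements are kept unchanged. The output is $(\hat{\mathcal{T}},\mathrm{ref}_{\hat{\mathcal{T}}})$. **Shape regularity** means that Ciarlet's inscribed ball condition holds for the family of all triangulations generated in this way from a fixed $(\mathcal{T}_0,\mathrm{ref}_{\mathcal{T}_0})$: there is a constant $C$ depending only on $(\mathcal{T}_0,\mathrm{ref}_{\mathcal{T}_0})$ such that every element $T$ of every such triangulation satisfies $\mathrm{diam}(T)\le C\,\rho_T$, where $\rho_T$ is the radius of the largest ball inscribed in $T$. *)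

theory Defs
  imports "HOL-Analysis.Analysis"
begin

section \<open>Triangulations\<close>

type_synonym point = "real^2"

text \<open>
  The triple \<open>(v1, v2, v3)\<close> stands for the closed triangle with these vertices in counterclockwise
  order together with the reference edge \<open>v1 v2\<close>. A triangle of positive area and one of its edges
  determine exactly one such triple, so an extended triangulation is a set of triples.
\<close>

type_synonym triangle = "point \<times> point \<times> point"

fun hull_of :: "triangle \<Rightarrow> point set" where
  "hull_of (v1, v2, v3) = convex hull {v1, v2, v3}"

fun vertices :: "triangle \<Rightarrow> point set" where
  "vertices (v1, v2, v3) = {v1, v2, v3}"

fun edges :: "triangle \<Rightarrow> point set set" where
  "edges (v1, v2, v3) = {closed_segment v1 v2, closed_segment v2 v3, closed_segment v3 v1}"

text \<open>Positive orientation; in particular the area is positive.\<close>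

fun ccw :: "triangle \<Rightarrow> bool" where
  "ccw (a, b, c) \<longleftrightarrow> (b$1 - a$1) * (c$2 - a$2) - (b$2 - a$2) * (c$1 - a$1) > 0"

definition polygonal_domain :: "point set \<Rightarrow> bool" where
  "polygonal_domain \<Omega> \<longleftrightarrow>
     open \<Omega> \<and> connected \<Omega> \<and> bounded \<Omega> \<and> \<Omega> \<noteq> {} \<and>
     (\<exists>S. finite S \<and> (\<forall>(a, b)\<in>S. a \<noteq> b) \<and> frontier \<Omega> = (\<Union>(a, b)\<in>S. closed_segment a b))"

text \<open>
  Two different triples carried by the same triangle violate the disjointness of interiors, so the
  reference edge is unique.
\<close>

definition triangulation :: "point set \<Rightarrow> triangle set \<Rightarrow> bool" where
  "triangulation \<Omega> \<T> \<longleftrightarrow>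
     finite \<T> \<and> (\<forall>t\<in>\<T>. ccw t) \<and>
     (\<forall>s\<in>\<T>. \<forall>t\<in>\<T>. s \<noteq> t \<longrightarrow> interior (hull_of s) \<inter> interior (hull_of t) = {}) \<and>
     (\<Union>t\<in>\<T>. hull_of t) = closure \<Omega>"

definition conforming :: "triangle set \<Rightarrow> bool" where
  "conforming \<T> \<longleftrightarrow>
     (\<forall>s\<in>\<T>. \<forall>t\<in>\<T>. s \<noteq> t \<longrightarrow>
        hull_of s \<inter> hull_of t = {} \<or>
        (\<exists>v \<in> vertices s \<inter> vertices t. hull_of s \<inter> hull_of t = {v}) \<or>
        (\<exists>e \<in> edges s \<inter> edges t. hull_of s \<inter> hull_of t = e))"

definition conforming_triangulation :: "point set \<Rightarrow> triangle set \<Rightarrow> bool" where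
  "conforming_triangulation \<Omega> \<T> \<longleftrightarrow> triangulation \<Omega> \<T> \<and> conforming \<T>"

definition inradius :: "point set \<Rightarrow> real" where
  "inradius K = Sup {r. 0 \<le> r \<and> (\<exists>x. cball x r \<subseteq> K)}"

definition shape_regular :: "triangle set set \<Rightarrow> bool" where
  "shape_regular \<F> \<longleftrightarrow>
     (\<exists>C. \<forall>\<T>\<in>\<F>. \<forall>t\<in>\<T>. diameter (hull_of t) \<le> C * inradius (hull_of t))"


section \<open>Red-green-blue refinement\<close>

text \<open>
  Elements record their genealogy, because it is not determined by the triangle alone: the red
  child \<open>r1\<close> of \<open>F\<close> and a green child of a green child of \<open>F\<close> can be the same triangle with the same
  reference edge. \<open>Initial t\<close> is an element of the initial triangulation, \<open>R1 F\<close>, \<dots>, \<open>R4 F\<close> are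
  the red children and \<open>G1 F\<close>, \<open>G2 F\<close> the green children of the father \<open>F\<close>.
\<close>

datatype element =
    Initial triangle
  | R1 element | R2 element | R3 element | R4 element
  | G1 element | G2 element

fun tri :: "element \<Rightarrow> triangle" where
  "tri (Initial t) = t"
| "tri (R1 F) = (case tri F of (v1, v2, v3) \<Rightarrow> (v1, midpoint v1 v2, midpoint v3 v1))"
| "tri (R2 F) = (case tri F of (v1, v2, v3) \<Rightarrow> (midpoint v1 v2, v2, midpoint v2 v3))"
| "tri (R3 F) = (case tri F of (v1, v2, v3) \<Rightarrow> (midpoint v3 v1, midpoint v2 v3, v3))"
| "tri (R4 F) = (case tri F of (v1, v2, v3) \<Rightarrow> (midpoint v2 v3, midpoint v3 v1, midpoint v1 v2))"
| "tri (G1 F) = (case tri F of (v1, v2, v3) \<Rightarrow> (v3, v1, midpoint v1 v2))"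
| "tri (G2 F) = (case tri F of (v1, v2, v3) \<Rightarrow> (v2, v3, midpoint v1 v2))"

datatype pattern = Unrefined | Red | Green | Blue_r | Blue_l

text \<open>The blue patterns are two successive green refinements.\<close>

fun children :: "pattern \<Rightarrow> element \<Rightarrow> element set" where
  "children Unrefined T = {T}"
| "children Red T = {R1 T, R2 T, R3 T, R4 T}"
| "children Green T = {G1 T, G2 T}"
| "children Blue_r T = {G1 T, G1 (G2 T), G2 (G2 T)}"
| "children Blue_l T = {G1 (G1 T), G2 (G1 T), G2 T}"

lemma tri_children_Blue:
  assumes "tri T = (v1, v2, v3)"
  shows "tri ` children Blue_r T =
           {(v3, v1, midpoint v1 v2), (midpoint v1 v2, v2, midpoint v2 v3),
            (v3, midpoint v1 v2, midpoint v2 v3)}"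
    and "tri ` children Blue_l T =
           {(midpoint v1 v2, v3, midpoint v3 v1), (v1, midpoint v1 v2, midpoint v3 v1),
            (v2, v3, midpoint v1 v2)}"
  using assms by auto

definition rgb_step :: "point set \<Rightarrow> element set \<Rightarrow> element set \<Rightarrow> bool" where
  "rgb_step \<Omega> \<T> \<T>' \<longleftrightarrow>
     (\<exists>p. \<T>' = (\<Union>T\<in>\<T>. children (p T) T)) \<and> conforming_triangulation \<Omega> (tri ` \<T>')"

definition rgb_refinement :: "point set \<Rightarrow> triangle set \<Rightarrow> element set \<Rightarrow> bool" where
  "rgb_refinement \<Omega> \<T>\<^sub>0 \<T> \<longleftrightarrow> (rgb_step \<Omega>)\<^sup>*\<^sup>* (Initial ` \<T>\<^sub>0) \<T>"


section \<open>Coarsening\<close>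

definition nodes :: "triangle set \<Rightarrow> point set" where
  "nodes \<T> = (\<Union>t\<in>\<T>. vertices t)"

fun mid12 :: "triangle \<Rightarrow> point" where "mid12 (v1, v2, v3) = midpoint v1 v2"
fun mid23 :: "triangle \<Rightarrow> point" where "mid23 (v1, v2, v3) = midpoint v2 v3"
fun mid31 :: "triangle \<Rightarrow> point" where "mid31 (v1, v2, v3) = midpoint v3 v1"

text \<open>The vertex opposite to the reference edge.\<close>

fun opposite_vertex :: "triangle \<Rightarrow> point" where
  "opposite_vertex (v1, v2, v3) = v3"

definition is_newest_vertex :: "point \<Rightarrow> element \<Rightarrow> bool" where
  "is_newest_vertex v T \<longleftrightarrow> v = opposite_vertex (tri T) \<and> (\<nexists>F. T = R3 F)"

definition N_new :: "triangle set \<Rightarrow> element set \<Rightarrow> point set" where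
  "N_new \<T>\<^sub>0 \<T> = {v \<in> nodes (tri ` \<T>) - nodes \<T>\<^sub>0. \<exists>T\<in>\<T>. is_newest_vertex v T}"

definition red_middle :: "element set \<Rightarrow> element set" where
  "red_middle \<T> = {T \<in> \<T>. \<exists>F. T = R4 F \<and> {R1 F, R2 F, R3 F} \<subseteq> \<T>}"

definition reduced_patch :: "element set \<Rightarrow> point \<Rightarrow> element set" where
  "reduced_patch \<T> v = {T \<in> \<T> - red_middle \<T>. v \<in> vertices (tri T)}"

definition N_adm_init :: "triangle set \<Rightarrow> element set \<Rightarrow> point set \<Rightarrow> point set" where
  "N_adm_init \<T>\<^sub>0 \<T> N_mark = {v \<in> N_new \<T>\<^sub>0 \<T> \<inter> N_mark. card (reduced_patch \<T> v) \<in> {2, 4}}"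

definition block_step :: "element set \<Rightarrow> point set \<Rightarrow> point set" where
  "block_step \<T> B =
     B \<union> {opposite_vertex (tri T) | T. T \<in> red_middle \<T> \<and> vertices (tri T) \<inter> B \<noteq> {}}"

text \<open>
  The iterates increase inside the finite set of nodes, so their union is the value at which the
  loop stops.
\<close>

definition N_block :: "triangle set \<Rightarrow> element set \<Rightarrow> point set \<Rightarrow> point set" where
  "N_block \<T>\<^sub>0 \<T> N_mark =
     (\<Union>k. (block_step \<T> ^^ k) (nodes (tri ` \<T>) - N_adm_init \<T>\<^sub>0 \<T> N_mark))"

definition N_hang :: "triangle set \<Rightarrow> element set \<Rightarrow> point set \<Rightarrow> point set" where
  "N_hang \<T>\<^sub>0 \<T> N_mark = N_block \<T>\<^sub>0 \<T> N_mark \<inter> N_new \<T>\<^sub>0 \<T>"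

definition N_adm :: "triangle set \<Rightarrow> element set \<Rightarrow> point set \<Rightarrow> point set" where
  "N_adm \<T>\<^sub>0 \<T> N_mark = N_adm_init \<T>\<^sub>0 \<T> N_mark - N_hang \<T>\<^sub>0 \<T> N_mark"

text \<open>
  In the next two definitions \<open>A\<close> and \<open>H\<close> are the admissible and the hanging nodes. In the last
  branch all midpoints are hanging; the blocking loop leaves no further combination.
\<close>

definition coarsen_red :: "point set \<Rightarrow> point set \<Rightarrow> element \<Rightarrow> element set" where
  "coarsen_red A H F =
     (let m12 = mid12 (tri F); m23 = mid23 (tri F); m31 = mid31 (tri F) in
      if m12 \<in> A \<and> m23 \<in> A \<and> m31 \<in> A then {F}
      else if m12 \<in> H \<and> m23 \<in> A \<and> m31 \<in> A then children Green F
      else if m12 \<in> H \<and> m31 \<in> H \<and> m23 \<in> A then children Blue_l F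
      else if m12 \<in> H \<and> m23 \<in> H \<and> m31 \<in> A then children Blue_r F
      else children Red F)"

definition coarsen_green :: "point set \<Rightarrow> element \<Rightarrow> element set" where
  "coarsen_green A F = (if mid12 (tri F) \<in> A then {F} else children Green F)"

definition coarsen :: "triangle set \<Rightarrow> element set \<Rightarrow> point set \<Rightarrow> element set" where
  "coarsen \<T>\<^sub>0 \<T> N_mark =
     (let A = N_adm \<T>\<^sub>0 \<T> N_mark;
          H = N_hang \<T>\<^sub>0 \<T> N_mark;
          red_fathers = {F. R4 F \<in> red_middle \<T>};
          green_fathers = {F. children Green F \<subseteq> \<T>}
      in (\<T> - (\<Union>F\<in>red_fathers. children Red F) - (\<Union>F\<in>green_fathers. children Green F))
         \<union> (\<Union>F\<in>red_fathers. coarsen_red A H F)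
         \<union> (\<Union>F\<in>green_fathers. coarsen_green A F))"

end

theory Submission
  imports Defs
begin

text \<open>
  A node that is newest vertex of an element is the midpoint of an edge that was bisected at some
  earlier step, on both sides at once, so at most two subdivided triangles contribute to its patch.
  Each of them contributes at least two elements that are not red middle elements. The one whose
  element has the node as newest vertex contributes at most three, because the edges of an
  unrefined element are not bisected, which limits the refinement of its neighbours. Hence if the
  patch has two or four elements, every contribution is exactly two, and this forces each of the
  two triangles to carry an unrefined red or green pattern. So the coarsening step really removes
  all admissible nodes. The blocking loop ensures that the remaining midpoints of a red pattern are
  exactly those of one of the RGB patterns, so no hanging node is left; for triangles with disjoint
  interiors this already implies conformity.

  Red refinement does not change the shape of a triangle, and iterated green refinement produces
  only four shapes up to scaling and rotation by a half turn; this gives shape regularity.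
\<close>

section \<open>Orientation and the children of a triangle\<close>

text \<open>The delicate point is what a count of two says about one subdivided triangle. If both
  green children of a triangle are refined red, only their two \<open>R3\<close> children remain at
  the node, so a contribution of two does not by itself mean an unrefined pattern; some edge ending
  at the node must be known to be unbisected. On the side of the element with the newest vertex this
  is known: its pattern is recognised first, the two halves of the common edge are then seen to be
  unbisected, and this fact is handed to the triangle across the edge. The bound three excludes that
  four elements all lie on one side. The triangles that were bisected when a node was created are
  not visible in the final mesh; therefore every node comes with an intermediate mesh from the
  refinement history. Conformity of the output is not checked edge by edge. Input and output arise
  from one common coarse mesh by one pattern per element, and in each coarse element the new pattern
  is determined by one global set of surviving nodes, so neighbours agree automatically.\<close>

definition orient :: "point \<Rightarrow> point \<Rightarrow> point \<Rightarrow> real" where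
  "orient a b c = (b$1 - a$1) * (c$2 - a$2) - (b$2 - a$2) * (c$1 - a$1)"

lemma ccw_iff_orient [simp]: "ccw (a, b, c) \<longleftrightarrow> 0 < orient a b c"
  by (simp add: orient_def)

declare ccw.simps [simp del]

lemma midpoint_nth: "midpoint x y $ i = (x $ i + y $ i) / 2" for x y :: point
  by (simp add: midpoint_def)

lemma orient_midpoint [simp]:
  "orient (midpoint a a') b c = (orient a b c + orient a' b c) / 2"
  "orient a (midpoint b b') c = (orient a b c + orient a b' c) / 2"
  "orient a b (midpoint c c') = (orient a b c + orient a b c') / 2"
  by (simp_all add: orient_def midpoint_nth field_simps)

lemma orient_degenerate [simp]: "orient a a b = 0" "orient a b a = 0" "orient a b b = 0"
  by (simp_all add: orient_def)

lemma orient_swap: "orient a b c = - orient b a c"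
  by (simp add: orient_def algebra_simps)

lemma orient_rotate: "orient b c a = orient a b c"
  by (simp add: orient_def algebra_simps)

lemma orient_sum: "orient a b x + orient b c x + orient c a x = orient a b c"
  by (simp add: orient_def algebra_simps)

lemma orient_scaleR_add:
  assumes "u + v + w = 1"
  shows "orient p q (u *\<^sub>R a + v *\<^sub>R b + w *\<^sub>R c) = u * orient p q a + v * orient p q b + w * orient p q c"
proof -
  have u: "u = 1 - v - w" using assms by simp
  show ?thesis unfolding u by (simp add: orient_def algebra_simps)
qed

lemma orient_closed_segment:
  assumes "x \<in> closed_segment a b"
  shows "orient a b x = 0"
proof -
  obtain u where x: "x = (1 - u) *\<^sub>R a + u *\<^sub>R b"
    using assms by (auto simp: closed_segment_def)
  show ?thesis unfolding x by (simp add: orient_def algebra_simps)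
qed

text \<open>\<open>orient\<close> is twice a signed area, so its three values at x, divided by
  \<open>orient a b c\<close>, are the barycentric coordinates of x. Incidences are thereby reduced
  to linear inequalities.\<close>

lemma convex_hull_ccw:
  assumes "0 < orient a b c"
  shows "convex hull {a, b, c} = {x. 0 \<le> orient a b x \<and> 0 \<le> orient b c x \<and> 0 \<le> orient c a x}"
proof (intro equalityI subsetI)
  fix x assume "x \<in> convex hull {a, b, c}"
  then obtain u v w where "0 \<le> u" "0 \<le> v" "0 \<le> w" and s: "u + v + w = 1"
    and x: "x = u *\<^sub>R a + v *\<^sub>R b + w *\<^sub>R c"
    by (auto simp: convex_hull_3)
  then show "x \<in> {x. 0 \<le> orient a b x \<and> 0 \<le> orient b c x \<and> 0 \<le> orient c a x}"
    using assms orient_rotate[of a b c] orient_rotate[of b c a] 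
    by (simp add: orient_scaleR_add)
next
  fix x assume x: "x \<in> {x. 0 \<le> orient a b x \<and> 0 \<le> orient b c x \<and> 0 \<le> orient c a x}"
  define D where "D = orient a b c"
  have D: "D > 0" using assms by (simp add: D_def)
  \<comment> \<open>Cramer's rule for the barycentric coordinates, cleared of denominators.\<close>
  have "D *\<^sub>R x = orient b c x *\<^sub>R a + orient c a x *\<^sub>R b + orient a b x *\<^sub>R c"
    by (simp add: vec_eq_iff forall_2 D_def orient_def algebra_simps)
  then have "x = (1 / D) *\<^sub>R (orient b c x *\<^sub>R a + orient c a x *\<^sub>R b + orient a b x *\<^sub>R c)"
    using D by (metis divideR_right scaleR_one less_irrefl divide_inverse mult_1 inverse_eq_divide)
  then have "x = (orient b c x / D) *\<^sub>R a + (orient c a x / D) *\<^sub>R b + (orient a b x / D) *\<^sub>R c"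
    by (simp add: scaleR_add_right)
  moreover have "orient b c x / D + orient c a x / D + orient a b x / D = 1"
    using D orient_sum[of a b x c] by (simp add: D_def flip: add_divide_distrib)
  ultimately show "x \<in> convex hull {a, b, c}"
    using x D unfolding convex_hull_3 by (smt (verit, best) divide_nonneg_pos mem_Collect_eq)
qed

lemma interior_orient:
  assumes "a \<noteq> b"
  shows "interior {x. 0 \<le> orient a b x} = {x. 0 < orient a b x}"
proof -
  \<comment> \<open>The edge vector b - a turned left by a right angle, a normal pointing into the
    half plane.\<close>
  define n :: point where "n = vector [a$2 - b$2, b$1 - a$1]"
  have *: "orient a b x = n \<bullet> x - n \<bullet> a" for x
    by (simp add: orient_def n_def inner_vec_def sum_2 algebra_simps)
  have "n \<noteq> 0" using assms by (auto simp: n_def vec_eq_iff forall_2)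
  then show ?thesis using interior_halfspace_ge[of n "n \<bullet> a"] by (simp add: *)
qed

lemma interior_convex_hull_ccw:
  assumes "0 < orient a b c"
  shows "interior (convex hull {a, b, c}) = {x. 0 < orient a b x \<and> 0 < orient b c x \<and> 0 < orient c a x}"
proof -
  have "a \<noteq> b" "b \<noteq> c" "c \<noteq> a" using assms by auto
  moreover have "convex hull {a, b, c} = {x. 0 \<le> orient a b x} \<inter> {x. 0 \<le> orient b c x} \<inter> {x. 0 \<le> orient c a x}"
    using convex_hull_ccw[OF assms] by auto
  ultimately show ?thesis by (auto simp: interior_orient)
qed


text \<open>Every child is described in the unnormalised barycentric coordinates of the father,
  whose sum is constant. The red cuts are the lines on which one coordinate equals the sum of the
  other two; the green cut is the line on which the coordinates of \<open>v1\<close> and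
  \<open>v2\<close> agree. Covering and disjointness then become linear arithmetic.\<close>

lemma hull_children:
  assumes "tri F = (v1, v2, v3)" and "0 < orient v1 v2 v3"
  shows "x \<in> hull_of (tri (R1 F)) \<longleftrightarrow> 0 \<le> orient v3 v1 x \<and> 0 \<le> orient v1 v2 x \<and>
          orient v3 v1 x + orient v1 v2 x \<le> orient v2 v3 x"
    and "x \<in> hull_of (tri (R2 F)) \<longleftrightarrow> 0 \<le> orient v1 v2 x \<and> 0 \<le> orient v2 v3 x \<and>
          orient v1 v2 x + orient v2 v3 x \<le> orient v3 v1 x"
    and "x \<in> hull_of (tri (R3 F)) \<longleftrightarrow> 0 \<le> orient v2 v3 x \<and> 0 \<le> orient v3 v1 x \<and>
          orient v2 v3 x + orient v3 v1 x \<le> orient v1 v2 x"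
    and "x \<in> hull_of (tri (R4 F)) \<longleftrightarrow> orient v2 v3 x \<le> orient v3 v1 x + orient v1 v2 x \<and>
          orient v3 v1 x \<le> orient v1 v2 x + orient v2 v3 x \<and>
          orient v1 v2 x \<le> orient v2 v3 x + orient v3 v1 x"
    and "x \<in> hull_of (tri (G1 F)) \<longleftrightarrow> 0 \<le> orient v3 v1 x \<and> 0 \<le> orient v1 v2 x \<and>
          orient v3 v1 x \<le> orient v2 v3 x"
    and "x \<in> hull_of (tri (G2 F)) \<longleftrightarrow> 0 \<le> orient v2 v3 x \<and> 0 \<le> orient v1 v2 x \<and>
          orient v2 v3 x \<le> orient v3 v1 x"
    and hull_father: "x \<in> hull_of (tri F) \<longleftrightarrow> 0 \<le> orient v2 v3 x \<and> 0 \<le> orient v3 v1 x \<and>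
          0 \<le> orient v1 v2 x"
proof -
  note sw = orient_swap[of v2 v1] orient_swap[of v3 v2] orient_swap[of v1 v3]
  have rot: "orient v2 v3 v1 = orient v1 v2 v3" "orient v3 v1 v2 = orient v1 v2 v3"
    by (simp_all add: orient_def algebra_simps)
  note s = orient_sum[of v1 v2 x v3]
  show "x \<in> hull_of (tri (R1 F)) \<longleftrightarrow> 0 \<le> orient v3 v1 x \<and> 0 \<le> orient v1 v2 x \<and>
          orient v3 v1 x + orient v1 v2 x \<le> orient v2 v3 x"
    "x \<in> hull_of (tri (R2 F)) \<longleftrightarrow> 0 \<le> orient v1 v2 x \<and> 0 \<le> orient v2 v3 x \<and>
          orient v1 v2 x + orient v2 v3 x \<le> orient v3 v1 x"
    "x \<in> hull_of (tri (R3 F)) \<longleftrightarrow> 0 \<le> orient v2 v3 x \<and> 0 \<le> orient v3 v1 x \<and>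
          orient v2 v3 x + orient v3 v1 x \<le> orient v1 v2 x"
    "x \<in> hull_of (tri (R4 F)) \<longleftrightarrow> orient v2 v3 x \<le> orient v3 v1 x + orient v1 v2 x \<and>
          orient v3 v1 x \<le> orient v1 v2 x + orient v2 v3 x \<and>
          orient v1 v2 x \<le> orient v2 v3 x + orient v3 v1 x"
    "x \<in> hull_of (tri (G1 F)) \<longleftrightarrow> 0 \<le> orient v3 v1 x \<and> 0 \<le> orient v1 v2 x \<and>
          orient v3 v1 x \<le> orient v2 v3 x"
    "x \<in> hull_of (tri (G2 F)) \<longleftrightarrow> 0 \<le> orient v2 v3 x \<and> 0 \<le> orient v1 v2 x \<and>
          orient v2 v3 x \<le> orient v3 v1 x"
    "x \<in> hull_of (tri F) \<longleftrightarrow> 0 \<le> orient v2 v3 x \<and> 0 \<le> orient v3 v1 x \<and>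
          0 \<le> orient v1 v2 x"
    using assms(2) s by (auto simp: assms(1) convex_hull_ccw sw rot field_simps)
qed

lemma interior_children:
  assumes "tri F = (v1, v2, v3)" and "0 < orient v1 v2 v3"
  shows "x \<in> interior (hull_of (tri (R1 F))) \<longleftrightarrow> 0 < orient v3 v1 x \<and> 0 < orient v1 v2 x \<and>
          orient v3 v1 x + orient v1 v2 x < orient v2 v3 x"
    and "x \<in> interior (hull_of (tri (R2 F))) \<longleftrightarrow> 0 < orient v1 v2 x \<and> 0 < orient v2 v3 x \<and>
          orient v1 v2 x + orient v2 v3 x < orient v3 v1 x"
    and "x \<in> interior (hull_of (tri (R3 F))) \<longleftrightarrow> 0 < orient v2 v3 x \<and> 0 < orient v3 v1 x \<and>
          orient v2 v3 x + orient v3 v1 x < orient v1 v2 x"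
    and "x \<in> interior (hull_of (tri (R4 F))) \<longleftrightarrow> orient v2 v3 x < orient v3 v1 x + orient v1 v2 x \<and>
          orient v3 v1 x < orient v1 v2 x + orient v2 v3 x \<and>
          orient v1 v2 x < orient v2 v3 x + orient v3 v1 x"
    and "x \<in> interior (hull_of (tri (G1 F))) \<longleftrightarrow> 0 < orient v3 v1 x \<and> 0 < orient v1 v2 x \<and>
          orient v3 v1 x < orient v2 v3 x"
    and "x \<in> interior (hull_of (tri (G2 F))) \<longleftrightarrow> 0 < orient v2 v3 x \<and> 0 < orient v1 v2 x \<and>
          orient v2 v3 x < orient v3 v1 x"
proof -
  note sw = orient_swap[of v2 v1] orient_swap[of v3 v2] orient_swap[of v1 v3]
  have rot: "orient v2 v3 v1 = orient v1 v2 v3" "orient v3 v1 v2 = orient v1 v2 v3"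
    by (simp_all add: orient_def algebra_simps)
  note s = orient_sum[of v1 v2 x v3]
  show "x \<in> interior (hull_of (tri (R1 F))) \<longleftrightarrow> 0 < orient v3 v1 x \<and> 0 < orient v1 v2 x \<and>
          orient v3 v1 x + orient v1 v2 x < orient v2 v3 x"
    "x \<in> interior (hull_of (tri (R2 F))) \<longleftrightarrow> 0 < orient v1 v2 x \<and> 0 < orient v2 v3 x \<and>
          orient v1 v2 x + orient v2 v3 x < orient v3 v1 x"
    "x \<in> interior (hull_of (tri (R3 F))) \<longleftrightarrow> 0 < orient v2 v3 x \<and> 0 < orient v3 v1 x \<and>
          orient v2 v3 x + orient v3 v1 x < orient v1 v2 x"
    "x \<in> interior (hull_of (tri (R4 F))) \<longleftrightarrow> orient v2 v3 x < orient v3 v1 x + orient v1 v2 x \<and>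
          orient v3 v1 x < orient v1 v2 x + orient v2 v3 x \<and>
          orient v1 v2 x < orient v2 v3 x + orient v3 v1 x"
    "x \<in> interior (hull_of (tri (G1 F))) \<longleftrightarrow> 0 < orient v3 v1 x \<and> 0 < orient v1 v2 x \<and>
          orient v3 v1 x < orient v2 v3 x"
    "x \<in> interior (hull_of (tri (G2 F))) \<longleftrightarrow> 0 < orient v2 v3 x \<and> 0 < orient v1 v2 x \<and>
          orient v2 v3 x < orient v3 v1 x"
    using assms(2) s by (auto simp: assms(1) interior_convex_hull_ccw sw rot field_simps)
qed

lemma ccw_children [simp]:
  "ccw (tri (R1 F)) = ccw (tri F)" "ccw (tri (R2 F)) = ccw (tri F)"
  "ccw (tri (R3 F)) = ccw (tri F)" "ccw (tri (R4 F)) = ccw (tri F)"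
  "ccw (tri (G1 F)) = ccw (tri F)" "ccw (tri (G2 F)) = ccw (tri F)"
proof -
  obtain v1 v2 v3 where F: "tri F = (v1, v2, v3)" by (metis prod_cases3)
  note sw = orient_swap[of v2 v1] orient_swap[of v3 v2] orient_swap[of v1 v3]
  have rot: "orient v2 v3 v1 = orient v1 v2 v3" "orient v3 v1 v2 = orient v1 v2 v3"
    by (simp_all add: orient_def algebra_simps)
  show "ccw (tri (R1 F)) = ccw (tri F)" "ccw (tri (R2 F)) = ccw (tri F)"
    "ccw (tri (R3 F)) = ccw (tri F)" "ccw (tri (R4 F)) = ccw (tri F)"
    "ccw (tri (G1 F)) = ccw (tri F)" "ccw (tri (G2 F)) = ccw (tri F)"
    by (simp_all add: F sw rot)
qed

section \<open>Subdivisions of an element\<close>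

declare tri.simps(2-) [simp del]

abbreviation region :: "element \<Rightarrow> point set" where "region X \<equiv> hull_of (tri X)"
abbreviation vert :: "element \<Rightarrow> point set" where "vert X \<equiv> vertices (tri X)"

fun mids :: "triangle \<Rightarrow> point set" where
  "mids (v1, v2, v3) = {midpoint v1 v2, midpoint v2 v3, midpoint v3 v1}"

lemma tri_cases:
  assumes "ccw (tri F)"
  obtains v1 v2 v3 where "tri F = (v1, v2, v3)" and "0 < orient v1 v2 v3"
  by (metis assms ccw_iff_orient prod_cases3)

lemma vert_subset_hull: "vert X \<subseteq> region X"
  by (cases "tri X") (auto intro: hull_inc)

lemma vertE: "x \<in> vert X \<Longrightarrow> x \<in> region X"
  using vert_subset_hull by blast

lemma convex_region: "convex (region X)"
  by (cases "tri X") simp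

lemma orient_vertices:
  assumes "0 < orient v1 v2 v3"
  shows "orient v2 v3 v1 = orient v1 v2 v3" "orient v3 v1 v2 = orient v1 v2 v3"
    "v1 \<noteq> v2" "v2 \<noteq> v3" "v3 \<noteq> v1" "v2 \<noteq> v1" "v3 \<noteq> v2" "v1 \<noteq> v3"
  using assms by (auto simp: orient_def algebra_simps)

lemma interior_hull_nonempty:
  assumes "ccw (tri X)"
  shows "interior (region X) \<noteq> {}"
proof -
  obtain v1 v2 v3 where X: "tri X = (v1, v2, v3)" "0 < orient v1 v2 v3" using assms by (rule tri_cases)
  \<comment> \<open>The point with barycentric weights 1/2, 1/4, 1/4.\<close>
  have "midpoint v1 (midpoint v2 v3) \<in> interior (region X)"
    using X by (simp add: interior_convex_hull_ccw orient_vertices)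
  then show ?thesis by blast
qed

lemma mids_disjoint_vert:
  assumes "ccw (tri E)"
  shows "mids (tri E) \<inter> vert E = {}"
proof -
  obtain v1 v2 v3 where E: "tri E = (v1, v2, v3)" "0 < orient v1 v2 v3" using assms by (rule tri_cases)
  have "orient v1 v2 v3 \<noteq> 0" using E(2) by simp
  then have "midpoint v1 v2 \<noteq> v3" "midpoint v2 v3 \<noteq> v1" "midpoint v3 v1 \<noteq> v2"
    using orient_vertices[OF E(2)] orient_midpoint orient_degenerate by (metis add_0 div_0)+
  then show ?thesis using orient_vertices[OF E(2)] by (auto simp: E(1))
qed

lemma mids_subset_hull:
  assumes "ccw (tri E)"
  shows "mids (tri E) \<subseteq> region E"
proof -
  obtain v1 v2 v3 where E: "tri E = (v1, v2, v3)" "0 < orient v1 v2 v3" using assms by (rule tri_cases)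
  then show ?thesis using orient_vertices[OF E(2)] hull_father[OF E] by (auto simp: E(1))
qed

lemma hull_red:
  assumes "ccw (tri E)"
  shows "region (R1 E) \<union> region (R2 E) \<union> region (R3 E) \<union> region (R4 E) = region E"
proof -
  obtain v1 v2 v3 where E: "tri E = (v1, v2, v3)" "0 < orient v1 v2 v3" using assms by (rule tri_cases)
  show ?thesis by (auto simp only: set_eq_iff Un_iff hull_children[OF E]; linarith)
qed

lemma hull_green:
  assumes "ccw (tri E)"
  shows "region (G1 E) \<union> region (G2 E) = region E"
proof -
  obtain v1 v2 v3 where E: "tri E = (v1, v2, v3)" "0 < orient v1 v2 v3" using assms by (rule tri_cases)
  show ?thesis by (auto simp only: set_eq_iff Un_iff hull_children[OF E]; linarith)
qed

text \<open>Serves to show that no triangle can be the father of a red and of a green pattern in the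
  same mesh.\<close>

lemma hull_R1_subset_hull_G1:
  assumes "ccw (tri E)"
  shows "region (R1 E) \<subseteq> region (G1 E)"
proof -
  obtain v1 v2 v3 where E: "tri E = (v1, v2, v3)" "0 < orient v1 v2 v3" using assms by (rule tri_cases)
  show ?thesis by (auto simp only: subset_iff hull_children[OF E])
qed

lemma interior_disjoint_red:
  assumes "ccw (tri E)"
  shows "interior (region (R1 E)) \<inter> interior (region (R2 E)) = {}"
    "interior (region (R1 E)) \<inter> interior (region (R3 E)) = {}"
    "interior (region (R1 E)) \<inter> interior (region (R4 E)) = {}"
    "interior (region (R2 E)) \<inter> interior (region (R3 E)) = {}"
    "interior (region (R2 E)) \<inter> interior (region (R4 E)) = {}"
    "interior (region (R3 E)) \<inter> interior (region (R4 E)) = {}"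
proof -
  obtain v1 v2 v3 where E: "tri E = (v1, v2, v3)" "0 < orient v1 v2 v3" using assms by (rule tri_cases)
  show "interior (region (R1 E)) \<inter> interior (region (R2 E)) = {}"
    "interior (region (R1 E)) \<inter> interior (region (R3 E)) = {}"
    "interior (region (R1 E)) \<inter> interior (region (R4 E)) = {}"
    "interior (region (R2 E)) \<inter> interior (region (R3 E)) = {}"
    "interior (region (R2 E)) \<inter> interior (region (R4 E)) = {}"
    "interior (region (R3 E)) \<inter> interior (region (R4 E)) = {}"
    by (auto simp only: set_eq_iff Int_iff interior_children[OF E] empty_iff)
qed

lemma interior_disjoint_green:
  assumes "ccw (tri E)"
  shows "interior (region (G1 E)) \<inter> interior (region (G2 E)) = {}"
proof -
  obtain v1 v2 v3 where E: "tri E = (v1, v2, v3)" "0 < orient v1 v2 v3" using assms by (rule tri_cases)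
  show ?thesis by (auto simp only: set_eq_iff Int_iff interior_children[OF E] empty_iff)
qed

lemma vert_red:
  assumes "ccw (tri E)" and "x \<in> vert E \<union> mids (tri E)"
  shows "x \<in> region (R1 E) \<Longrightarrow> x \<in> vert (R1 E)" "x \<in> region (R2 E) \<Longrightarrow> x \<in> vert (R2 E)"
    "x \<in> region (R3 E) \<Longrightarrow> x \<in> vert (R3 E)" "x \<in> region (R4 E) \<Longrightarrow> x \<in> vert (R4 E)"
proof -
  obtain v1 v2 v3 where E: "tri E = (v1, v2, v3)" "0 < orient v1 v2 v3" using assms(1) by (rule tri_cases)
  note o = orient_vertices[OF E(2)]
  have x: "x = v1 \<or> x = v2 \<or> x = v3 \<or> x = midpoint v1 v2 \<or> x = midpoint v2 v3 \<or> x = midpoint v3 v1"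
    using assms(2) by (auto simp: E(1))
  have "(x \<in> region (R1 E) \<longrightarrow> x \<in> vert (R1 E)) \<and> (x \<in> region (R2 E) \<longrightarrow> x \<in> vert (R2 E)) \<and>
    (x \<in> region (R3 E) \<longrightarrow> x \<in> vert (R3 E)) \<and> (x \<in> region (R4 E) \<longrightarrow> x \<in> vert (R4 E))"
    unfolding hull_children[OF E] using x E(2) by (elim disjE) (simp_all add: E(1) o tri.simps)
  then show "x \<in> region (R1 E) \<Longrightarrow> x \<in> vert (R1 E)" "x \<in> region (R2 E) \<Longrightarrow> x \<in> vert (R2 E)"
    "x \<in> region (R3 E) \<Longrightarrow> x \<in> vert (R3 E)" "x \<in> region (R4 E) \<Longrightarrow> x \<in> vert (R4 E)"
    by blast+
qed

text \<open>The exceptional point is the midpoint of the reference edge of the green child, exactly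
  where the second step of a blue pattern would cut it.\<close>

lemma vert_green:
  assumes "ccw (tri E)" and "x \<in> vert E \<union> mids (tri E)"
  shows "x \<in> region (G1 E) \<Longrightarrow> x \<in> vert (G1 E) \<union> {mid31 (tri E)}"
    "x \<in> region (G2 E) \<Longrightarrow> x \<in> vert (G2 E) \<union> {mid23 (tri E)}"
proof -
  obtain v1 v2 v3 where E: "tri E = (v1, v2, v3)" "0 < orient v1 v2 v3" using assms(1) by (rule tri_cases)
  note o = orient_vertices[OF E(2)]
  have x: "x = v1 \<or> x = v2 \<or> x = v3 \<or> x = midpoint v1 v2 \<or> x = midpoint v2 v3 \<or> x = midpoint v3 v1"
    using assms(2) by (auto simp: E(1))
  have "(x \<in> region (G1 E) \<longrightarrow> x \<in> vert (G1 E) \<union> {mid31 (tri E)}) \<and>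
    (x \<in> region (G2 E) \<longrightarrow> x \<in> vert (G2 E) \<union> {mid23 (tri E)})"
    unfolding hull_children[OF E] using x E(2) by (elim disjE) (simp_all add: E(1) o tri.simps)
  then show "x \<in> region (G1 E) \<Longrightarrow> x \<in> vert (G1 E) \<union> {mid31 (tri E)}"
    "x \<in> region (G2 E) \<Longrightarrow> x \<in> vert (G2 E) \<union> {mid23 (tri E)}"
    by blast+
qed

text \<open>The leaves of a finite refinement tree with root E. The order of the refinement steps is
  forgotten, and blue patterns appear as nested green steps.\<close>

inductive subdivides :: "element \<Rightarrow> element set \<Rightarrow> bool" where
  leaf: "subdivides E {E}"
| red: "subdivides (R1 E) S1 \<Longrightarrow> subdivides (R2 E) S2 \<Longrightarrow> subdivides (R3 E) S3 \<Longrightarrow>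
    subdivides (R4 E) S4 \<Longrightarrow> subdivides E (S1 \<union> S2 \<union> S3 \<union> S4)"
| green: "subdivides (G1 E) S1 \<Longrightarrow> subdivides (G2 E) S2 \<Longrightarrow> subdivides E (S1 \<union> S2)"

lemma subdivides_finite: "subdivides E S \<Longrightarrow> finite S"
  by (induction rule: subdivides.induct) auto

lemma subdivides_ccw: "subdivides E S \<Longrightarrow> X \<in> S \<Longrightarrow> ccw (tri X) = ccw (tri E)"
  by (induction rule: subdivides.induct) auto

lemma subdivides_hull: "subdivides E S \<Longrightarrow> ccw (tri E) \<Longrightarrow> (\<Union>X\<in>S. region X) = region E"
proof (induction rule: subdivides.induct)
  case (red E S1 S2 S3 S4)
  have "(\<Union>X\<in>S1 \<union> S2 \<union> S3 \<union> S4. region X) = (\<Union>X\<in>S1. region X) \<union> (\<Union>X\<in>S2. region X) \<union>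
      (\<Union>X\<in>S3. region X) \<union> (\<Union>X\<in>S4. region X)"
    by blast
  then show ?case using red.IH red.prems hull_red[of E] by simp
next
  case (green E S1 S2)
  then show ?case using hull_green[of E] by (metis UN_Un ccw_children(5,6))
qed auto

lemma subdivides_hull_subset:
  assumes "subdivides E S" "ccw (tri E)" "X \<in> S"
  shows "region X \<subseteq> region E"
  unfolding subdivides_hull[OF assms(1,2), symmetric] using assms(3) by (rule UN_upper)

lemma subdivides_interior: "subdivides E S \<Longrightarrow> ccw (tri E) \<Longrightarrow> X \<in> S \<Longrightarrow> interior (region X) \<subseteq> interior (region E)"
  by (intro interior_mono subdivides_hull_subset)

lemma subdivides_disjoint_interior:
  assumes "subdivides E S" "subdivides E' S'" "ccw (tri E)" "ccw (tri E')"
    and "interior (region E) \<inter> interior (region E') = {}" "X \<in> S" "Y \<in> S'"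
  shows "interior (region X) \<inter> interior (region Y) = {}"
  using subdivides_interior[OF assms(1,3,6)] subdivides_interior[OF assms(2,4,7)] assms(5) by blast

text \<open>A common leaf would have its nonempty interior inside both roots.\<close>

lemma subdivides_disjoint:
  assumes "subdivides E S" "subdivides E' S'" "ccw (tri E)" "ccw (tri E')"
    and "interior (region E) \<inter> interior (region E') = {}"
  shows "S \<inter> S' = {}"
proof -
  have False if X: "X \<in> S" "X \<in> S'" for X
    using subdivides_disjoint_interior[OF assms X] subdivides_ccw[OF assms(1) X(1)] assms(3)
      interior_hull_nonempty[of X] by simp
  then show ?thesis by blast
qed

text \<open>Elements are compared as genealogies: two different elements with the same triangle of
  positive area count as overlapping. Hence \<open>tri\<close> is injective on a tiling.\<close>

definition nonoverlapping :: "element set \<Rightarrow> element set \<Rightarrow> bool" where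
  "nonoverlapping A B \<longleftrightarrow>
     (\<forall>X\<in>A. \<forall>Y\<in>B. X \<noteq> Y \<longrightarrow> interior (region X) \<inter> interior (region Y) = {})"

lemma nonoverlapping_Un:
  "nonoverlapping (A \<union> B) C \<longleftrightarrow> nonoverlapping A C \<and> nonoverlapping B C"
  "nonoverlapping A (B \<union> C) \<longleftrightarrow> nonoverlapping A B \<and> nonoverlapping A C"
  unfolding nonoverlapping_def by blast+

lemma nonoverlapping_sym: "nonoverlapping A B \<Longrightarrow> nonoverlapping B A"
  unfolding nonoverlapping_def by (metis Int_commute)

lemma subdivides_nonoverlapping2:
  assumes "subdivides E S" "subdivides E' S'" "ccw (tri E)" "ccw (tri E')"
    and "interior (region E) \<inter> interior (region E') = {}"
  shows "nonoverlapping S S'" "nonoverlapping S' S"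
proof -
  show "nonoverlapping S S'"
    unfolding nonoverlapping_def using subdivides_disjoint_interior[OF assms] by blast
  then show "nonoverlapping S' S" by (rule nonoverlapping_sym)
qed

lemma subdivides_nonoverlapping: "subdivides E S \<Longrightarrow> ccw (tri E) \<Longrightarrow> nonoverlapping S S"
proof (induction rule: subdivides.induct)
  case (leaf E)
  then show ?case by (simp add: nonoverlapping_def)
next
  case (red E S1 S2 S3 S4)
  have c: "ccw (tri (R1 E))" "ccw (tri (R2 E))" "ccw (tri (R3 E))" "ccw (tri (R4 E))"
    using red.prems by simp_all
  note d = interior_disjoint_red[OF red.prems(1)]
  show ?case unfolding nonoverlapping_Un
    using red.IH c
      subdivides_nonoverlapping2[OF red.hyps(1,2) c(1,2) d(1)]
      subdivides_nonoverlapping2[OF red.hyps(1,3) c(1,3) d(2)]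
      subdivides_nonoverlapping2[OF red.hyps(1,4) c(1,4) d(3)]
      subdivides_nonoverlapping2[OF red.hyps(2,3) c(2,3) d(4)]
      subdivides_nonoverlapping2[OF red.hyps(2,4) c(2,4) d(5)]
      subdivides_nonoverlapping2[OF red.hyps(3,4) c(3,4) d(6)]
    by simp
next
  case (green E S1 S2)
  have c: "ccw (tri (G1 E))" "ccw (tri (G2 E))" using green.prems by simp_all
  show ?case unfolding nonoverlapping_Un
    using green.IH c
      subdivides_nonoverlapping2[OF green.hyps(1,2) c interior_disjoint_green[OF green.prems(1)]]
    by simp
qed

lemma subdivides_trans:
  assumes "subdivides E S" and "\<And>X. X \<in> S \<Longrightarrow> subdivides X (f X)"
  shows "subdivides E (\<Union>X\<in>S. f X)"
  using assms
proof (induction rule: subdivides.induct)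
  case (red E S1 S2 S3 S4)
  then show ?case unfolding UN_Un by (intro subdivides.red) auto
next
  case (green E S1 S2)
  then show ?case unfolding UN_Un by (intro subdivides.green) auto
qed auto

lemma subdivides_Red: "subdivides E (children Red E)"
  using subdivides.red[OF leaf leaf leaf leaf, of E] by (simp add: insert_commute)

lemma subdivides_Green: "subdivides E (children Green E)"
  using subdivides.green[OF leaf leaf, of E] by (simp add: insert_commute)

lemma subdivides_children: "subdivides E (children p E)"
proof (cases p)
  case Blue_r
  have "children p E = {G1 E} \<union> children Green (G2 E)" using Blue_r by auto
  then show ?thesis using green[OF leaf subdivides_Green, of E] by simp
next
  case Blue_l
  have "children p E = children Green (G1 E) \<union> {G2 E}" using Blue_l by auto
  then show ?thesis using green[OF subdivides_Green leaf, of E] by simp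
qed (use subdivides_Red subdivides_Green leaf in auto)

lemma nodes_Un: "nodes (A \<union> B) = nodes A \<union> nodes B"
  by (auto simp: nodes_def)

lemma vert_subset_red: "vert E \<subseteq> vert (R1 E) \<union> vert (R2 E) \<union> vert (R3 E)"
  and vert_subset_green: "vert E \<subseteq> vert (G1 E) \<union> vert (G2 E)"
  by (cases "tri E"; auto simp: tri.simps)+

lemma subdivides_vert: "subdivides E S \<Longrightarrow> vert E \<subseteq> nodes (tri ` S)"
proof (induction rule: subdivides.induct)
  case (red E S1 S2 S3 S4)
  then show ?case using vert_subset_red[of E] by (auto simp only: image_Un nodes_Un)
next
  case (green E S1 S2)
  then show ?case using vert_subset_green[of E] by (auto simp only: image_Un nodes_Un)
qed (auto simp: nodes_def)

text \<open>
  The newest vertex of a proper descendant of \<open>E\<close> is the midpoint of an edge that was bisected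
  inside \<open>E\<close>, hence not a vertex of \<open>E\<close>.
\<close>
lemma subdivides_old_vertex:
  assumes "subdivides E S" "ccw (tri E)" "x \<in> vert E" "X \<in> S" "x \<in> region X"
  shows "x \<in> vert X \<and> (is_newest_vertex x X \<longrightarrow> X = E)"
  using assms
proof (induction rule: subdivides.induct)
  case (leaf E)
  then show ?case by auto
next
  case (red E S1 S2 S3 S4)
  have nm: "x \<notin> mids (tri E)" using mids_disjoint_vert red.prems(1,2) by blast
  have c: "ccw (tri (R1 E))" "ccw (tri (R2 E))" "ccw (tri (R3 E))" "ccw (tri (R4 E))"
    using red.prems by simp_all
  have x: "x \<in> vert E \<union> mids (tri E)" using red.prems by simp
  \<comment> \<open>Newest vertices of children are midpoints of the father. \<open>R3\<close>,
    whose opposite vertex is an old one, is covered by the exception in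
    \<open>is_newest_vertex\<close>.\<close>
  have n: "\<not> is_newest_vertex x (R1 E)" "\<not> is_newest_vertex x (R2 E)" "\<not> is_newest_vertex x (R3 E)"
    "\<not> is_newest_vertex x (R4 E)" using nm by (cases "tri E"; simp add: is_newest_vertex_def tri.simps)+
  consider "X \<in> S1" | "X \<in> S2" | "X \<in> S3" | "X \<in> S4" using red.prems by blast
  then show ?case
  proof cases
    case 1
    have "x \<in> region (R1 E)" using subdivides_hull_subset[OF red.hyps(1) c(1) 1] red.prems by blast
    then show ?thesis using red.IH(1)[OF c(1) _ 1] vert_red(1)[OF red.prems(1) x] red.prems n by blast
  next
    case 2
    have "x \<in> region (R2 E)" using subdivides_hull_subset[OF red.hyps(2) c(2) 2] red.prems by blast
    then show ?thesis using red.IH(2)[OF c(2) _ 2] vert_red(2)[OF red.prems(1) x] red.prems n by blast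
  next
    case 3
    have "x \<in> region (R3 E)" using subdivides_hull_subset[OF red.hyps(3) c(3) 3] red.prems by blast
    then show ?thesis using red.IH(3)[OF c(3) _ 3] vert_red(3)[OF red.prems(1) x] red.prems n by blast
  next
    case 4
    have "x \<in> region (R4 E)" using subdivides_hull_subset[OF red.hyps(4) c(4) 4] red.prems by blast
    then show ?thesis using red.IH(4)[OF c(4) _ 4] vert_red(4)[OF red.prems(1) x] red.prems n by blast
  qed
next
  case (green E S1 S2)
  have nm: "x \<notin> mids (tri E)" using mids_disjoint_vert green.prems(1,2) by blast
  have c: "ccw (tri (G1 E))" "ccw (tri (G2 E))" using green.prems by simp_all
  have x: "x \<in> vert E \<union> mids (tri E)" using green.prems by simp
  have n: "\<not> is_newest_vertex x (G1 E)" "\<not> is_newest_vertex x (G2 E)" "x \<noteq> mid31 (tri E)" "x \<noteq> mid23 (tri E)"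
    using nm by (cases "tri E"; simp add: is_newest_vertex_def tri.simps)+
  consider "X \<in> S1" | "X \<in> S2" using green.prems by blast
  then show ?case
  proof cases
    case 1
    have "x \<in> region (G1 E)" using subdivides_hull_subset[OF green.hyps(1) c(1) 1] green.prems by blast
    then show ?thesis using green.IH(1)[OF c(1) _ 1] vert_green(1)[OF green.prems(1) x] green.prems n by blast
  next
    case 2
    have "x \<in> region (G2 E)" using subdivides_hull_subset[OF green.hyps(2) c(2) 2] green.prems by blast
    then show ?thesis using green.IH(2)[OF c(2) _ 2] vert_green(2)[OF green.prems(1) x] green.prems n by blast
  qed
qed

section \<open>Tilings and hanging nodes\<close>

definition tiling :: "point set \<Rightarrow> element set \<Rightarrow> bool" where
  "tiling K \<T> \<longleftrightarrow> finite \<T> \<and> (\<forall>X\<in>\<T>. ccw (tri X)) \<and> nonoverlapping \<T> \<T> \<and> (\<Union>X\<in>\<T>. region X) = K"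

definition no_hanging_nodes :: "element set \<Rightarrow> bool" where
  "no_hanging_nodes \<T> \<longleftrightarrow> (\<forall>X\<in>\<T>. nodes (tri ` \<T>) \<inter> region X \<subseteq> vert X)"

definition subdivision :: "element set \<Rightarrow> element set \<Rightarrow> bool" where
  "subdivision \<T> \<T>' \<longleftrightarrow> (\<exists>f. (\<forall>E\<in>\<T>. subdivides E (f E)) \<and> \<T>' = (\<Union>E\<in>\<T>. f E))"

fun sides :: "triangle \<Rightarrow> point set set" where
  "sides (v1, v2, v3) = {{v1, v2}, {v2, v3}, {v3, v1}}"

lemma tiling_triangulation:
  assumes "tiling (closure \<Omega>) \<T>"
  shows "triangulation \<Omega> (tri ` \<T>)"
  using assms unfolding tiling_def triangulation_def nonoverlapping_def by (simp, metis)

lemma tiling_overlap: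
  assumes "tiling K \<T>" "X \<in> \<T>" "Y \<in> \<T>" "interior (region X) \<inter> interior (region Y) \<noteq> {}"
  shows "X = Y"
  using assms unfolding tiling_def nonoverlapping_def by metis

lemma tiling_subdivision:
  assumes T: "tiling K \<T>" and "subdivision \<T> \<T>'"
  shows "tiling K \<T>'"
proof -
  obtain f where f: "\<And>E. E \<in> \<T> \<Longrightarrow> subdivides E (f E)" and T': "\<T>' = (\<Union>E\<in>\<T>. f E)"
    using assms(2) by (auto simp: subdivision_def)
  have c: "\<And>E. E \<in> \<T> \<Longrightarrow> ccw (tri E)" and fin: "finite \<T>" using T by (auto simp: tiling_def)
  have "nonoverlapping (f E) (f E')" if "E \<in> \<T>" "E' \<in> \<T>" for E E'
  proof (cases "E = E'")
    case True
    then show ?thesis using subdivides_nonoverlapping[OF f c] that by blast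
  next
    case False
    then have "interior (region E) \<inter> interior (region E') = {}" using tiling_overlap[OF T that] by blast
    then show ?thesis
      using subdivides_nonoverlapping2(1)[OF f[OF that(1)] f[OF that(2)] c[OF that(1)] c[OF that(2)]] by blast
  qed
  then have "nonoverlapping \<T>' \<T>'" unfolding T' nonoverlapping_def by blast
  moreover have "(\<Union>X\<in>\<T>'. region X) = (\<Union>E\<in>\<T>. region E)"
  proof -
    have "(\<Union>X\<in>\<T>'. region X) = (\<Union>E\<in>\<T>. \<Union>X\<in>f E. region X)" unfolding T' by blast
    also have "\<dots> = (\<Union>E\<in>\<T>. region E)" by (intro SUP_cong refl subdivides_hull f c)
    finally show ?thesis .
  qed
  moreover have "finite \<T>'" unfolding T' using fin f subdivides_finite by blast
  moreover have "\<forall>X\<in>\<T>'. ccw (tri X)" unfolding T' using f c subdivides_ccw by blast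
  ultimately show ?thesis using T unfolding tiling_def by blast
qed

text \<open>A point of U in E lies in some leaf, and every point of a triangle is a limit of
  interior points of that triangle.\<close>

lemma open_meets_interior:
  assumes "subdivides E S" "ccw (tri E)" "open U" "U \<inter> interior (region E) \<noteq> {}"
  shows "\<exists>X\<in>S. U \<inter> interior (region X) \<noteq> {}"
proof -
  obtain x where x: "x \<in> U" "x \<in> region E" using assms(4) interior_subset by blast
  then obtain X where X: "X \<in> S" "x \<in> region X" using subdivides_hull[OF assms(1,2)] by blast
  have "closure (interior (region X)) = closure (region X)"
    using X assms subdivides_ccw interior_hull_nonempty convex_closure_interior convex_region by blast
  then have "x \<in> closure (interior (region X))" using X(2) closure_subset by blast
  then show ?thesis using X(1) x(1) assms(3) open_Int_closure_eq_empty by blast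
qed

text \<open>The reverse of \<open>tiling_subdivision\<close>. If two roots overlap, then so do a
  leaf of one and a leaf of the other; the tiling makes these leaves equal, against the disjointness
  of the two families.\<close>

lemma tiling_unsubdivide:
  assumes T: "tiling K (\<Union>E\<in>\<U>. f E)" and f: "\<And>E. E \<in> \<U> \<Longrightarrow> subdivides E (f E)"
    and c: "\<And>E. E \<in> \<U> \<Longrightarrow> ccw (tri E)" and fin: "finite \<U>"
    and disj: "\<And>E E'. E \<in> \<U> \<Longrightarrow> E' \<in> \<U> \<Longrightarrow> E \<noteq> E' \<Longrightarrow> f E \<inter> f E' = {}"
  shows "tiling K \<U>"
proof -
  have "interior (region E) \<inter> interior (region E') = {}" if E: "E \<in> \<U>" "E' \<in> \<U>" "E \<noteq> E'" for E E'
  proof (rule ccontr)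
    assume "interior (region E) \<inter> interior (region E') \<noteq> {}"
    then obtain X where X: "X \<in> f E" "interior (region E') \<inter> interior (region X) \<noteq> {}"
      using open_meets_interior[OF f[OF E(1)] c[OF E(1)], of "interior (region E')"] by blast
    then have "interior (region X) \<inter> interior (region E') \<noteq> {}" by blast
    then obtain Y where Y: "Y \<in> f E'" "interior (region X) \<inter> interior (region Y) \<noteq> {}"
      using open_meets_interior[OF f[OF E(2)] c[OF E(2)], of "interior (region X)"] by blast
    have "X = Y" by (rule tiling_overlap[OF T _ _ Y(2)]) (use X Y E in blast)+
    then show False using disj[OF E] X(1) Y(1) by blast
  qed
  moreover have "(\<Union>X\<in>(\<Union>E\<in>\<U>. f E). region X) = (\<Union>E\<in>\<U>. region E)"
  proof -
    have "(\<Union>X\<in>(\<Union>E\<in>\<U>. f E). region X) = (\<Union>E\<in>\<U>. \<Union>X\<in>f E. region X)" by blast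
    also have "\<dots> = (\<Union>E\<in>\<U>. region E)" by (intro SUP_cong refl subdivides_hull f c)
    finally show ?thesis .
  qed
  moreover have "(\<Union>X\<in>(\<Union>E\<in>\<U>. f E). region X) = K" using T unfolding tiling_def by (elim conjE)
  ultimately show ?thesis
    unfolding tiling_def nonoverlapping_def using fin c by (intro conjI ballI impI) simp_all
qed

lemma subdivision_trans:
  assumes "subdivision \<T> \<T>'" "subdivision \<T>' \<T>''"
  shows "subdivision \<T> \<T>''"
proof -
  obtain f where f: "\<And>E. E \<in> \<T> \<Longrightarrow> subdivides E (f E)" "\<T>' = (\<Union>E\<in>\<T>. f E)"
    using assms(1) by (auto simp: subdivision_def)
  obtain g where g: "\<And>E. E \<in> \<T>' \<Longrightarrow> subdivides E (g E)" "\<T>'' = (\<Union>E\<in>\<T>'. g E)"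
    using assms(2) by (auto simp: subdivision_def)
  have "subdivides E (\<Union>X\<in>f E. g X)" if "E \<in> \<T>" for E
    using that f g(1) by (intro subdivides_trans) blast+
  moreover have "\<T>'' = (\<Union>E\<in>\<T>. \<Union>X\<in>f E. g X)" unfolding g(2) f(2) by blast
  ultimately show ?thesis unfolding subdivision_def by (intro exI[of _ "\<lambda>E. \<Union>X\<in>f E. g X"]) blast
qed

lemma subdivision_refl: "subdivision \<T> \<T>"
  unfolding subdivision_def by (intro exI[of _ "\<lambda>E. {E}"]) (simp add: leaf)

lemma subdivision_children: "subdivision \<T> (\<Union>T\<in>\<T>. children (p T) T)"
  unfolding subdivision_def by (intro exI[of _ "\<lambda>T. children (p T) T"]) (simp add: subdivides_children)

lemma vert_children:
  assumes "Y \<in> children p X"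
  shows "vert Y \<subseteq> vert X \<union> mids (tri X)"
  using assms by (cases p; cases "tri X"; auto simp: tri.simps)

lemma mids_sides: "x \<in> mids t \<longleftrightarrow> (\<exists>a b. x = midpoint a b \<and> {a, b} \<in> sides t)"
  by (cases t) (auto simp: doubleton_eq_iff midpoint_sym)

lemma edges_sides: "e \<in> edges t \<longleftrightarrow> (\<exists>p q. e = closed_segment p q \<and> {p, q} \<in> sides t)"
  by (cases t) (auto simp: doubleton_eq_iff closed_segment_commute)

lemma sides_vert: "{p, q} \<in> sides t \<Longrightarrow> p \<in> vertices t \<and> q \<in> vertices t"
  by (cases t) (auto simp: doubleton_eq_iff)

text \<open>\<open>orient p q\<close> vanishes along the side pq, but at the midpoint of another
  side it is half its value at the opposite vertex, up to sign, and so nonzero.\<close>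

lemma midpoint_on_side:
  assumes "ccw (tri E)" "{a, b} \<in> sides (tri E)" "{p, q} \<in> sides (tri E)"
    and "midpoint a b \<in> closed_segment p q"
  shows "{p, q} = {a, b}"
proof -
  obtain v1 v2 v3 where E: "tri E = (v1, v2, v3)" "0 < orient v1 v2 v3" using assms(1) by (rule tri_cases)
  show ?thesis
    using assms(2,3) orient_closed_segment[OF assms(4)] E(2) orient_vertices[OF E(2)]
      orient_swap[of v2 v1 v3] orient_swap[of v3 v2 v1] orient_swap[of v1 v3 v2]
    by (auto simp: E(1) doubleton_eq_iff)
qed

text \<open>A midpoint that is not yet a node cannot be a common vertex, so the two triangles share
  an edge through it, and the only side of E through this midpoint is the one with end points a and
  b. This is why an edge is bisected on both sides at once.\<close>

lemma conforming_shared_side: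
  assumes "conforming (tri ` \<T>)" "E \<in> \<T>" "E' \<in> \<T>" "ccw (tri E)" "ccw (tri E')"
    and ab: "{a, b} \<in> sides (tri E)" and "midpoint a b \<notin> nodes (tri ` \<T>)" "midpoint a b \<in> region E'"
  shows "{a, b} \<in> sides (tri E')"
proof (cases "tri E = tri E'")
  case True
  then show ?thesis using ab by simp
next
  case False
  have m: "midpoint a b \<in> region E \<inter> region E'"
    using assms mids_subset_hull[OF assms(4)] mids_sides by blast
  have "\<not> (\<exists>v\<in>vert E \<inter> vert E'. region E \<inter> region E' = {v})"
  proof
    assume "\<exists>v\<in>vert E \<inter> vert E'. region E \<inter> region E' = {v}"
    then obtain v where v: "v \<in> vert E" "region E \<inter> region E' = {v}" by blast
    then have "midpoint a b = v" using m by (simp only: singleton_iff)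
    then have "midpoint a b \<in> vert E" using v(1) by simp
    then show False using assms(2,7) by (auto simp: nodes_def)
  qed
  then obtain e where e: "e \<in> edges (tri E)" "e \<in> edges (tri E')" "region E \<inter> region E' = e"
    using assms(1-3) False m unfolding conforming_def by (metis (lifting) IntE IntI empty_iff imageI)
  obtain p q where pq: "e = closed_segment p q" "{p, q} \<in> sides (tri E)" using e(1) edges_sides by blast
  obtain p' q' where pq': "e = closed_segment p' q'" "{p', q'} \<in> sides (tri E')" using e(2) edges_sides by blast
  have "{p, q} = {a, b}" using midpoint_on_side[OF assms(4) ab pq(2)] m unfolding e(3) pq(1) by blast
  moreover have "{p, q} = {p', q'}" using pq(1) pq'(1) by simp
  ultimately show ?thesis using pq'(2) by simp
qed

lemma conforming_no_hanging_nodes: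
  assumes "conforming (tri ` \<T>)" "\<And>X. X \<in> \<T> \<Longrightarrow> ccw (tri X)"
  shows "no_hanging_nodes \<T>"
  unfolding no_hanging_nodes_def
proof (intro ballI subsetI)
  fix X x assume X: "X \<in> \<T>" and x: "x \<in> nodes (tri ` \<T>) \<inter> region X"
  then obtain Y where Y: "Y \<in> \<T>" "x \<in> vert Y" by (auto simp: nodes_def)
  show "x \<in> vert X"
  proof (cases "tri X = tri Y")
    case False
    have xY: "x \<in> region X \<inter> region Y" using x vertE[OF Y(2)] by blast
    show ?thesis
    proof (cases "\<exists>v\<in>vert X \<inter> vert Y. region X \<inter> region Y = {v}")
      case True
      then obtain v where v: "v \<in> vert X" "region X \<inter> region Y = {v}" by blast
      then have "x = v" using xY by (simp only: singleton_iff)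
      then show ?thesis using v(1) by simp
    next
      case nv: False
      then obtain e where e: "e \<in> edges (tri X)" "e \<in> edges (tri Y)" "region X \<inter> region Y = e"
        using assms(1) X Y(1) False xY unfolding conforming_def by (metis (lifting) IntE IntI empty_iff imageI)
      obtain p q where pq: "e = closed_segment p q" "{p, q} \<in> sides (tri X)" using e(1) edges_sides by blast
      obtain p' q' where pq': "e = closed_segment p' q'" "{p', q'} \<in> sides (tri Y)" using e(2) edges_sides by blast
      obtain v1 v2 v3 where E: "tri Y = (v1, v2, v3)" "0 < orient v1 v2 v3"
        using assms(2)[OF Y(1)] by (rule tri_cases)
      \<comment> \<open>A vertex of Y on the line through one side of Y is an end point of that
        side, since the third vertex is off the line.\<close>
      have "orient p' q' x = 0" using xY orient_closed_segment unfolding e(3) pq'(1) by blast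
      then have "x \<in> {p', q'}"
        using pq'(2) Y(2) E(2) orient_vertices[OF E(2)]
          orient_swap[of v2 v1 v3] orient_swap[of v3 v2 v1] orient_swap[of v1 v3 v2]
        by (auto simp: E(1) doubleton_eq_iff)
      moreover have "{p, q} = {p', q'}" using pq(1) pq'(1) by simp
      ultimately show ?thesis using sides_vert[OF pq(2)] by (auto simp: doubleton_eq_iff)
    qed
  qed (use Y in simp)
qed

section \<open>The intersection of two triangles with disjoint interiors\<close>

lemma convex_hull_supporting_hyperplane:
  fixes V :: "'a::euclidean_space set"
  assumes "compact V" "\<And>v. v \<in> V \<Longrightarrow> n \<bullet> v \<le> k"
  shows "convex hull V \<inter> {x. n \<bullet> x = k} = convex hull (V \<inter> {x. n \<bullet> x = k})"
proof (rule antisym)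
  have "convex hull V \<subseteq> {x. n \<bullet> x \<le> k}"
    using assms(2) by (intro hull_minimal) (auto simp: convex_halfspace_le)
  then have "(convex hull V \<inter> {x. n \<bullet> x = k}) face_of (convex hull V)"
    by (intro face_of_Int_supporting_hyperplane_le convex_convex_hull) auto
  \<comment> \<open>A face of a convex hull is the hull of some of the generating points.\<close>
  then obtain V' where V': "V' \<subseteq> V" "convex hull V \<inter> {x. n \<bullet> x = k} = convex hull V'"
    using face_of_convex_hull_subset[OF assms(1)] by metis
  then have "V' \<subseteq> V \<inter> {x. n \<bullet> x = k}" using hull_subset[of V' convex] by blast
  then show "convex hull V \<inter> {x. n \<bullet> x = k} \<subseteq> convex hull (V \<inter> {x. n \<bullet> x = k})"
    unfolding V'(2) by (rule hull_mono)
  have "convex hull (V \<inter> {x. n \<bullet> x = k}) \<subseteq> {x. n \<bullet> x = k}"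
    by (intro hull_minimal) (auto simp: convex_hyperplane)
  then show "convex hull (V \<inter> {x. n \<bullet> x = k}) \<subseteq> convex hull V \<inter> {x. n \<bullet> x = k}"
    using hull_mono[of "V \<inter> {x. n \<bullet> x = k}" V convex] by blast
qed

lemma closed_segment_line:
  fixes p w :: "'a::real_vector"
  assumes "r \<in> closed_segment s t"
  shows "p + r *\<^sub>R w \<in> closed_segment (p + s *\<^sub>R w) (p + t *\<^sub>R w)"
proof -
  obtain u where u: "r = (1 - u) * s + u * t" "0 \<le> u" "u \<le> 1"
    using assms by (auto simp: closed_segment_def)
  have "p + r *\<^sub>R w = (1 - u) *\<^sub>R (p + s *\<^sub>R w) + u *\<^sub>R (p + t *\<^sub>R w)"
    unfolding u(1) by (simp add: algebra_simps)
  then show ?thesis using u by (auto simp: closed_segment_def)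
qed

lemma closed_segment_line_iff:
  fixes p w :: "'a::real_vector"
  assumes "w \<noteq> 0"
  shows "p + r *\<^sub>R w \<in> closed_segment (p + s *\<^sub>R w) (p + t *\<^sub>R w) \<longleftrightarrow> r \<in> closed_segment s t"
proof
  assume "p + r *\<^sub>R w \<in> closed_segment (p + s *\<^sub>R w) (p + t *\<^sub>R w)"
  then obtain u where u: "0 \<le> u" "u \<le> 1"
    "p + r *\<^sub>R w = (1 - u) *\<^sub>R (p + s *\<^sub>R w) + u *\<^sub>R (p + t *\<^sub>R w)"
    by (auto simp: closed_segment_def)
  then have "(r - ((1 - u) * s + u * t)) *\<^sub>R w = 0" by (simp add: algebra_simps)
  then have "r = (1 - u) * s + u * t" using assms by simp
  then show "r \<in> closed_segment s t" using u by (auto simp: closed_segment_def)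
qed (rule closed_segment_line)

text \<open>The one-dimensional core of conformity. Degenerate pairs are allowed, so that a triangle
  touching the separating line in a single vertex is included.\<close>

lemma collinear_segments_meet:
  fixes z w :: "'a::euclidean_space"
  assumes w: "w \<noteq> 0" and A: "A = {z + s *\<^sub>R w, z + t *\<^sub>R w}" and B: "B = {z + s' *\<^sub>R w, z + t' *\<^sub>R w}"
    and AB: "A \<inter> convex hull B \<subseteq> B" "B \<inter> convex hull A \<subseteq> A"
  shows "convex hull A \<inter> convex hull B \<subseteq> convex hull (A \<inter> B)"
proof -
  \<comment> \<open>Exchanging the end points orders the parameters of both segments.\<close>
  have wlog: "convex hull A \<inter> convex hull B \<subseteq> convex hull (A \<inter> B)"
    if st: "s \<le> t" "s' \<le> t'" and A: "A = {z + s *\<^sub>R w, z + t *\<^sub>R w}" and B: "B = {z + s' *\<^sub>R w, z + t' *\<^sub>R w}"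
      and AB: "A \<inter> convex hull B \<subseteq> B" "B \<inter> convex hull A \<subseteq> A"
    for A B s t s' t'
  proof
    fix x assume x: "x \<in> convex hull A \<inter> convex hull B"
    have hA: "convex hull A = closed_segment (z + s *\<^sub>R w) (z + t *\<^sub>R w)"
      and hB: "convex hull B = closed_segment (z + s' *\<^sub>R w) (z + t' *\<^sub>R w)"
      by (simp_all add: A B segment_convex_hull)
    obtain u where u: "0 \<le> u" "u \<le> 1" "x = (1 - u) *\<^sub>R (z + s *\<^sub>R w) + u *\<^sub>R (z + t *\<^sub>R w)"
      using x unfolding hA by (auto simp: closed_segment_def)
    define r where "r = (1 - u) * s + u * t"
    have xr: "x = z + r *\<^sub>R w" unfolding u(3) r_def by (simp add: algebra_simps)
    have "r \<in> closed_segment s t" "r \<in> closed_segment s' t'"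
      using x unfolding hA hB xr Int_iff closed_segment_line_iff[OF w] by blast+
    then have r: "s \<le> r" "r \<le> t" "s' \<le> r" "r \<le> t'"
      using st by (auto simp: closed_segment_eq_real_ivl)
    have iA: "z + q *\<^sub>R w \<in> A \<longleftrightarrow> q = s \<or> q = t" and iB: "z + q *\<^sub>R w \<in> B \<longleftrightarrow> q = s' \<or> q = t'" for q
      using w by (auto simp: A B)
    have jA: "z + q *\<^sub>R w \<in> convex hull A \<longleftrightarrow> s \<le> q \<and> q \<le> t"
      and jB: "z + q *\<^sub>R w \<in> convex hull B \<longleftrightarrow> s' \<le> q \<and> q \<le> t'" for q
      unfolding hA hB closed_segment_line_iff[OF w] using st by (auto simp: closed_segment_eq_real_ivl)
    have AB': "s' \<le> q \<and> q \<le> t' \<Longrightarrow> q = s' \<or> q = t'" if "q = s \<or> q = t" for q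
      using AB(1) that iA[of q] iB[of q] jB[of q] by blast
    have BA': "s \<le> q \<and> q \<le> t \<Longrightarrow> q = s \<or> q = t" if "q = s' \<or> q = t'" for q
      using AB(2) that iA[of q] iB[of q] jA[of q] by blast
    \<comment> \<open>No end point of one interval lies in the other unless it is an end point there
      too; so intervals with a common point r either meet in a common end point or coincide.\<close>
    have "r = s \<and> (r = s' \<or> r = t') \<or> r = t \<and> (r = s' \<or> r = t') \<or> s = s' \<and> t = t'"
      using AB'[of s] AB'[of t] BA'[of s'] BA'[of t'] r by smt
    then consider "z + r *\<^sub>R w \<in> A \<inter> B" | "A \<inter> B = A"
      using iA iB A B by auto
    then show "x \<in> convex hull (A \<inter> B)"
    proof cases
      case 1
      then show ?thesis unfolding xr by (rule hull_inc)
    next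
      case 2
      then show ?thesis using x by simp
    qed
  qed
  have A': "A = {z + t *\<^sub>R w, z + s *\<^sub>R w}" "B = {z + t' *\<^sub>R w, z + s' *\<^sub>R w}"
    using A B by auto
  consider "s \<le> t" "s' \<le> t'" | "s \<le> t" "t' \<le> s'" | "t \<le> s" "s' \<le> t'" | "t \<le> s" "t' \<le> s'"
    by linarith
  then show ?thesis
  proof cases
    case 1 then show ?thesis by (rule wlog[OF _ _ A B AB])
  next
    case 2 then show ?thesis by (rule wlog[OF _ _ A A'(2) AB])
  next
    case 3 then show ?thesis by (rule wlog[OF _ _ A'(1) B AB])
  next
    case 4 then show ?thesis by (rule wlog[OF _ _ A'(1) A'(2) AB])
  qed
qed

lemma real2_line:
  fixes n z x :: point
  assumes "n \<noteq> 0" "n \<bullet> x = n \<bullet> z"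
  shows "\<exists>s. x = z + s *\<^sub>R vector [- n$2, n$1]"
proof -
  define d where "d = n$1 * n$1 + n$2 * n$2"
  have d: "d \<noteq> 0" using assms(1) by (auto simp: d_def vec_eq_iff forall_2 sum_squares_eq_zero_iff)
  \<comment> \<open>The coefficient of the orthogonal projection of x - z to the rotated
    normal.\<close>
  define s where "s = (n$1 * (x$2 - z$2) - n$2 * (x$1 - z$1)) / d"
  have e: "n$1 * (x$1 - z$1) + n$2 * (x$2 - z$2) = 0"
    using assms(2) by (simp add: inner_vec_def sum_2 algebra_simps)
  have sd: "s * d = n$1 * (x$2 - z$2) - n$2 * (x$1 - z$1)" using d by (simp add: s_def)
  have "(x$1 - z$1 + s * n$2) * d = 0" "(x$2 - z$2 - s * n$1) * d = 0"
    using sd e unfolding d_def by algebra+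
  then have "x$1 = z$1 - s * n$2" "x$2 = z$2 + s * n$1" using d by auto
  then show ?thesis by (intro exI[of _ s]) (simp add: vec_eq_iff forall_2)
qed

lemma ccw_not_on_line:
  assumes "0 < orient a b c" "n \<noteq> 0"
  shows "\<not> (n \<bullet> a = k \<and> n \<bullet> b = k \<and> n \<bullet> c = k)"
proof
  assume k: "n \<bullet> a = k \<and> n \<bullet> b = k \<and> n \<bullet> c = k"
  then obtain s t where b: "b = a + s *\<^sub>R vector [- n$2, n$1]" and c: "c = a + t *\<^sub>R vector [- n$2, n$1]"
    using real2_line[OF assms(2)] by metis
  show False using assms(1) unfolding b c by (simp add: orient_def algebra_simps)
qed

lemma vert_on_line:
  assumes "ccw t" "n \<noteq> 0"
  shows "vertices t \<inter> {x. n \<bullet> x = k} = {} \<or> (\<exists>p q. vertices t \<inter> {x. n \<bullet> x = k} = {p, q})"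
proof -
  obtain a b c where t: "t = (a, b, c)" by (metis prod_cases3)
  have "vertices t \<inter> {x. n \<bullet> x = k} = (if n \<bullet> a = k then {a} else {}) \<union>
      (if n \<bullet> b = k then {b} else {}) \<union> (if n \<bullet> c = k then {c} else {})"
    by (auto simp: t)
  then show ?thesis using ccw_not_on_line[of a b c n k] assms by (auto simp: t)
qed

lemma hull_of_vertices: "hull_of t = convex hull (vertices t)"
  by (cases t) simp

text \<open>A line separates the interiors and hence weakly separates the triangles, so they meet
  only on it. Each triangle cuts out of this line the hull of its own vertices there, at most a
  segment, and the condition on the vertices excludes partially overlapping segments.\<close>

lemma triangles_meet:
  assumes "ccw s" "ccw t" "interior (hull_of s) \<inter> interior (hull_of t) = {}"
    and st: "vertices s \<inter> hull_of t \<subseteq> vertices t" "vertices t \<inter> hull_of s \<subseteq> vertices s"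
  shows "\<exists>C \<subseteq> vertices s \<inter> vertices t. hull_of s \<inter> hull_of t = convex hull C \<and> (C = {} \<or> (\<exists>p q. C = {p, q}))"
proof -
  \<comment> \<open>\<open>Initial\<close> turns a bare triple into an element, to which the lemma
    applies.\<close>
  have int: "interior (hull_of s) \<noteq> {}" "interior (hull_of t) \<noteq> {}"
    using interior_hull_nonempty[of "Initial s"] interior_hull_nonempty[of "Initial t"] assms by simp_all
  have conv: "convex (hull_of s)" "convex (hull_of t)" by (simp_all add: hull_of_vertices)
  obtain n k where n: "n \<noteq> 0" "\<forall>x\<in>interior (hull_of s). n \<bullet> x \<le> k" "\<forall>x\<in>interior (hull_of t). k \<le> n \<bullet> x"
    using separating_hyperplane_sets[OF convex_interior[OF conv(1)] convex_interior[OF conv(2)] int assms(3)]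
    by blast
  have cl: "closure (interior (hull_of s)) = closure (hull_of s)" "closure (interior (hull_of t)) = closure (hull_of t)"
    using convex_closure_interior conv int by blast+
  have "closure (interior (hull_of s)) \<subseteq> {x. n \<bullet> x \<le> k}"
    using n(2) by (intro closure_minimal closed_halfspace_le) auto
  then have s: "n \<bullet> x \<le> k" if "x \<in> hull_of s" for x
    using that closure_subset[of "hull_of s"] unfolding cl by blast
  have "closure (interior (hull_of t)) \<subseteq> {x. n \<bullet> x \<ge> k}"
    using n(3) by (intro closure_minimal closed_halfspace_ge) auto
  then have t: "n \<bullet> x \<ge> k" if "x \<in> hull_of t" for x
    using that closure_subset[of "hull_of t"] unfolding cl by blast
  define L where "L = {x. n \<bullet> x = k}"
  define A where "A = vertices s \<inter> L"
  define B where "B = vertices t \<inter> L"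
  have fin: "finite (vertices s)" "finite (vertices t)" by (cases s; cases t; simp)+
  have vs: "vertices s \<subseteq> hull_of s" "vertices t \<subseteq> hull_of t"
    by (simp_all add: hull_of_vertices hull_subset)
  have A: "hull_of s \<inter> L = convex hull A"
    unfolding A_def L_def hull_of_vertices
    by (rule convex_hull_supporting_hyperplane) (use s vs fin in \<open>auto intro: finite_imp_compact\<close>)
  \<comment> \<open>The line supports the second triangle from the other side, hence the reversed
    normal.\<close>
  have "hull_of t \<inter> {x. (- n) \<bullet> x = - k} = convex hull (vertices t \<inter> {x. (- n) \<bullet> x = - k})"
    unfolding hull_of_vertices
    by (rule convex_hull_supporting_hyperplane) (use t vs fin in \<open>auto intro: finite_imp_compact\<close>)
  then have B: "hull_of t \<inter> L = convex hull B"
    unfolding B_def L_def by simp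
  have "hull_of s \<inter> hull_of t \<subseteq> L" using s t unfolding L_def by force
  then have meet: "hull_of s \<inter> hull_of t = convex hull A \<inter> convex hull B"
    unfolding A[symmetric] B[symmetric] by blast
  have AB: "A \<inter> convex hull B \<subseteq> B" "B \<inter> convex hull A \<subseteq> A"
    unfolding A[symmetric] B[symmetric] using st unfolding A_def B_def by blast+
  have "convex hull A \<inter> convex hull B \<subseteq> convex hull (A \<inter> B)"
  proof (cases "A = {} \<or> B = {}")
    case False
    then obtain p q p' q' where pq: "A = {p, q}" "B = {p', q'}"
      using vert_on_line[OF assms(1) n(1), of k] vert_on_line[OF assms(2) n(1), of k]
      unfolding A_def B_def L_def by blast
    have "{p, q, p', q'} \<subseteq> L" using pq unfolding A_def B_def by blast
    then have "n \<bullet> q = n \<bullet> p" "n \<bullet> p' = n \<bullet> p" "n \<bullet> q' = n \<bullet> p" by (auto simp: L_def)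
    then obtain a b c where abc: "q = p + a *\<^sub>R vector [- n$2, n$1]" "p' = p + b *\<^sub>R vector [- n$2, n$1]"
      "q' = p + c *\<^sub>R vector [- n$2, n$1]"
      using real2_line[OF n(1)] by metis
    have w: "vector [- n$2, n$1] \<noteq> (0 :: point)" using n(1) by (auto simp: vec_eq_iff forall_2)
    show ?thesis
      by (rule collinear_segments_meet[OF w, of A p 0 a B b c]) (use pq abc AB in simp_all)
  qed auto
  moreover have "convex hull (A \<inter> B) \<subseteq> convex hull A \<inter> convex hull B"
    by (simp add: hull_mono)
  ultimately have "hull_of s \<inter> hull_of t = convex hull (A \<inter> B)" using meet by blast
  moreover have "A \<inter> B = {} \<or> (\<exists>p q. A \<inter> B = {p, q})"
  proof -
    have "A = {} \<or> (\<exists>p q. A = {p, q})"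
      using vert_on_line[OF assms(1) n(1), of k] unfolding A_def L_def .
    then show ?thesis by (auto simp: Int_insert_left)
  qed
  ultimately show ?thesis unfolding A_def B_def by blast
qed

lemma sidesI:
  assumes "p \<in> vertices t" "q \<in> vertices t" "p \<noteq> q"
  shows "{p, q} \<in> sides t"
  using assms by (cases t) (auto simp: doubleton_eq_iff)

lemma no_hanging_nodes_conforming:
  assumes T: "tiling K \<T>" and "no_hanging_nodes \<T>"
  shows "conforming (tri ` \<T>)"
  unfolding conforming_def
proof (intro ballI impI)
  fix s t assume "s \<in> tri ` \<T>" "t \<in> tri ` \<T>" and ne: "s \<noteq> t"
  then obtain X Y where X: "X \<in> \<T>" "s = tri X" and Y: "Y \<in> \<T>" "t = tri Y" by blast
  have "interior (region X) \<inter> interior (region Y) = {}"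
    using tiling_overlap[OF T X(1) Y(1)] ne X(2) Y(2) by blast
  moreover have "vert X \<inter> region Y \<subseteq> vert Y" "vert Y \<inter> region X \<subseteq> vert X"
    using assms(2) X(1) Y(1) unfolding no_hanging_nodes_def nodes_def by blast+
  moreover have "ccw s" "ccw t" using T X Y by (auto simp: tiling_def)
  ultimately obtain C where C: "C \<subseteq> vertices s \<inter> vertices t" "hull_of s \<inter> hull_of t = convex hull C"
    "C = {} \<or> (\<exists>p q. C = {p, q})"
    using triangles_meet[of s t] unfolding X(2) Y(2) by metis
  consider "C = {}" | p where "C = {p}" | p q where "C = {p, q}" "p \<noteq> q" using C(3) by auto
  then show "hull_of s \<inter> hull_of t = {} \<or> (\<exists>v\<in>vertices s \<inter> vertices t. hull_of s \<inter> hull_of t = {v}) \<or>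
      (\<exists>e\<in>edges s \<inter> edges t. hull_of s \<inter> hull_of t = e)"
  proof cases
    case 1
    then show ?thesis using C(2) by simp
  next
    case 2
    then show ?thesis using C(1,2) by simp
  next
    case 3
    then have "{p, q} \<in> sides s" "{p, q} \<in> sides t" using C(1) by (auto intro: sidesI)
    then have "closed_segment p q \<in> edges s \<inter> edges t" unfolding Int_iff edges_sides by blast
    moreover have "hull_of s \<inter> hull_of t = closed_segment p q"
      using C(2) 3(1) by (simp add: segment_convex_hull)
    ultimately show ?thesis by blast
  qed
qed

text \<open>The last conjunct is the part of the history that the count uses. It provides for each
  node that is not initial a stage at which it was the midpoint of a full edge of every triangle
  containing it. Later steps preserve this, because subdivisions compose.\<close>

lemma rgb_refinement_induct:
  assumes T0: "conforming_triangulation \<Omega> \<T>\<^sub>0" and ref: "rgb_refinement \<Omega> \<T>\<^sub>0 \<T>"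
  shows "tiling (closure \<Omega>) \<T> \<and> conforming (tri ` \<T>) \<and> subdivision (Initial ` \<T>\<^sub>0) \<T> \<and>
    (\<forall>v \<in> nodes (tri ` \<T>) - nodes \<T>\<^sub>0. \<exists>\<T>' a b. tiling (closure \<Omega>) \<T>' \<and> subdivision \<T>' \<T> \<and>
       v = midpoint a b \<and> (\<forall>E\<in>\<T>'. v \<in> region E \<longrightarrow> {a, b} \<in> sides (tri E)))"
  using ref unfolding rgb_refinement_def
proof (induction rule: rtranclp_induct)
  case base
  have "tiling (closure \<Omega>) (Initial ` \<T>\<^sub>0)"
    using T0 unfolding conforming_triangulation_def triangulation_def tiling_def nonoverlapping_def
    by (auto simp: image_image)
  then show ?case
    using T0 subdivision_refl by (simp add: conforming_triangulation_def image_image)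
next
  case (step \<T> \<T>'')
  obtain p where p: "\<T>'' = (\<Union>T\<in>\<T>. children (p T) T)" and conf: "conforming_triangulation \<Omega> (tri ` \<T>'')"
    using step.hyps(2) by (auto simp: rgb_step_def)
  have sub: "subdivision \<T> \<T>''" unfolding p by (rule subdivision_children)
  have til: "tiling (closure \<Omega>) \<T>" and confT: "conforming (tri ` \<T>)" using step.IH by blast+
  have ccwT: "ccw (tri X)" if "X \<in> \<T>" for X using til that by (simp add: tiling_def)
  have "\<exists>\<T>' a b. tiling (closure \<Omega>) \<T>' \<and> subdivision \<T>' \<T>'' \<and>
       v = midpoint a b \<and> (\<forall>E\<in>\<T>'. v \<in> region E \<longrightarrow> {a, b} \<in> sides (tri E))"
    if v: "v \<in> nodes (tri ` \<T>'') - nodes \<T>\<^sub>0" for v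
  proof (cases "v \<in> nodes (tri ` \<T>)")
    case True
    then obtain \<T>' a b where old: "tiling (closure \<Omega>) \<T>'" "subdivision \<T>' \<T>" "v = midpoint a b"
      "\<forall>E\<in>\<T>'. v \<in> region E \<longrightarrow> {a, b} \<in> sides (tri E)"
      using step.IH v by blast
    show ?thesis
      using old subdivision_trans[OF old(2) sub] by (intro exI[of _ \<T>'] exI[of _ a] exI[of _ b] conjI)
  next
    \<comment> \<open>The node is created in the present step, so the mesh before this step is the
      witness.\<close>
    case False
    obtain X Y where X: "X \<in> \<T>" "Y \<in> children (p X) X" "v \<in> vert Y"
      using v unfolding p nodes_def by blast
    then have "v \<notin> vert X" using False by (auto simp: nodes_def)
    then have "v \<in> mids (tri X)" using X(3) vert_children[OF X(2)] by blast
    then obtain a b where ab: "v = midpoint a b" "{a, b} \<in> sides (tri X)" unfolding mids_sides by blast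
    have "{a, b} \<in> sides (tri E)" if "E \<in> \<T>" "v \<in> region E" for E
      using conforming_shared_side[OF confT X(1) that(1) ccwT[OF X(1)] ccwT[OF that(1)] ab(2)] False that(2) ab(1)
      by blast
    then show ?thesis using til sub ab(1) by blast
  qed
  moreover have "subdivision (Initial ` \<T>\<^sub>0) \<T>''" using step.IH sub subdivision_trans by blast
  \<comment> \<open>The tiling is inherited through the subdivision: \<open>rgb_step\<close>
    constrains the set of triangles, which cannot tell apart two elements carrying the same
    triangle.\<close>
  ultimately show ?case using tiling_subdivision[OF til sub] conf
    unfolding conforming_triangulation_def by blast
qed

section \<open>Counting elements at a node\<close>

lemma corners_off:
  assumes "tri E = (w1, w2, w3)" and "0 < orient w1 w2 w3"
  shows "w1 \<notin> region (G2 E)" "w2 \<notin> region (G1 E)"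
    "midpoint w2 w3 \<notin> region (G1 E)" "midpoint w3 w1 \<notin> region (G2 E)"
    "w1 \<notin> region (R2 E)" "w1 \<notin> region (R3 E)" "w1 \<notin> region (R4 E)"
    "w2 \<notin> region (R1 E)" "w2 \<notin> region (R3 E)" "w2 \<notin> region (R4 E)"
    "midpoint w1 w2 \<notin> region (R3 E)" "midpoint w2 w3 \<notin> region (R1 E)" "midpoint w3 w1 \<notin> region (R2 E)"
  unfolding hull_children[OF assms] using assms(2) orient_vertices[OF assms(2)] by simp_all

definition red_split :: "element \<Rightarrow> element set \<Rightarrow> bool" where
  "red_split F S \<longleftrightarrow> (\<exists>S1 S2 S3 S4. subdivides (R1 F) S1 \<and> subdivides (R2 F) S2 \<and>
     subdivides (R3 F) S3 \<and> subdivides (R4 F) S4 \<and> S = S1 \<union> S2 \<union> S3 \<union> S4)"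

definition green_split :: "element \<Rightarrow> element set \<Rightarrow> bool" where
  "green_split F S \<longleftrightarrow> (\<exists>S1 S2. subdivides (G1 F) S1 \<and> subdivides (G2 F) S2 \<and> S = S1 \<union> S2)"

text \<open>A green refinement of F counts only for its reference edge. When another side of a
  triangle is bisected after a green step, F is the green child that has this side as reference
  edge.\<close>

definition bisects :: "element \<Rightarrow> element set \<Rightarrow> point \<Rightarrow> point \<Rightarrow> bool" where
  "bisects F S a b \<longleftrightarrow> ccw (tri F) \<and>
     (red_split F S \<and> {a, b} \<in> sides (tri F) \<or>
      green_split F S \<and> {a, b} = {fst (tri F), fst (snd (tri F))})"

lemma subdivides_split:
  assumes "subdivides E S"
  shows "S = {E} \<or> red_split E S \<or> green_split E S"
  using assms unfolding red_split_def green_split_def by cases blast+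

locale mesh =
  fixes K :: "point set" and \<T> :: "element set"
  assumes tiling: "tiling K \<T>" and no_hanging: "no_hanging_nodes \<T>"
begin

abbreviation N :: "point set" where "N \<equiv> nodes (tri ` \<T>)"

lemma ccw_elements: "X \<in> \<T> \<Longrightarrow> ccw (tri X)"
  using tiling by (simp add: tiling_def)

lemma finite_elements: "finite \<T>"
  using tiling by (simp add: tiling_def)

lemma node_vert: "X \<in> \<T> \<Longrightarrow> x \<in> N \<Longrightarrow> x \<in> region X \<Longrightarrow> x \<in> vert X"
  using no_hanging unfolding no_hanging_nodes_def by blast

lemma mids_not_node:
  assumes "X \<in> \<T>" "x \<in> mids (tri X)"
  shows "x \<notin> N"
  using node_vert[OF assms(1), of x] assms mids_disjoint_vert[OF ccw_elements] mids_subset_hull[OF ccw_elements]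
  by blast

lemma subdivides_nodes:
  assumes "subdivides E S" "S \<subseteq> \<T>" "x \<in> vert E"
  shows "x \<in> N"
  using subdivides_vert[OF assms(1)] assms(2,3) unfolding nodes_def by blast

text \<open>Every leaf below E overlaps E, so in a tiling that contains E it is E itself.\<close>

lemma subdivides_element:
  assumes "subdivides E S" "S \<subseteq> \<T>" "E \<in> \<T>"
  shows "S = {E}"
proof -
  have c: "ccw (tri E)" using assms(3) by (rule ccw_elements)
  have "X = E" if "X \<in> S" for X
  proof (rule tiling_overlap[OF tiling])
    show "X \<in> \<T>" "E \<in> \<T>" using that assms by auto
    show "interior (region X) \<inter> interior (region E) \<noteq> {}"
      using subdivides_interior[OF assms(1) c that] interior_hull_nonempty[of X] subdivides_ccw[OF assms(1) that] c
      by blast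
  qed
  moreover have "S \<noteq> {}" using subdivides_hull[OF assms(1) c] interior_hull_nonempty[OF c] interior_subset by force
  ultimately show ?thesis by blast
qed

lemma split_cases:
  assumes "subdivides E S" "S \<subseteq> \<T>" "tri E = (w1, w2, w3)"
  obtains (leaf) "S = {E}" "E \<in> \<T>"
  | (red) S1 S2 S3 S4 where "subdivides (R1 E) S1" "subdivides (R2 E) S2" "subdivides (R3 E) S3"
      "subdivides (R4 E) S4" "S = S1 \<union> S2 \<union> S3 \<union> S4" "S1 \<subseteq> \<T>" "S2 \<subseteq> \<T>" "S3 \<subseteq> \<T>" "S4 \<subseteq> \<T>"
      "midpoint w1 w2 \<in> N" "midpoint w2 w3 \<in> N" "midpoint w3 w1 \<in> N"
  | (green) S1 S2 where "subdivides (G1 E) S1" "subdivides (G2 E) S2" "S = S1 \<union> S2" "S1 \<subseteq> \<T>" "S2 \<subseteq> \<T>"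
      "midpoint w1 w2 \<in> N"
  using assms(1)
proof cases
  case leaf
  then show ?thesis using assms(2) that(1) by simp
next
  case (red S1 S2 S3 S4)
  have sub: "S1 \<subseteq> \<T>" "S2 \<subseteq> \<T>" "S3 \<subseteq> \<T>" "S4 \<subseteq> \<T>" using red(1) assms(2) by auto
  have "midpoint w1 w2 \<in> N" "midpoint w2 w3 \<in> N" "midpoint w3 w1 \<in> N"
    using subdivides_nodes[OF red(5) sub(4)] by (auto simp: tri.simps assms(3))
  then show ?thesis using that(2) red sub by blast
next
  case (green S1 S2)
  have sub: "S1 \<subseteq> \<T>" "S2 \<subseteq> \<T>" using green(1) assms(2) by auto
  have "midpoint w1 w2 \<in> N"
    using subdivides_nodes[OF green(2) sub(1)] by (auto simp: tri.simps assms(3))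
  then show ?thesis using that(3) green sub by blast
qed

text \<open>S may be a part of the mesh, but the red middle elements are always those of the whole
  mesh. Thus the sizes for disjoint parts add up to the size of the reduced patch.\<close>

definition patch :: "element set \<Rightarrow> point \<Rightarrow> element set" where
  "patch S v = {X \<in> S. v \<in> vert X} - red_middle \<T>"

lemma patch_Un: "patch (A \<union> B) v = patch A v \<union> patch B v"
  by (auto simp: patch_def)

lemma patch_finite: "S \<subseteq> \<T> \<Longrightarrow> finite (patch S v)"
  using finite_elements by (auto simp: patch_def intro: finite_subset)

lemma patch_off:
  assumes "subdivides E S" "ccw (tri E)" "v \<notin> region E"
  shows "patch S v = {}"
proof -
  have "v \<notin> vert X" if "X \<in> S" for X
    using subdivides_hull_subset[OF assms(1,2) that] vertE[of v X] assms(3) by blast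
  then show ?thesis by (auto simp: patch_def)
qed

lemma card_patch_singleton: "card (patch {X} v) \<le> 1"
proof -
  have "patch {X} v \<subseteq> {X}" by (auto simp: patch_def)
  then show ?thesis using card_mono[of "{X}"] by simp
qed

lemma red_middle_R4: "X \<in> red_middle \<T> \<Longrightarrow> \<exists>F. X = R4 F"
  by (auto simp: red_middle_def)

text \<open>A corner of E can be followed down the tree without ever entering an \<open>R4\<close>,
  so the leaf that is reached is no red middle element.\<close>

lemma patch_nonempty:
  assumes "subdivides E S" "S \<subseteq> \<T>" "v \<in> vert E" "E \<notin> red_middle \<T>"
  shows "patch S v \<noteq> {}"
  using assms
proof (induction rule: subdivides.induct)
  case (leaf E)
  then show ?case by (auto simp: patch_def)
next
  case (red E S1 S2 S3 S4)
  have n: "R1 E \<notin> red_middle \<T>" "R2 E \<notin> red_middle \<T>" "R3 E \<notin> red_middle \<T>"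
    using red_middle_R4 by blast+
  have sub: "S1 \<subseteq> \<T>" "S2 \<subseteq> \<T>" "S3 \<subseteq> \<T>" using red.prems(1) by auto
  consider "v \<in> vert (R1 E)" | "v \<in> vert (R2 E)" | "v \<in> vert (R3 E)"
    using vert_subset_red[of E] red.prems(2) by blast
  then show ?case using red.IH(1-3) n sub unfolding patch_Un by cases auto
next
  case (green E S1 S2)
  have n: "G1 E \<notin> red_middle \<T>" "G2 E \<notin> red_middle \<T>"
    using red_middle_R4 by blast+
  have sub: "S1 \<subseteq> \<T>" "S2 \<subseteq> \<T>" using green.prems(1) by auto
  consider "v \<in> vert (G1 E)" | "v \<in> vert (G2 E)"
    using vert_subset_green[of E] green.prems(2) by blast
  then show ?case using green.IH n sub unfolding patch_Un by cases auto
qed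

lemma card_patch_pos:
  assumes "subdivides E S" "S \<subseteq> \<T>" "v \<in> vert E" "E \<notin> red_middle \<T>"
  shows "1 \<le> card (patch S v)"
  using patch_nonempty[OF assms] patch_finite[OF assms(2)] by (simp add: Suc_le_eq card_gt_0_iff)

lemma card_patch_green:
  assumes "subdivides (G1 E) S1" "subdivides (G2 E) S2" "S1 \<subseteq> \<T>" "S2 \<subseteq> \<T>" "ccw (tri E)"
  shows "card (patch (S1 \<union> S2) v) = card (patch S1 v) + card (patch S2 v)"
proof -
  have "S1 \<inter> S2 = {}"
    by (rule subdivides_disjoint[OF assms(1,2)]) (use assms(5) interior_disjoint_green in simp_all)
  then have "patch S1 v \<inter> patch S2 v = {}" by (auto simp: patch_def)
  then show ?thesis unfolding patch_Un using patch_finite assms by (intro card_Un_disjoint) auto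
qed

lemma card_patch_red:
  assumes "subdivides (R1 E) S1" "subdivides (R2 E) S2" "subdivides (R3 E) S3" "subdivides (R4 E) S4"
    and "S1 \<subseteq> \<T>" "S2 \<subseteq> \<T>" "S3 \<subseteq> \<T>" "S4 \<subseteq> \<T>" and c: "ccw (tri E)"
  shows "card (patch (S1 \<union> S2 \<union> S3 \<union> S4) v) =
    card (patch S1 v) + card (patch S2 v) + card (patch S3 v) + card (patch S4 v)"
proof -
  have c': "ccw (tri (R1 E))" "ccw (tri (R2 E))" "ccw (tri (R3 E))" "ccw (tri (R4 E))" using c by simp_all
  note d = interior_disjoint_red[OF c]
  have "S1 \<inter> S2 = {}" "S1 \<inter> S3 = {}" "S1 \<inter> S4 = {}" "S2 \<inter> S3 = {}" "S2 \<inter> S4 = {}" "S3 \<inter> S4 = {}"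
    using subdivides_disjoint[OF assms(1,2) c'(1,2) d(1)] subdivides_disjoint[OF assms(1,3) c'(1,3) d(2)]
      subdivides_disjoint[OF assms(1,4) c'(1,4) d(3)] subdivides_disjoint[OF assms(2,3) c'(2,3) d(4)]
      subdivides_disjoint[OF assms(2,4) c'(2,4) d(5)] subdivides_disjoint[OF assms(3,4) c'(3,4) d(6)]
    by blast+
  then have "patch S1 v \<inter> patch S2 v = {}" "(patch S1 v \<union> patch S2 v) \<inter> patch S3 v = {}"
    "(patch S1 v \<union> patch S2 v \<union> patch S3 v) \<inter> patch S4 v = {}"
    unfolding patch_def by blast+
  then show ?thesis unfolding patch_Un
    using patch_finite[OF assms(5)] patch_finite[OF assms(6)] patch_finite[OF assms(7)] patch_finite[OF assms(8)]
    by (simp add: card_Un_disjoint)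
qed

text \<open>
  Every refinement bisects the reference edge. Hence an unbisected edge stops the refinement as soon
  as it becomes a reference edge, which happens after at most one green refinement.
\<close>

lemma leaf_if_reference_edge:
  assumes "subdivides E S" "S \<subseteq> \<T>" "tri E = (w1, w2, w3)" "midpoint w1 w2 \<notin> N"
  shows "S = {E}" "E \<in> \<T>"
  using assms by (auto elim: split_cases)

text \<open>A red refinement would bisect the side w3 w1. After a green one this side is the
  reference edge of \<open>G1\<close>, which therefore stays unrefined, while \<open>G2\<close> does
  not contain w1.\<close>

lemma card_patch_first:
  assumes E: "subdivides E S" "S \<subseteq> \<T>" "tri E = (w1, w2, w3)" "0 < orient w1 w2 w3"
    and "midpoint w3 w1 \<notin> N"
  shows "card (patch S w1) \<le> 1"
  using E(1-3)
proof (cases rule: split_cases)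
  case leaf
  then show ?thesis using card_patch_singleton by simp
next
  case (green S1 S2)
  have "S1 = {G1 E}"
    by (rule leaf_if_reference_edge(1)[OF green(1,4), of w3 w1]) (use assms(5) in \<open>simp_all add: tri.simps E(3)\<close>)
  moreover have "patch S2 w1 = {}"
    by (rule patch_off[OF green(2)]) (use E corners_off[OF E(3,4)] in simp_all)
  ultimately show ?thesis unfolding green(3) patch_Un using card_patch_singleton by simp
qed (use assms(5) in blast)

lemma card_patch_second:
  assumes E: "subdivides E S" "S \<subseteq> \<T>" "tri E = (w1, w2, w3)" "0 < orient w1 w2 w3"
    and "midpoint w2 w3 \<notin> N"
  shows "card (patch S w2) \<le> 1"
  using E(1-3)
proof (cases rule: split_cases)
  case leaf
  then show ?thesis using card_patch_singleton by simp
next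
  case (green S1 S2)
  have "S2 = {G2 E}"
    by (rule leaf_if_reference_edge(1)[OF green(2,5), of w2 w3]) (use assms(5) in \<open>simp_all add: tri.simps E(3)\<close>)
  moreover have "patch S1 w2 = {}"
    by (rule patch_off[OF green(1)]) (use E corners_off[OF E(3,4)] in simp_all)
  ultimately show ?thesis unfolding green(3) patch_Un using card_patch_singleton by simp
qed (use assms(5) in blast)

lemma child_orient:
  assumes "0 < orient w1 w2 w3"
  shows "0 < orient w3 w1 (midpoint w1 w2)" "0 < orient w2 w3 (midpoint w1 w2)"
    "0 < orient w1 (midpoint w1 w2) (midpoint w3 w1)"
    "0 < orient (midpoint w1 w2) w2 (midpoint w2 w3)"
    "0 < orient (midpoint w3 w1) (midpoint w2 w3) w3"
    "0 < orient (midpoint w2 w3) (midpoint w3 w1) (midpoint w1 w2)"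
  using assms orient_vertices[OF assms] orient_swap[of w1 w3 w2] orient_swap[of w2 w1 w3] orient_swap[of w3 w2 w1]
  by simp_all

text \<open>Only half of the reference edge is known to be unbisected. After a red step this half is
  the reference edge of \<open>R1\<close>; after a green step it is a further side of
  \<open>G1\<close>, where the mirror image of the previous argument applies.\<close>

lemma card_patch_first_half:
  assumes E: "subdivides E S" "S \<subseteq> \<T>" "tri E = (w1, w2, w3)" "0 < orient w1 w2 w3"
    and half: "midpoint w1 (midpoint w1 w2) \<notin> N"
  shows "card (patch S w1) \<le> 1"
  using E(1-3)
proof (cases rule: split_cases)
  case leaf
  then show ?thesis using card_patch_singleton by simp
next
  case (red S1 S2 S3 S4)
  have "S1 = {R1 E}"
    by (rule leaf_if_reference_edge(1)[OF red(1,6), of w1 "midpoint w1 w2"]) (use half in \<open>simp_all add: tri.simps E(3)\<close>)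
  moreover have "patch S2 w1 = {}" by (rule patch_off[OF red(2)]) (use E corners_off[OF E(3,4)] in simp_all)
  moreover have "patch S3 w1 = {}" by (rule patch_off[OF red(3)]) (use E corners_off[OF E(3,4)] in simp_all)
  moreover have "patch S4 w1 = {}" by (rule patch_off[OF red(4)]) (use E corners_off[OF E(3,4)] in simp_all)
  ultimately show ?thesis unfolding red(5) patch_Un using card_patch_singleton by simp
next
  case (green S1 S2)
  have "card (patch S1 w1) \<le> 1"
    by (rule card_patch_second[OF green(1,4), of w3 _ "midpoint w1 w2"])
      (use half child_orient[OF E(4)] in \<open>simp_all add: tri.simps E(3)\<close>)
  moreover have "patch S2 w1 = {}"
    by (rule patch_off[OF green(2)]) (use E corners_off[OF E(3,4)] in simp_all)
  ultimately show ?thesis unfolding green(3) patch_Un by simp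
qed

lemma card_patch_second_half:
  assumes E: "subdivides E S" "S \<subseteq> \<T>" "tri E = (w1, w2, w3)" "0 < orient w1 w2 w3"
    and half: "midpoint (midpoint w1 w2) w2 \<notin> N"
  shows "card (patch S w2) \<le> 1"
  using E(1-3)
proof (cases rule: split_cases)
  case leaf
  then show ?thesis using card_patch_singleton by simp
next
  case (red S1 S2 S3 S4)
  have "S2 = {R2 E}"
    by (rule leaf_if_reference_edge(1)[OF red(2,7), of "midpoint w1 w2" w2]) (use half in \<open>simp_all add: tri.simps E(3)\<close>)
  moreover have "patch S1 w2 = {}" by (rule patch_off[OF red(1)]) (use E corners_off[OF E(3,4)] in simp_all)
  moreover have "patch S3 w2 = {}" by (rule patch_off[OF red(3)]) (use E corners_off[OF E(3,4)] in simp_all)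
  moreover have "patch S4 w2 = {}" by (rule patch_off[OF red(4)]) (use E corners_off[OF E(3,4)] in simp_all)
  ultimately show ?thesis unfolding red(5) patch_Un using card_patch_singleton by simp
next
  case (green S1 S2)
  have "card (patch S2 w2) \<le> 1"
    by (rule card_patch_first[OF green(2,5), of _ w3 "midpoint w1 w2"])
      (use half child_orient[OF E(4)] in \<open>simp_all add: tri.simps E(3)\<close>)
  moreover have "patch S1 w2 = {}"
    by (rule patch_off[OF green(1)]) (use E corners_off[OF E(3,4)] in simp_all)
  ultimately show ?thesis unfolding green(3) patch_Un by simp
qed

text \<open>The unbisected side excludes a red refinement. After a green one it is the reference
  edge of one child, which is then an element; the side from w3 to the new midpoint is thus
  unbisected as well and leaves just one element of the other child at w3. So the count is two
  unless E is unrefined.\<close>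

lemma card_patch_third:
  assumes E: "subdivides E S" "S \<subseteq> \<T>" "tri E = (w1, w2, w3)" "0 < orient w1 w2 w3"
    and edge: "midpoint w2 w3 \<notin> N \<or> midpoint w3 w1 \<notin> N"
  shows "card (patch S w3) \<le> 2" and "S = {E} \<or> 2 \<le> card (patch S w3)"
proof -
  have "card (patch S w3) \<le> 2 \<and> (S = {E} \<or> 2 \<le> card (patch S w3))"
    using E(1-3)
  proof (cases rule: split_cases)
    case leaf
    then show ?thesis using card_patch_singleton[of E w3] by simp
  next
    case (green S1 S2)
    have "card (patch S1 w3) \<le> 1 \<and> card (patch S2 w3) \<le> 1"
      using edge
    proof
      assume e: "midpoint w2 w3 \<notin> N"
      have S2: "S2 = {G2 E}" "G2 E \<in> \<T>"
        using leaf_if_reference_edge[OF green(2,5), of w2 w3] e by (simp_all add: tri.simps E(3))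
      have "midpoint (midpoint w1 w2) w3 \<notin> N"
        by (rule mids_not_node[OF S2(2)]) (simp add: tri.simps E(3) midpoint_sym)
      then have "card (patch S1 w3) \<le> 1"
        by (intro card_patch_first[OF green(1,4), of _ w1 "midpoint w1 w2"])
          (use child_orient[OF E(4)] in \<open>simp_all add: tri.simps E(3)\<close>)
      then show ?thesis using card_patch_singleton S2(1) by simp
    next
      assume e: "midpoint w3 w1 \<notin> N"
      have S1: "S1 = {G1 E}" "G1 E \<in> \<T>"
        using leaf_if_reference_edge[OF green(1,4), of w3 w1] e by (simp_all add: tri.simps E(3))
      have "midpoint w3 (midpoint w1 w2) \<notin> N"
        by (rule mids_not_node[OF S1(2)]) (simp add: tri.simps E(3) midpoint_sym)
      then have "card (patch S2 w3) \<le> 1"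
        by (intro card_patch_second[OF green(2,5), of w2 _ "midpoint w1 w2"])
          (use child_orient[OF E(4)] in \<open>simp_all add: tri.simps E(3)\<close>)
      then show ?thesis using card_patch_singleton S1(1) by simp
    qed
    moreover have "1 \<le> card (patch S1 w3)"
      by (rule card_patch_pos[OF green(1,4)]) (use red_middle_R4 in \<open>auto simp: tri.simps E(3)\<close>)
    moreover have "1 \<le> card (patch S2 w3)"
      by (rule card_patch_pos[OF green(2,5)]) (use red_middle_R4 in \<open>auto simp: tri.simps E(3)\<close>)
    moreover have "card (patch S w3) = card (patch S1 w3) + card (patch S2 w3)"
      unfolding green(3) by (rule card_patch_green[OF green(1,2,4,5)]) (simp add: E)
    ultimately show ?thesis by linarith
  qed (use edge in blast)
  then show "card (patch S w3) \<le> 2" "S = {E} \<or> 2 \<le> card (patch S w3)" by blast+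
qed

end

section \<open>Bisected edges and unrefined patterns\<close>

definition complete_split :: "element \<Rightarrow> element set \<Rightarrow> point \<Rightarrow> point \<Rightarrow> bool" where
  "complete_split F S a b \<longleftrightarrow> S = children Red F \<and> {a, b} \<in> sides (tri F) \<or>
     S = children Green F \<and> {a, b} = {fst (tri F), fst (snd (tri F))}"

lemma midpoint_doubleton: "{a, b} = {c, d} \<Longrightarrow> midpoint a b = midpoint c d"
  by (auto simp: doubleton_eq_iff midpoint_sym)

lemma newest_vert: "is_newest_vertex v X \<Longrightarrow> v \<in> vert X"
  by (cases "tri X") (simp add: is_newest_vertex_def)

context mesh
begin

text \<open>E is the father if it is refined red or if the side is its reference edge. Otherwise E
  is refined green, the side is the reference edge of one green child, and the other child misses
  its midpoint; so the descent has length at most one.\<close>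

lemma side_father:
  assumes E: "subdivides E S" "S \<subseteq> \<T>" and c: "ccw (tri E)"
    and ab: "{a, b} \<in> sides (tri E)" and m: "midpoint a b \<in> N"
  shows "\<exists>F S'. bisects F S' a b \<and> S' \<subseteq> S \<and> (\<forall>X\<in>S. midpoint a b \<in> vert X \<longrightarrow> X \<in> S')"
proof -
  obtain v1 v2 v3 where v: "tri E = (v1, v2, v3)" "0 < orient v1 v2 v3" using c by (rule tri_cases)
  consider "S = {E}" | "red_split E S" | "green_split E S" using subdivides_split[OF E(1)] by blast
  then show ?thesis
  proof cases
    case 1
    then have "midpoint a b \<notin> N"
      using E(2) ab by (intro mids_not_node[of E]) (auto simp: mids_sides)
    then show ?thesis using m by blast
  next
    case 2
    then have "bisects E S a b" using ab c by (simp add: bisects_def)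
    then show ?thesis by blast
  next
    case 3
    then obtain S1 S2 where S: "subdivides (G1 E) S1" "subdivides (G2 E) S2" "S = S1 \<union> S2"
      unfolding green_split_def by blast
    consider "{a, b} = {v1, v2}" | "{a, b} = {v2, v3}" | "{a, b} = {v3, v1}" using ab by (auto simp: v(1))
    then show ?thesis
    proof cases
      case 1
      then have "bisects E S a b" using 3 c by (simp add: bisects_def v(1))
      then show ?thesis by blast
    next
      case 2
      then have mid: "midpoint a b = midpoint v2 v3" by (rule midpoint_doubleton)
      have c2: "ccw (tri (G1 E))" "ccw (tri (G2 E))" using c by simp_all
      have "X \<notin> S1" if "midpoint a b \<in> vert X" for X
        using subdivides_hull_subset[OF S(1) c2(1)] vertE[OF that] corners_off(3)[OF v] unfolding mid by blast
      moreover have "S2 \<noteq> {G2 E}"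
      proof
        assume "S2 = {G2 E}"
        then have "midpoint v2 v3 \<notin> N"
          using E(2) S(3) by (intro mids_not_node[of "G2 E"]) (auto simp: tri.simps v(1))
        then show False using m mid by simp
      qed
      then have "bisects (G2 E) S2 a b"
        using subdivides_split[OF S(2)] c2(2) 2 by (auto simp: bisects_def tri.simps v(1))
      ultimately show ?thesis using S(3) by blast
    next
      case 3
      then have mid: "midpoint a b = midpoint v3 v1" by (rule midpoint_doubleton)
      have c2: "ccw (tri (G1 E))" "ccw (tri (G2 E))" using c by simp_all
      have "X \<notin> S2" if "midpoint a b \<in> vert X" for X
        using subdivides_hull_subset[OF S(2) c2(2)] vertE[OF that] corners_off(4)[OF v] unfolding mid by blast
      moreover have "S1 \<noteq> {G1 E}"
      proof
        assume "S1 = {G1 E}"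
        then have "midpoint v3 v1 \<notin> N"
          using E(2) S(3) by (intro mids_not_node[of "G1 E"]) (auto simp: tri.simps v(1))
        then show False using m mid by simp
      qed
      then have "bisects (G1 E) S1 a b"
        using subdivides_split[OF S(1)] c2(1) 3 by (auto simp: bisects_def tri.simps v(1))
      ultimately show ?thesis using S(3) by blast
    qed
  qed
qed

text \<open>The midpoint is a vertex of two of the corner children and of \<open>R4\<close>. The two
  corners already account for two elements; if there are no more, \<open>R4\<close> contributes
  nothing and must be a red middle element, which by definition has all its siblings in the
  mesh.\<close>

lemma red_split_card:
  assumes "red_split F S" "S \<subseteq> \<T>" and c: "ccw (tri F)" and v: "v \<in> mids (tri F)"
  shows "2 \<le> card (patch S v)" and "card (patch S v) = 2 \<Longrightarrow> S = children Red F"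
proof -
  obtain S1 S2 S3 S4 where S: "subdivides (R1 F) S1" "subdivides (R2 F) S2" "subdivides (R3 F) S3"
    "subdivides (R4 F) S4" "S = S1 \<union> S2 \<union> S3 \<union> S4"
    using assms(1) unfolding red_split_def by blast
  have sub: "S1 \<subseteq> \<T>" "S2 \<subseteq> \<T>" "S3 \<subseteq> \<T>" "S4 \<subseteq> \<T>" using S(5) assms(2) by auto
  obtain v1 v2 v3 where F: "tri F = (v1, v2, v3)" using prod_cases3 by blast
  have n: "R1 F \<notin> red_middle \<T>" "R2 F \<notin> red_middle \<T>" "R3 F \<notin> red_middle \<T>"
    using red_middle_R4 by blast+
  have p1: "v \<in> vert (R1 F) \<Longrightarrow> 1 \<le> card (patch S1 v)"
    and p2: "v \<in> vert (R2 F) \<Longrightarrow> 1 \<le> card (patch S2 v)"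
    and p3: "v \<in> vert (R3 F) \<Longrightarrow> 1 \<le> card (patch S3 v)"
    using card_patch_pos[OF S(1) sub(1)] card_patch_pos[OF S(2) sub(2)] card_patch_pos[OF S(3) sub(3)] n by blast+
  have "v \<in> vert (R4 F)" using v by (auto simp: F tri.simps)
  then have p4: "R4 F \<notin> red_middle \<T> \<Longrightarrow> 1 \<le> card (patch S4 v)" using card_patch_pos[OF S(4) sub(4)] by blast
  have "v \<in> vert (R1 F) \<and> v \<in> vert (R2 F) \<or> v \<in> vert (R2 F) \<and> v \<in> vert (R3 F) \<or>
      v \<in> vert (R1 F) \<and> v \<in> vert (R3 F)"
    using v by (auto simp: F tri.simps)
  then have ge: "2 \<le> card (patch S1 v) + card (patch S2 v) + card (patch S3 v)" using p1 p2 p3 by fastforce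
  have sum: "card (patch S v) = card (patch S1 v) + card (patch S2 v) + card (patch S3 v) + card (patch S4 v)"
    unfolding S(5) by (rule card_patch_red[OF S(1-4) sub c])
  then show "2 \<le> card (patch S v)" using ge by linarith
  assume "card (patch S v) = 2"
  then have "R4 F \<in> red_middle \<T>" using sum ge p4 by force
  then have "R1 F \<in> \<T>" "R2 F \<in> \<T>" "R3 F \<in> \<T>" "R4 F \<in> \<T>" by (auto simp: red_middle_def)
  then have "S1 = {R1 F}" "S2 = {R2 F}" "S3 = {R3 F}" "S4 = {R4 F}"
    using subdivides_element[OF S(1) sub(1)] subdivides_element[OF S(2) sub(2)]
      subdivides_element[OF S(3) sub(3)] subdivides_element[OF S(4) sub(4)] by blast+
  then show "S = children Red F" using S(5) by auto
qed

text \<open>The element with newest vertex v is an unrefined child of F. Its unbisected sides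
  restrict \<open>R4\<close> and, through \<open>R4\<close>, the remaining corner child at v, so
  that each of the three children at v contributes at most one element.\<close>

lemma red_split_newest:
  assumes "red_split F S" "S \<subseteq> \<T>" and c: "ccw (tri F)" and v: "v \<in> mids (tri F)"
    and X: "X \<in> S" "is_newest_vertex v X"
  shows "card (patch S v) \<le> 3"
proof -
  obtain S1 S2 S3 S4 where S: "subdivides (R1 F) S1" "subdivides (R2 F) S2" "subdivides (R3 F) S3"
    "subdivides (R4 F) S4" "S = S1 \<union> S2 \<union> S3 \<union> S4"
    using assms(1) unfolding red_split_def by blast
  have sub: "S1 \<subseteq> \<T>" "S2 \<subseteq> \<T>" "S3 \<subseteq> \<T>" "S4 \<subseteq> \<T>" using S(5) assms(2) by auto
  obtain v1 v2 v3 where F: "tri F = (v1, v2, v3)" "0 < orient v1 v2 v3" using c by (rule tri_cases)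
  define m12 m23 m31 where m: "m12 = midpoint v1 v2" "m23 = midpoint v2 v3" "m31 = midpoint v3 v1"
  have t: "tri (R1 F) = (v1, m12, m31)" "tri (R2 F) = (m12, v2, m23)" "tri (R3 F) = (m31, m23, v3)"
    "tri (R4 F) = (m23, m31, m12)" by (simp_all add: tri.simps F m)
  have o: "0 < orient v1 m12 m31" "0 < orient m12 v2 m23" "0 < orient m31 m23 v3" "0 < orient m23 m31 m12"
    unfolding m by (rule child_orient[OF F(2)])+
  have cc: "ccw (tri (R1 F))" "ccw (tri (R2 F))" "ccw (tri (R3 F))" "ccw (tri (R4 F))" using c by simp_all
  have sum: "card (patch S v) = card (patch S1 v) + card (patch S2 v) + card (patch S3 v) + card (patch S4 v)"
    unfolding S(5) by (rule card_patch_red[OF S(1-4) sub c])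
  have vX: "v \<in> region X" using newest_vert[OF X(2)] vertE by blast
  have vm: "v \<in> vert F \<union> mids (tri F)" using v by simp
  consider "X \<in> S1" | "X \<in> S2" | "X \<in> S3" | "X \<in> S4" using X(1) S(5) by blast
  then show ?thesis
  proof cases
    case 1
    have "v \<in> vert (R1 F)"
      using vert_red(1)[OF c vm] subdivides_hull_subset[OF S(1) cc(1) 1] vX by blast
    then have "X = R1 F" using subdivides_old_vertex[OF S(1) cc(1) _ 1 vX] X(2) by blast
    then have T: "R1 F \<in> \<T>" and vm: "v = m31" using 1 sub(1) X(2) by (auto simp: is_newest_vertex_def t)
    have "S1 = {R1 F}" by (rule subdivides_element[OF S(1) sub(1) T])
    then have 1: "card (patch S1 v) \<le> 1" using card_patch_singleton by simp
    have "patch S2 v = {}"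
      by (rule patch_off[OF S(2) cc(2)]) (use corners_off[OF F] in \<open>simp add: vm m\<close>)
    then have 2: "card (patch S2 v) = 0" by simp
    have e: "midpoint m31 m12 \<notin> N" by (rule mids_not_node[OF T]) (simp add: t midpoint_sym)
    have 4: "card (patch S4 v) \<le> 1" unfolding vm by (rule card_patch_second[OF S(4) sub(4) t(4) o(4) e])
    have 3: "card (patch S3 v) \<le> 1"
    proof (cases "midpoint m31 m23 \<in> N")
      case False
      then have "S3 = {R3 F}" by (intro leaf_if_reference_edge(1)[OF S(3) sub(3) t(3)])
      then show ?thesis using card_patch_singleton by simp
    next
      case True
      \<comment> \<open>The segment from m31 to m23 is the reference edge of both \<open>R3\<close>
        and \<open>R4\<close>. With the side m31 m12 unbisected, \<open>R4\<close> can only be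
        refined green, and \<open>G2 (R4 F)\<close> is an element having half of the common edge as
        a side.\<close>
      have "midpoint m31 (midpoint m31 m23) \<notin> N"
        using S(4) sub(4) t(4)
      proof (cases rule: split_cases)
        case leaf
        then show ?thesis using mids_not_node[of "R4 F" "midpoint m31 m23"] True by (simp add: t midpoint_sym)
      next
        case (green U1 U2)
        have t2: "tri (G2 (R4 F)) = (m31, m12, midpoint m23 m31)" by (simp add: tri.simps(7) t)
        have "G2 (R4 F) \<in> \<T>" by (rule leaf_if_reference_edge(2)[OF green(2,5) t2 e])
        then show ?thesis by (rule mids_not_node) (simp add: t2 midpoint_sym)
      qed (use e in blast)
      then show ?thesis unfolding vm by (rule card_patch_first_half[OF S(3) sub(3) t(3) o(3)])
    qed
    show ?thesis using sum 1 2 3 4 by linarith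
  next
    case 2
    have "v \<in> vert (R2 F)"
      using vert_red(2)[OF c vm] subdivides_hull_subset[OF S(2) cc(2) 2] vX by blast
    then have "X = R2 F" using subdivides_old_vertex[OF S(2) cc(2) _ 2 vX] X(2) by blast
    then have T: "R2 F \<in> \<T>" and vm: "v = m23" using 2 sub(2) X(2) by (auto simp: is_newest_vertex_def t)
    have "S2 = {R2 F}" by (rule subdivides_element[OF S(2) sub(2) T])
    then have 2: "card (patch S2 v) \<le> 1" using card_patch_singleton by simp
    have "patch S1 v = {}"
      by (rule patch_off[OF S(1) cc(1)]) (use corners_off[OF F] in \<open>simp add: vm m\<close>)
    then have 1: "card (patch S1 v) = 0" by simp
    have e: "midpoint m12 m23 \<notin> N" by (rule mids_not_node[OF T]) (simp add: t midpoint_sym)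
    have 4: "card (patch S4 v) \<le> 1" unfolding vm by (rule card_patch_first[OF S(4) sub(4) t(4) o(4) e])
    have 3: "card (patch S3 v) \<le> 1"
    proof (cases "midpoint m31 m23 \<in> N")
      case False
      then have "S3 = {R3 F}" by (intro leaf_if_reference_edge(1)[OF S(3) sub(3) t(3)])
      then show ?thesis using card_patch_singleton by simp
    next
      case True
      have "midpoint (midpoint m31 m23) m23 \<notin> N"
        using S(4) sub(4) t(4)
      proof (cases rule: split_cases)
        case leaf
        then show ?thesis using mids_not_node[of "R4 F" "midpoint m31 m23"] True by (simp add: t midpoint_sym)
      next
        case (green U1 U2)
        have t1: "tri (G1 (R4 F)) = (m12, m23, midpoint m23 m31)" by (simp add: tri.simps(6) t)
        have "G1 (R4 F) \<in> \<T>" by (rule leaf_if_reference_edge(2)[OF green(1,4) t1 e])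
        then show ?thesis by (rule mids_not_node) (simp add: t1 midpoint_sym)
      qed (use e in blast)
      then show ?thesis unfolding vm by (rule card_patch_second_half[OF S(3) sub(3) t(3) o(3)])
    qed
    show ?thesis using sum 1 2 3 4 by linarith
  next
    case 3
    have "v \<in> vert (R3 F)"
      using vert_red(3)[OF c vm] subdivides_hull_subset[OF S(3) cc(3) 3] vX by blast
    then have "X = R3 F" using subdivides_old_vertex[OF S(3) cc(3) _ 3 vX] X(2) by blast
    then show ?thesis using X(2) by (simp add: is_newest_vertex_def)
  next
    case 4
    have "v \<in> vert (R4 F)"
      using vert_red(4)[OF c vm] subdivides_hull_subset[OF S(4) cc(4) 4] vX by blast
    then have "X = R4 F" using subdivides_old_vertex[OF S(4) cc(4) _ 4 vX] X(2) by blast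
    then have T: "R4 F \<in> \<T>" and vm: "v = m12" using 4 sub(4) X(2) by (auto simp: is_newest_vertex_def t)
    have "S4 = {R4 F}" by (rule subdivides_element[OF S(4) sub(4) T])
    then have 4: "card (patch S4 v) \<le> 1" using card_patch_singleton by simp
    have "patch S3 v = {}"
      by (rule patch_off[OF S(3) cc(3)]) (use corners_off[OF F] in \<open>simp add: vm m\<close>)
    then have 3: "card (patch S3 v) = 0" by simp
    \<comment> \<open>Both corner children at m12 share a side with the unrefined
      \<open>R4\<close>.\<close>
    have e: "midpoint m12 m31 \<notin> N" "midpoint m23 m12 \<notin> N"
      by (rule mids_not_node[OF T]; simp add: t midpoint_sym)+
    have 1: "card (patch S1 v) \<le> 1" unfolding vm by (rule card_patch_second[OF S(1) sub(1) t(1) o(1) e(1)])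
    have 2: "card (patch S2 v) \<le> 1" unfolding vm by (rule card_patch_first[OF S(2) sub(2) t(2) o(2) e(2)])
    show ?thesis using sum 1 2 3 4 by linarith
  qed
qed

text \<open>m is the third vertex of both green children, so \<open>card_patch_third\<close> applies
  once an edge at m is known to be unbisected. In the second claim these edges are the halves of the
  reference edge; in the third it is the common side of the children, one of which is an
  element.\<close>

lemma green_split_card:
  assumes "green_split F S" "S \<subseteq> \<T>" and F: "tri F = (v1, v2, v3)" "0 < orient v1 v2 v3"
  defines "m \<equiv> midpoint v1 v2"
  shows "2 \<le> card (patch S m)"
    and "card (patch S m) = 2 \<Longrightarrow> midpoint v1 m \<notin> N \<Longrightarrow> midpoint m v2 \<notin> N \<Longrightarrow> S = children Green F"
    and "X \<in> S \<Longrightarrow> is_newest_vertex m X \<Longrightarrow>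
      card (patch S m) \<le> 3 \<and> (card (patch S m) = 2 \<longrightarrow> S = children Green F)"
proof -
  obtain S1 S2 where S: "subdivides (G1 F) S1" "subdivides (G2 F) S2" "S = S1 \<union> S2"
    using assms(1) unfolding green_split_def by blast
  have sub: "S1 \<subseteq> \<T>" "S2 \<subseteq> \<T>" using S(3) assms(2) by auto
  have c: "ccw (tri F)" "ccw (tri (G1 F))" "ccw (tri (G2 F))" using F by simp_all
  have t: "tri (G1 F) = (v3, v1, m)" "tri (G2 F) = (v2, v3, m)" by (simp_all add: tri.simps F m_def)
  have o: "0 < orient v3 v1 m" "0 < orient v2 v3 m" unfolding m_def by (rule child_orient[OF F(2)])+
  have n: "G1 F \<notin> red_middle \<T>" "G2 F \<notin> red_middle \<T>" using red_middle_R4 by blast+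
  have sum: "card (patch S m) = card (patch S1 m) + card (patch S2 m)"
    unfolding S(3) by (rule card_patch_green[OF S(1,2) sub c(1)])
  have mv: "m \<in> vert (G1 F)" "m \<in> vert (G2 F)" by (simp_all add: t)
  have p: "1 \<le> card (patch S1 m)" "1 \<le> card (patch S2 m)"
    using card_patch_pos[OF S(1) sub(1) mv(1) n(1)] card_patch_pos[OF S(2) sub(2) mv(2) n(2)] .
  then show "2 \<le> card (patch S m)" using sum by linarith
  have G: "S1 = {G1 F} \<Longrightarrow> S2 = {G2 F} \<Longrightarrow> S = children Green F" using S(3) by auto
  note third1 = card_patch_third[OF S(1) sub(1) t(1) o(1)]
  note third2 = card_patch_third[OF S(2) sub(2) t(2) o(2)]
  show "S = children Green F" if "card (patch S m) = 2" "midpoint v1 m \<notin> N" "midpoint m v2 \<notin> N"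
    using third1(2) third2(2) that sum p G by force
  show "card (patch S m) \<le> 3 \<and> (card (patch S m) = 2 \<longrightarrow> S = children Green F)"
    if X: "X \<in> S" "is_newest_vertex m X"
  proof -
    have mX: "m \<in> region X" using newest_vert[OF X(2)] vertE by blast
    consider "X \<in> S1" | "X \<in> S2" using X(1) S(3) by blast
    then show ?thesis
    proof cases
      case 1
      have "X = G1 F" using subdivides_old_vertex[OF S(1) c(2) mv(1) 1 mX] X(2) by blast
      then have T: "G1 F \<in> \<T>" using 1 sub(1) by blast
      have S1: "S1 = {G1 F}" by (rule subdivides_element[OF S(1) sub(1) T])
      have "midpoint v3 m \<notin> N" by (rule mids_not_node[OF T]) (simp add: t midpoint_sym)
      then have "card (patch S2 m) \<le> 2" "S2 = {G2 F} \<or> 2 \<le> card (patch S2 m)" using third2 by blast+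
      moreover have "card (patch S1 m) \<le> 1" unfolding S1 by (rule card_patch_singleton)
      ultimately show ?thesis using sum p G[OF S1] by force
    next
      case 2
      have "X = G2 F" using subdivides_old_vertex[OF S(2) c(3) mv(2) 2 mX] X(2) by blast
      then have T: "G2 F \<in> \<T>" using 2 sub(2) by blast
      have S2: "S2 = {G2 F}" by (rule subdivides_element[OF S(2) sub(2) T])
      have "midpoint m v3 \<notin> N" by (rule mids_not_node[OF T]) (simp add: t midpoint_sym)
      then have "card (patch S1 m) \<le> 2" "S1 = {G1 F} \<or> 2 \<le> card (patch S1 m)" using third1 by blast+
      moreover have "card (patch S2 m) \<le> 1" unfolding S2 by (rule card_patch_singleton)
      ultimately show ?thesis using sum p G[OF _ S2] by force
    qed
  qed
qed

lemma bisects_card: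
  assumes F: "bisects F S a b" "S \<subseteq> \<T>"
  defines "v \<equiv> midpoint a b"
  shows "2 \<le> card (patch S v)"
    and "card (patch S v) = 2 \<Longrightarrow> midpoint a v \<notin> N \<Longrightarrow> midpoint v b \<notin> N \<Longrightarrow> complete_split F S a b"
    and "X \<in> S \<Longrightarrow> is_newest_vertex v X \<Longrightarrow>
      card (patch S v) \<le> 3 \<and> (card (patch S v) = 2 \<longrightarrow> complete_split F S a b)"
proof -
  have c: "ccw (tri F)" using F(1) by (simp add: bisects_def)
  obtain v1 v2 v3 where t: "tri F = (v1, v2, v3)" "0 < orient v1 v2 v3" using c by (rule tri_cases)
  have "2 \<le> card (patch S v) \<and>
    (card (patch S v) = 2 \<longrightarrow> midpoint a v \<notin> N \<longrightarrow> midpoint v b \<notin> N \<longrightarrow> complete_split F S a b) \<and>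
    (X \<in> S \<longrightarrow> is_newest_vertex v X \<longrightarrow>
      card (patch S v) \<le> 3 \<and> (card (patch S v) = 2 \<longrightarrow> complete_split F S a b))"
  proof (cases "red_split F S \<and> {a, b} \<in> sides (tri F)")
    case True
    then have m: "v \<in> mids (tri F)" unfolding v_def mids_sides by blast
    have r: "red_split F S" using True by blast
    have "complete_split F S a b" if "card (patch S v) = 2"
      using red_split_card(2)[OF r F(2) c m that] True by (simp add: complete_split_def)
    moreover have "card (patch S v) \<le> 3" if "X \<in> S" "is_newest_vertex v X"
      by (rule red_split_newest[OF r F(2) c m that])
    ultimately show ?thesis using red_split_card(1)[OF r F(2) c m] by (intro conjI impI) fast+
  next
    case False
    then have "green_split F S \<and> {a, b} = {fst (tri F), fst (snd (tri F))}"
      using F(1) unfolding bisects_def by blast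
    then have g: "green_split F S" "{a, b} = {v1, v2}" unfolding t(1) by simp_all
    have v: "v = midpoint v1 v2" unfolding v_def by (rule midpoint_doubleton[OF g(2)])
    have half: "midpoint v1 v \<notin> N" "midpoint v v2 \<notin> N" if "midpoint a v \<notin> N" "midpoint v b \<notin> N"
      using that g(2) by (auto simp: doubleton_eq_iff midpoint_sym)
    have comp: "complete_split F S a b" if "S = children Green F"
      using that g(2) by (simp add: complete_split_def t(1))
    note G = green_split_card[OF g(1) F(2) t, folded v]
    have "complete_split F S a b"
      if "card (patch S v) = 2" "midpoint a v \<notin> N" "midpoint v b \<notin> N"
      by (rule comp[OF G(2)[OF that(1) half[OF that(2,3)]]])
    moreover have "card (patch S v) \<le> 3 \<and> (card (patch S v) = 2 \<longrightarrow> complete_split F S a b)"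
      if "X \<in> S" "is_newest_vertex v X"
      using G(3)[OF that] comp by (intro conjI impI) fast+
    ultimately show ?thesis using G(1) by (intro conjI impI) fast+
  qed
  then show "2 \<le> card (patch S v)"
    "card (patch S v) = 2 \<Longrightarrow> midpoint a v \<notin> N \<Longrightarrow> midpoint v b \<notin> N \<Longrightarrow> complete_split F S a b"
    "X \<in> S \<Longrightarrow> is_newest_vertex v X \<Longrightarrow>
      card (patch S v) \<le> 3 \<and> (card (patch S v) = 2 \<longrightarrow> complete_split F S a b)"
    by blast+
qed

text \<open>In an unrefined pattern each half of the bisected side is a full side of an element.
  This carries information from the triangle with the newest vertex to the triangle across the
  edge.\<close>

lemma complete_split_halves:
  assumes "complete_split F S a b" "S \<subseteq> \<T>"
  shows "midpoint a (midpoint a b) \<notin> N" "midpoint (midpoint a b) b \<notin> N"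
proof -
  obtain v1 v2 v3 where t: "tri F = (v1, v2, v3)" using prod_cases3 by blast
  have *: "midpoint a (midpoint a b) \<in> mids (tri X) \<union> mids (tri Y) \<and> midpoint (midpoint a b) b \<in> mids (tri X) \<union> mids (tri Y) \<Longrightarrow>
      X \<in> \<T> \<Longrightarrow> Y \<in> \<T> \<Longrightarrow> midpoint a (midpoint a b) \<notin> N \<and> midpoint (midpoint a b) b \<notin> N" for X Y
    using mids_not_node by blast
  consider "R1 F \<in> \<T>" "R2 F \<in> \<T>" "{a, b} = {v1, v2}" | "R2 F \<in> \<T>" "R3 F \<in> \<T>" "{a, b} = {v2, v3}"
    | "R1 F \<in> \<T>" "R3 F \<in> \<T>" "{a, b} = {v3, v1}" | "G1 F \<in> \<T>" "G2 F \<in> \<T>" "{a, b} = {v1, v2}"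
    using assms by (auto simp: complete_split_def t)
  then have "midpoint a (midpoint a b) \<notin> N \<and> midpoint (midpoint a b) b \<notin> N"
  proof cases
    case 1 show ?thesis by (rule *[OF _ 1(1,2)]) (use 1(3) in \<open>auto simp: doubleton_eq_iff tri.simps t midpoint_sym\<close>)
  next
    case 2 show ?thesis by (rule *[OF _ 2(1,2)]) (use 2(3) in \<open>auto simp: doubleton_eq_iff tri.simps t midpoint_sym\<close>)
  next
    case 3 show ?thesis by (rule *[OF _ 3(1,2)]) (use 3(3) in \<open>auto simp: doubleton_eq_iff tri.simps t midpoint_sym\<close>)
  next
    case 4 show ?thesis by (rule *[OF _ 4(1,2)]) (use 4(3) in \<open>auto simp: doubleton_eq_iff tri.simps t midpoint_sym\<close>)
  qed
  then show "midpoint a (midpoint a b) \<notin> N" "midpoint (midpoint a b) b \<notin> N" by blast+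
qed

lemma reduced_patch_eq: "reduced_patch \<T> v = patch \<T> v"
  by (auto simp: reduced_patch_def patch_def)

text \<open>The reduced patch is the disjoint union of the contributions of the triangles of
  \<open>\<T>'\<close> at the node, each at least two. The triangle of \<open>X0\<close> contributes
  at most three, so it and then all others contribute exactly two.\<close>

lemma admissible_complete:
  assumes sub: "subdivision \<T>' \<T>" and til: "tiling K' \<T>'"
    and side: "\<And>E. E \<in> \<T>' \<Longrightarrow> midpoint a b \<in> region E \<Longrightarrow> {a, b} \<in> sides (tri E)"
    and X0: "X0 \<in> \<T>" "is_newest_vertex (midpoint a b) X0"
    and card: "card (reduced_patch \<T> (midpoint a b)) \<in> {2, 4}"
    and X: "X \<in> \<T>" "midpoint a b \<in> vert X"
  shows "\<exists>F S. complete_split F S a b \<and> S \<subseteq> \<T> \<and> X \<in> S"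
proof -
  define v where "v = midpoint a b"
  obtain f where f: "\<And>E. E \<in> \<T>' \<Longrightarrow> subdivides E (f E)" and T: "\<T> = (\<Union>E\<in>\<T>'. f E)"
    using sub by (auto simp: subdivision_def)
  have c: "ccw (tri E)" if "E \<in> \<T>'" for E using til that by (simp add: tiling_def)
  have fT: "f E \<subseteq> \<T>" if "E \<in> \<T>'" for E using that T by blast
  have vN: "v \<in> N" using X unfolding v_def nodes_def by blast
  define D where "D = {E \<in> \<T>'. v \<in> region E}"
  have D: "E \<in> \<T>'" "v \<in> region E" if "E \<in> D" for E using that by (auto simp: D_def)
  have finD: "finite D" using til by (simp add: D_def tiling_def)
  have "\<exists>F S'. bisects F S' a b \<and> S' \<subseteq> f E \<and> (\<forall>X\<in>f E. v \<in> vert X \<longrightarrow> X \<in> S')" if "E \<in> D" for E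
    using side_father[OF f fT c side] D[OF that] vN unfolding v_def by blast
  then obtain F S where FS: "\<And>E. E \<in> D \<Longrightarrow> bisects (F E) (S E) a b" "\<And>E. E \<in> D \<Longrightarrow> S E \<subseteq> f E"
    "\<And>E X. E \<in> D \<Longrightarrow> X \<in> f E \<Longrightarrow> v \<in> vert X \<Longrightarrow> X \<in> S E"
    by metis
  have ST: "S E \<subseteq> \<T>" if "E \<in> D" for E using FS(2)[OF that] fT D(1)[OF that] by blast
  define k where "k E = card (patch (S E) v)" for E
  have inD: "E \<in> D" if "E \<in> \<T>'" "Y \<in> f E" "v \<in> vert Y" for E Y
    using subdivides_hull_subset[OF f[OF that(1)] c[OF that(1)] that(2)] vertE[OF that(3)] that(1)
    by (auto simp: D_def)
  \<comment> \<open>An element at v lies below some triangle of D and there in the part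
    \<open>S E\<close> below the bisected father.\<close>
  have "patch \<T> v = (\<Union>E\<in>D. patch (S E) v)"
  proof (intro equalityI subsetI)
    fix Y assume Y: "Y \<in> patch \<T> v"
    then have "Y \<in> \<T>" and vY: "v \<in> vert Y" by (auto simp: patch_def)
    then obtain E where E: "E \<in> \<T>'" "Y \<in> f E" unfolding T by blast
    then have "Y \<in> S E" "E \<in> D" using FS(3) inD vY by blast+
    then show "Y \<in> (\<Union>E\<in>D. patch (S E) v)" using Y by (auto simp: patch_def)
  next
    fix Y assume "Y \<in> (\<Union>E\<in>D. patch (S E) v)"
    then show "Y \<in> patch \<T> v" using ST by (auto simp: patch_def)
  qed
  moreover have "patch (S E) v \<inter> patch (S E') v = {}" if E: "E \<in> D" "E' \<in> D" "E \<noteq> E'" for E E'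
  proof -
    have "interior (region E) \<inter> interior (region E') = {}"
      using tiling_overlap[OF til] D E by metis
    then have "f E \<inter> f E' = {}" using subdivides_disjoint[OF f f c c] D E by metis
    then show ?thesis using FS(2)[OF E(1)] FS(2)[OF E(2)] unfolding patch_def by blast
  qed
  ultimately have total: "card (reduced_patch \<T> v) = (\<Sum>E\<in>D. k E)"
    unfolding reduced_patch_eq k_def using finD patch_finite[OF ST] by (simp add: card_UN_disjoint)
  have ge2: "2 \<le> k E" if "E \<in> D" for E
    using bisects_card(1)[OF FS(1)[OF that] ST[OF that]] by (simp add: k_def v_def)
  obtain E0 where E0: "E0 \<in> \<T>'" "X0 \<in> f E0" using X0(1) unfolding T by blast
  have vX0: "v \<in> vert X0" using newest_vert[OF X0(2)] by (simp add: v_def)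
  have E0D: "E0 \<in> D" and X0S: "X0 \<in> S E0" using inD[OF E0 vX0] FS(3) E0(2) vX0 by blast+
  have k0: "k E0 \<le> 3" "k E0 = 2 \<Longrightarrow> complete_split (F E0) (S E0) a b"
    using bisects_card(3)[OF FS(1)[OF E0D] ST[OF E0D] X0S X0(2)] unfolding k_def v_def by blast+
  define r where "r = (\<Sum>E\<in>D - {E0}. k E)"
  have split: "(\<Sum>E\<in>D. k E) = k E0 + r" unfolding r_def using finD E0D by (simp add: sum.remove)
  have r2: "r = 0 \<or> 2 \<le> r"
  proof (cases "D - {E0} = {}")
    case True
    then show ?thesis unfolding r_def by (simp only: sum.empty simp_thms)
  next
    case False
    then obtain E where E: "E \<in> D - {E0}" by blast
    then have "k E \<le> r" unfolding r_def using finD by (intro member_le_sum) auto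
    then show ?thesis using ge2[of E] E by force
  qed
  have tot: "k E0 + r \<in> {2, 4}" using card total split unfolding v_def by simp
  \<comment> \<open>Three plus either zero or at least two is never two or four.\<close>
  have kE0: "k E0 = 2" using tot k0(1) ge2[OF E0D] r2 by auto
  have k2: "k E = 2" if "E \<in> D" for E
  proof (cases "E = E0")
    case False
    then have "k E \<le> r" unfolding r_def using finD that by (intro member_le_sum) auto
    then show ?thesis using tot kE0 ge2[OF that] by auto
  qed (simp add: kE0)
  \<comment> \<open>Known from the pattern in \<open>E0\<close>, used for the patterns in all other
    triangles of D.\<close>
  have half: "midpoint a v \<notin> N" "midpoint v b \<notin> N"
    using complete_split_halves[OF k0(2)[OF kE0] ST[OF E0D]] by (simp_all add: v_def)
  obtain E where E: "E \<in> \<T>'" "X \<in> f E" using X(1) unfolding T by blast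
  have vX: "v \<in> vert X" using X(2) by (simp add: v_def)
  have ED: "E \<in> D" and XS: "X \<in> S E" using inD[OF E vX] FS(3) E(2) vX by blast+
  have "complete_split (F E) (S E) a b"
    by (rule bisects_card(2)[OF FS(1)[OF ED] ST[OF ED]]) (use k2[OF ED] half in \<open>simp_all add: k_def v_def\<close>)
  then show ?thesis using ST[OF ED] XS by blast
qed

end

section \<open>Nodes of a single pattern\<close>

fun pattern_nodes :: "pattern \<Rightarrow> triangle \<Rightarrow> point set" where
  "pattern_nodes Unrefined t = vertices t"
| "pattern_nodes Red t = vertices t \<union> mids t"
| "pattern_nodes Green t = vertices t \<union> {mid12 t}"
| "pattern_nodes Blue_r t = vertices t \<union> {mid12 t, mid23 t}"
| "pattern_nodes Blue_l t = vertices t \<union> {mid12 t, mid31 t}"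

lemma mids_eq: "mids t = {mid12 t, mid23 t, mid31 t}"
  by (cases t) simp

lemma vert_pattern_nodes: "Y \<in> children p X \<Longrightarrow> vert Y \<subseteq> pattern_nodes p (tri X)"
  by (cases p; cases "tri X"; auto simp: tri.simps)

lemma mid_green: "mid12 (tri (G2 X)) = mid23 (tri X)" "mid12 (tri (G1 X)) = mid31 (tri X)"
  by (cases "tri X"; simp add: tri.simps)+

text \<open>The exceptional points of \<open>vert_green\<close> are excluded here. The lemma serves
  the green pattern and, applied to a green child, the second step of a blue one.\<close>

lemma vert_double_green:
  assumes "ccw (tri X)" "x \<in> vert X \<union> {mid12 (tri X)}"
  shows "x \<in> region (G1 X) \<Longrightarrow> x \<in> vert (G1 X)" "x \<in> region (G2 X) \<Longrightarrow> x \<in> vert (G2 X)"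
proof -
  have x: "x \<in> vert X \<union> mids (tri X)" using assms(2) by (auto simp: mids_eq)
  obtain v1 v2 v3 where t: "tri X = (v1, v2, v3)" "0 < orient v1 v2 v3" using assms(1) by (rule tri_cases)
  have "mid12 (tri X) \<in> vert (G1 X)" "mid12 (tri X) \<in> vert (G2 X)" by (simp_all add: t tri.simps)
  moreover have "x \<in> vert X \<Longrightarrow> x \<noteq> mid31 (tri X) \<and> x \<noteq> mid23 (tri X)"
    using mids_disjoint_vert[OF assms(1)] by (auto simp: mids_eq)
  ultimately show "x \<in> region (G1 X) \<Longrightarrow> x \<in> vert (G1 X)" "x \<in> region (G2 X) \<Longrightarrow> x \<in> vert (G2 X)"
    using vert_green[OF assms(1) x] assms(2) by auto
qed

text \<open>In a blue pattern the second midpoint lies outside the undivided green child and bisects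
  the reference edge of the other one, which is thus a green pattern again.\<close>

lemma pattern_no_hanging:
  assumes c: "ccw (tri X)" and Y: "Y \<in> children p X" and x: "x \<in> pattern_nodes p (tri X)" "x \<in> region Y"
  shows "x \<in> vert Y"
proof (cases p)
  case Unrefined
  then show ?thesis using Y x by simp
next
  case Red
  then have x': "x \<in> vert X \<union> mids (tri X)" using x(1) by simp
  have "Y \<in> {R1 X, R2 X, R3 X, R4 X}" using Y Red by simp
  then show ?thesis using vert_red[OF c x'] x(2) by auto
next
  case Green
  then have x': "x \<in> vert X \<union> {mid12 (tri X)}" using x(1) by simp
  have "Y \<in> {G1 X, G2 X}" using Y Green by simp
  then show ?thesis using vert_double_green[OF c x'] x(2) by auto
next
  case Blue_r
  then have x': "x \<in> vert X \<union> {mid12 (tri X), mid23 (tri X)}" using x(1) by simp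
  then have xm: "x \<in> vert X \<union> mids (tri X)" by (auto simp: mids_eq)
  obtain v1 v2 v3 where t: "tri X = (v1, v2, v3)" "0 < orient v1 v2 v3" using c by (rule tri_cases)
  have c2: "ccw (tri (G2 X))" using c by simp
  consider "Y = G1 X" | "Y = G1 (G2 X)" | "Y = G2 (G2 X)" using Y Blue_r by auto
  then show ?thesis
  proof cases
    case 1
    then have "x \<noteq> mid23 (tri X)" using corners_off(3)[OF t] x(2) by (auto simp: t(1))
    then show ?thesis using vert_double_green(1)[OF c] x' x(2) 1 by blast
  next
    case 2
    have "x \<in> region (G2 X)" using x(2) hull_green[OF c2] 2 by blast
    then have "x \<in> vert (G2 X) \<union> {mid12 (tri (G2 X))}" using vert_green(2)[OF c xm] by (simp add: mid_green)
    then show ?thesis using vert_double_green(1)[OF c2] x(2) 2 by blast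
  next
    case 3
    have "x \<in> region (G2 X)" using x(2) hull_green[OF c2] 3 by blast
    then have "x \<in> vert (G2 X) \<union> {mid12 (tri (G2 X))}" using vert_green(2)[OF c xm] by (simp add: mid_green)
    then show ?thesis using vert_double_green(2)[OF c2] x(2) 3 by blast
  qed
next
  case Blue_l
  then have x': "x \<in> vert X \<union> {mid12 (tri X), mid31 (tri X)}" using x(1) by simp
  then have xm: "x \<in> vert X \<union> mids (tri X)" by (auto simp: mids_eq)
  obtain v1 v2 v3 where t: "tri X = (v1, v2, v3)" "0 < orient v1 v2 v3" using c by (rule tri_cases)
  have c1: "ccw (tri (G1 X))" using c by simp
  consider "Y = G2 X" | "Y = G1 (G1 X)" | "Y = G2 (G1 X)" using Y Blue_l by auto
  then show ?thesis
  proof cases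
    case 1
    then have "x \<noteq> mid31 (tri X)" using corners_off(4)[OF t] x(2) by (auto simp: t(1))
    then show ?thesis using vert_double_green(2)[OF c] x' x(2) 1 by blast
  next
    case 2
    have "x \<in> region (G1 X)" using x(2) hull_green[OF c1] 2 by blast
    then have "x \<in> vert (G1 X) \<union> {mid12 (tri (G1 X))}" using vert_green(1)[OF c xm] by (simp add: mid_green)
    then show ?thesis using vert_double_green(1)[OF c1] x(2) 2 by blast
  next
    case 3
    have "x \<in> region (G1 X)" using x(2) hull_green[OF c1] 3 by blast
    then have "x \<in> vert (G1 X) \<union> {mid12 (tri (G1 X))}" using vert_green(1)[OF c xm] by (simp add: mid_green)
    then show ?thesis using vert_double_green(2)[OF c1] x(2) 3 by blast
  qed
qed

section \<open>The coarsened mesh\<close>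

text \<open>The assumption \<open>complete\<close> is the outcome of the count. From here on the
  removal of nodes is combinatorial and makes no reference to the refinement history.\<close>

locale coarsening = mesh +
  fixes \<T>\<^sub>0 :: "triangle set" and N_mark :: "point set"
  assumes initial: "tiling K (Initial ` \<T>\<^sub>0)" "no_hanging_nodes (Initial ` \<T>\<^sub>0)"
      "subdivision (Initial ` \<T>\<^sub>0) \<T>"
    and complete: "\<lbrakk>v \<in> N_adm_init \<T>\<^sub>0 \<T> N_mark; X \<in> \<T>; v \<in> vert X\<rbrakk> \<Longrightarrow>
      \<exists>F. children Red F \<subseteq> \<T> \<and> X \<in> children Red F \<and> v \<in> mids (tri F) \<or>
        children Green F \<subseteq> \<T> \<and> X \<in> children Green F \<and> v = mid12 (tri F)"
begin

abbreviation A :: "point set" where "A \<equiv> N_adm \<T>\<^sub>0 \<T> N_mark"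
abbreviation H :: "point set" where "H \<equiv> N_hang \<T>\<^sub>0 \<T> N_mark"
abbreviation red_fathers :: "element set" where "red_fathers \<equiv> {F. children Red F \<subseteq> \<T>}"
abbreviation green_fathers :: "element set" where "green_fathers \<equiv> {F. children Green F \<subseteq> \<T>}"

text \<open>An initial node inside an initial triangle is one of its vertices, and such a vertex is
  never newest for a proper descendant.\<close>

lemma newest_in_N_new:
  assumes X: "X \<in> \<T>" "is_newest_vertex v X" "\<And>t. X \<noteq> Initial t"
  shows "v \<in> N_new \<T>\<^sub>0 \<T>"
proof -
  obtain f where f: "\<And>E. E \<in> Initial ` \<T>\<^sub>0 \<Longrightarrow> subdivides E (f E)" and T: "\<T> = (\<Union>E\<in>Initial ` \<T>\<^sub>0. f E)"
    using initial(3) unfolding subdivision_def by blast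
  obtain E where E: "E \<in> Initial ` \<T>\<^sub>0" "X \<in> f E" using X(1) unfolding T by blast
  have c: "ccw (tri E)" using initial(1) E(1) by (auto simp: tiling_def)
  have v: "v \<in> vert X" "v \<in> region X" using newest_vert[OF X(2)] vertE by blast+
  have "v \<notin> nodes \<T>\<^sub>0"
  proof
    assume "v \<in> nodes \<T>\<^sub>0"
    then have "v \<in> nodes (tri ` Initial ` \<T>\<^sub>0)" by (simp add: image_image)
    moreover have "v \<in> region E" using subdivides_hull_subset[OF f[OF E(1)] c E(2)] v(2) by blast
    ultimately have "v \<in> vert E" using initial(2) E(1) unfolding no_hanging_nodes_def by blast
    then have "X = E" using subdivides_old_vertex[OF f[OF E(1)] c _ E(2) v(2)] X(2) by blast
    then show False using E(1) X(3) by blast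
  qed
  moreover have "v \<in> N" using X(1) v(1) by (auto simp: nodes_def)
  ultimately show ?thesis using X(1,2) by (auto simp: N_new_def)
qed

lemma N_new_cases: "v \<in> N_new \<T>\<^sub>0 \<T> \<Longrightarrow> v \<in> A \<or> v \<in> H"
proof -
  assume v: "v \<in> N_new \<T>\<^sub>0 \<T>"
  \<comment> \<open>A node that fails the initial admissibility test is in the zeroth iterate of the
    loop.\<close>
  have "v \<in> N_block \<T>\<^sub>0 \<T> N_mark" if "v \<notin> N_adm_init \<T>\<^sub>0 \<T> N_mark"
    unfolding N_block_def using that v by (intro UN_I[of 0]) (auto simp: N_new_def)
  then show ?thesis using v by (auto simp: N_adm_def N_hang_def)
qed

lemma A_H_disjoint: "A \<inter> H = {}"
  by (auto simp: N_adm_def)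

lemma H_nodes: "H \<subseteq> N"
  by (auto simp: N_hang_def N_new_def)

text \<open>The union of all iterates is closed under the blocking rule, since a node of iterate k
  acts in iterate k + 1.\<close>

lemma block_closed:
  assumes "X \<in> red_middle \<T>" "v \<in> vert X" "v \<in> N_block \<T>\<^sub>0 \<T> N_mark"
  shows "opposite_vertex (tri X) \<in> N_block \<T>\<^sub>0 \<T> N_mark"
proof -
  obtain k where "v \<in> (block_step \<T> ^^ k) (nodes (tri ` \<T>) - N_adm_init \<T>\<^sub>0 \<T> N_mark)"
    using assms(3) unfolding N_block_def by blast
  then have "opposite_vertex (tri X) \<in> (block_step \<T> ^^ Suc k) (nodes (tri ` \<T>) - N_adm_init \<T>\<^sub>0 \<T> N_mark)"
    using assms(1,2) by (auto simp: block_step_def)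
  then show ?thesis unfolding N_block_def by blast
qed

lemma red_middle_iff: "R4 F \<in> red_middle \<T> \<longleftrightarrow> children Red F \<subseteq> \<T>"
  by (auto simp: red_middle_def)

lemma red_mids_N_new:
  assumes "children Red F \<subseteq> \<T>"
  shows "mids (tri F) \<subseteq> N_new \<T>\<^sub>0 \<T>"
proof -
  obtain v1 v2 v3 where t: "tri F = (v1, v2, v3)" using prod_cases3 by blast
  \<comment> \<open>The midpoints are the last entries of \<open>R4\<close>, \<open>R2\<close> and
    \<open>R1\<close>, respectively; \<open>R3\<close> supplies none.\<close>
  have "mid12 (tri F) \<in> N_new \<T>\<^sub>0 \<T>"
    by (rule newest_in_N_new[of "R4 F"]) (use assms in \<open>simp_all add: is_newest_vertex_def t tri.simps\<close>)
  moreover have "mid23 (tri F) \<in> N_new \<T>\<^sub>0 \<T>"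
    by (rule newest_in_N_new[of "R2 F"]) (use assms in \<open>simp_all add: is_newest_vertex_def t tri.simps\<close>)
  moreover have "mid31 (tri F) \<in> N_new \<T>\<^sub>0 \<T>"
    by (rule newest_in_N_new[of "R1 F"]) (use assms in \<open>simp_all add: is_newest_vertex_def t tri.simps\<close>)
  ultimately show ?thesis by (simp add: mids_eq)
qed

lemma green_mid_N_new:
  assumes "children Green F \<subseteq> \<T>"
  shows "mid12 (tri F) \<in> N_new \<T>\<^sub>0 \<T>"
proof -
  obtain v1 v2 v3 where t: "tri F = (v1, v2, v3)" using prod_cases3 by blast
  show ?thesis
    by (rule newest_in_N_new[of "G1 F"]) (use assms in \<open>simp_all add: is_newest_vertex_def t tri.simps\<close>)
qed

text \<open>The vertex of \<open>R4\<close> opposite to its reference edge is the midpoint of the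
  reference edge of the father. Blocking therefore keeps the reference edge bisected whenever
  another edge stays bisected, as all green and blue patterns require.\<close>

lemma red_block:
  assumes "children Red F \<subseteq> \<T>" "v \<in> mids (tri F)" "v \<in> H"
  shows "mid12 (tri F) \<in> H"
proof -
  obtain v1 v2 v3 where t: "tri F = (v1, v2, v3)" using prod_cases3 by blast
  have "opposite_vertex (tri (R4 F)) \<in> N_block \<T>\<^sub>0 \<T> N_mark"
    by (rule block_closed[of _ v]) (use assms in \<open>auto simp: red_middle_iff N_hang_def t tri.simps simp del: children.simps\<close>)
  then have "mid12 (tri F) \<in> N_block \<T>\<^sub>0 \<T> N_mark" by (simp add: t tri.simps)
  then show ?thesis using red_mids_N_new[OF assms(1)] by (auto simp: N_hang_def mids_eq)
qed

lemma ccw_red_father: "children Red F \<subseteq> \<T> \<Longrightarrow> ccw (tri F)"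
  using ccw_elements[of "R1 F"] by simp

lemma ccw_green_father: "children Green F \<subseteq> \<T> \<Longrightarrow> ccw (tri F)"
  using ccw_elements[of "G1 F"] by simp

text \<open>If a corner were admissible, the child at this corner would belong to a pattern with the
  corner as a midpoint. The genealogy of the child determines the father of that pattern, and the
  corners of F are not midpoints of F.\<close>

lemma red_father_vert:
  assumes F: "children Red F \<subseteq> \<T>"
  shows "vert F \<inter> A = {}" "vert F \<subseteq> N"
proof -
  have *: "v \<notin> A \<and> v \<in> N" if v: "v \<in> vert F" for v
  proof -
    have nm: "v \<notin> mids (tri F)" using v mids_disjoint_vert[OF ccw_red_father[OF F]] by blast
    obtain X where X: "X \<in> {R1 F, R2 F, R3 F}" "v \<in> vert X" using v vert_subset_red[of F] by blast
    then have XT: "X \<in> \<T>" using F by auto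
    have "v \<notin> A"
    proof
      assume "v \<in> A"
      then have "v \<in> N_adm_init \<T>\<^sub>0 \<T> N_mark" by (simp add: N_adm_def)
      then obtain F' where F': "X \<in> children Red F' \<and> v \<in> mids (tri F') \<or> X \<in> children Green F'"
        using complete[OF _ XT X(2)] by blast
      then have "F' = F" using X(1) by auto
      then show False using F' X(1) nm by auto
    qed
    then show ?thesis using XT X(2) by (auto simp: nodes_def)
  qed
  then show "vert F \<inter> A = {}" "vert F \<subseteq> N" by blast+
qed

lemma green_father_vert:
  assumes F: "children Green F \<subseteq> \<T>"
  shows "vert F \<inter> A = {}" "vert F \<subseteq> N"
proof -
  have *: "v \<notin> A \<and> v \<in> N" if v: "v \<in> vert F" for v
  proof -
    have nm: "v \<noteq> mid12 (tri F)" using v mids_disjoint_vert[OF ccw_green_father[OF F]] by (auto simp: mids_eq)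
    obtain X where X: "X \<in> {G1 F, G2 F}" "v \<in> vert X" using v vert_subset_green[of F] by blast
    then have XT: "X \<in> \<T>" using F by auto
    have "v \<notin> A"
    proof
      assume "v \<in> A"
      then have "v \<in> N_adm_init \<T>\<^sub>0 \<T> N_mark" by (simp add: N_adm_def)
      then obtain F' where F': "X \<in> children Red F' \<or> X \<in> children Green F' \<and> v = mid12 (tri F')"
        using complete[OF _ XT X(2)] by blast
      then have "F' = F" using X(1) by auto
      then show False using F' X(1) nm by auto
    qed
    then show ?thesis using XT X(2) by (auto simp: nodes_def)
  qed
  then show "vert F \<inter> A = {}" "vert F \<subseteq> N" by blast+
qed

text \<open>A father overlaps its children and cannot be an element beside them; a red and a green
  pattern of one father would overlap in \<open>R1\<close> and \<open>G1\<close>.\<close>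

lemma fathers_disjoint:
  "red_fathers \<inter> \<T> = {}" "green_fathers \<inter> \<T> = {}" "red_fathers \<inter> green_fathers = {}"
proof -
  have "children Red F = {F}" if "F \<in> red_fathers \<inter> \<T>" for F
    using that by (intro subdivides_element[OF subdivides_Red]) auto
  then show "red_fathers \<inter> \<T> = {}" by force
  have "children Green F = {F}" if "F \<in> green_fathers \<inter> \<T>" for F
    using that by (intro subdivides_element[OF subdivides_Green]) auto
  then show "green_fathers \<inter> \<T> = {}" by force
  have False if "children Red F \<subseteq> \<T>" "children Green F \<subseteq> \<T>" for F
  proof -
    have T: "R1 F \<in> \<T>" "G1 F \<in> \<T>" using that by simp_all
    have "interior (region (R1 F)) \<subseteq> interior (region (G1 F))"
      by (intro interior_mono hull_R1_subset_hull_G1 ccw_red_father that)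
    then have "interior (region (R1 F)) \<inter> interior (region (G1 F)) \<noteq> {}"
      using interior_hull_nonempty[OF ccw_elements[OF T(1)]] by blast
    then have "R1 F = G1 F" by (rule tiling_overlap[OF tiling T])
    then show False by simp
  qed
  then show "red_fathers \<inter> green_fathers = {}" by blast
qed

section \<open>The common coarse mesh of input and output\<close>

definition kept :: "element set" where
  "kept = \<T> - (\<Union>F\<in>red_fathers. children Red F) - (\<Union>F\<in>green_fathers. children Green F)"

text \<open>All unrefined patterns are undone here, whether or not their midpoints are admissible.
  Both the given mesh and the output are then one pattern on each of these elements.\<close>

definition coarse :: "element set" where
  "coarse = kept \<union> red_fathers \<union> green_fathers"

definition old_pattern :: "element \<Rightarrow> pattern" where
  "old_pattern X = (if X \<in> red_fathers then Red else if X \<in> green_fathers then Green else Unrefined)"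

definition red_pattern :: "element \<Rightarrow> pattern" where
  "red_pattern F = (let m12 = mid12 (tri F); m23 = mid23 (tri F); m31 = mid31 (tri F) in
      if m12 \<in> A \<and> m23 \<in> A \<and> m31 \<in> A then Unrefined
      else if m12 \<in> H \<and> m23 \<in> A \<and> m31 \<in> A then Green
      else if m12 \<in> H \<and> m31 \<in> H \<and> m23 \<in> A then Blue_l
      else if m12 \<in> H \<and> m23 \<in> H \<and> m31 \<in> A then Blue_r
      else Red)"

definition new_pattern :: "element \<Rightarrow> pattern" where
  "new_pattern X = (if X \<in> red_fathers then red_pattern X
     else if X \<in> green_fathers \<and> mid12 (tri X) \<notin> A then Green else Unrefined)"

lemma kept_not_father: "kept \<inter> red_fathers = {}" "kept \<inter> green_fathers = {}"
  using fathers_disjoint by (auto simp: kept_def)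

lemma old_pattern_kept: "X \<in> kept \<Longrightarrow> old_pattern X = Unrefined"
  and new_pattern_kept: "X \<in> kept \<Longrightarrow> new_pattern X = Unrefined"
  using kept_not_father by (auto simp: old_pattern_def new_pattern_def simp del: children.simps)

lemma elements_eq: "\<T> = (\<Union>X\<in>coarse. children (old_pattern X) X)"
proof -
  have "(\<Union>X\<in>coarse. children (old_pattern X) X) = (\<Union>X\<in>kept. children (old_pattern X) X) \<union>
    (\<Union>X\<in>red_fathers. children (old_pattern X) X) \<union> (\<Union>X\<in>green_fathers. children (old_pattern X) X)"
    unfolding coarse_def by (simp only: UN_Un)
  also have "(\<Union>X\<in>kept. children (old_pattern X) X) = kept"
    using old_pattern_kept by simp
  also have "(\<Union>X\<in>red_fathers. children (old_pattern X) X) = (\<Union>X\<in>red_fathers. children Red X)"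
    by (simp add: old_pattern_def del: children.simps)
  also have "(\<Union>X\<in>green_fathers. children (old_pattern X) X) = (\<Union>X\<in>green_fathers. children Green X)"
    using fathers_disjoint(3) by (intro SUP_cong refl) (auto simp: old_pattern_def simp del: children.simps)
  also have "kept \<union> (\<Union>X\<in>red_fathers. children Red X) \<union> (\<Union>X\<in>green_fathers. children Green X) = \<T>"
    unfolding kept_def by blast
  finally show ?thesis by (rule sym)
qed

lemma children_red_pattern: "children (red_pattern F) F = coarsen_red A H F"
  by (simp add: red_pattern_def coarsen_red_def Let_def)

lemma coarsen_eq: "coarsen \<T>\<^sub>0 \<T> N_mark = (\<Union>X\<in>coarse. children (new_pattern X) X)"
proof -
  have "(\<Union>X\<in>coarse. children (new_pattern X) X) = (\<Union>X\<in>kept. children (new_pattern X) X) \<union>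
    (\<Union>X\<in>red_fathers. children (new_pattern X) X) \<union> (\<Union>X\<in>green_fathers. children (new_pattern X) X)"
    unfolding coarse_def by (simp only: UN_Un)
  also have "(\<Union>X\<in>kept. children (new_pattern X) X) = kept"
    using new_pattern_kept by simp
  also have "(\<Union>X\<in>red_fathers. children (new_pattern X) X) = (\<Union>X\<in>red_fathers. coarsen_red A H X)"
    by (simp add: new_pattern_def children_red_pattern del: children.simps)
  also have "(\<Union>X\<in>green_fathers. children (new_pattern X) X) = (\<Union>X\<in>green_fathers. coarsen_green A X)"
    using fathers_disjoint(3)
    by (intro SUP_cong refl) (auto simp: new_pattern_def coarsen_green_def simp del: children.simps(2-))
  finally show ?thesis
    unfolding coarsen_def Let_def red_middle_iff kept_def by (rule sym)
qed

lemma ccw_coarse: "X \<in> coarse \<Longrightarrow> ccw (tri X)"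
  using ccw_elements ccw_red_father ccw_green_father by (auto simp: coarse_def kept_def simp del: children.simps)

text \<open>This mesh need not have occurred during the refinement, so its tiling property is
  recovered from the given mesh.\<close>

lemma tiling_coarse: "tiling K coarse"
proof (rule tiling_unsubdivide)
  show "tiling K (\<Union>E\<in>coarse. children (old_pattern E) E)" using tiling elements_eq by simp
  show "subdivides E (children (old_pattern E) E)" for E by (rule subdivides_children)
  show "ccw (tri E)" if "E \<in> coarse" for E using that by (rule ccw_coarse)
  \<comment> \<open>Each father is recovered from its child \<open>R1\<close> or \<open>G1\<close>,
    so there are only finitely many.\<close>
  have "red_fathers \<subseteq> R1 -` \<T>" "green_fathers \<subseteq> G1 -` \<T>" by auto
  moreover have "finite (R1 -` \<T>)" "finite (G1 -` \<T>)"
    by (intro finite_vimageI finite_elements injI; simp)+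
  ultimately have "finite red_fathers" "finite green_fathers" using finite_subset by blast+
  then show "finite coarse" using finite_elements by (simp add: coarse_def kept_def)
  show "children (old_pattern E) E \<inter> children (old_pattern E') E' = {}"
    if "E \<in> coarse" "E' \<in> coarse" "E \<noteq> E'" for E E'
  proof -
    \<comment> \<open>Children of different fathers differ as terms, and \<open>kept\<close> omits
      all children of fathers.\<close>
    have "E \<in> kept \<and> old_pattern E = Unrefined \<or> E \<in> red_fathers \<and> old_pattern E = Red \<or>
        E \<in> green_fathers \<and> old_pattern E = Green" if "E \<in> coarse" for E
      using that kept_not_father by (auto simp: coarse_def old_pattern_def simp del: children.simps)
    from this[OF that(1)] this[OF that(2)] show ?thesis
      using that(3) by (elim disjE conjE) (auto simp: kept_def)
  qed
qed

text \<open>Together the two claims say that the nodes of the new pattern in X are the points of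
  \<open>N - A\<close> in X. As this set does not depend on X, the patterns of neighbouring elements
  fit together.\<close>

lemma new_pattern_nodes:
  assumes X: "X \<in> coarse"
  shows "pattern_nodes (new_pattern X) (tri X) \<subseteq> N - A"
    and "\<lbrakk>x \<in> N - A; x \<in> region X\<rbrakk> \<Longrightarrow> x \<in> pattern_nodes (new_pattern X) (tri X)"
proof -
  \<comment> \<open>x lies in one of the present elements inside X and is a vertex of it, because
    the given mesh has no hanging nodes.\<close>
  have old: "x \<in> pattern_nodes (old_pattern X) (tri X)" if "x \<in> N" "x \<in> region X"
  proof -
    obtain Y where Y: "Y \<in> children (old_pattern X) X" "x \<in> region Y"
      using subdivides_hull[OF subdivides_children ccw_coarse[OF X]] \<open>x \<in> region X\<close> by blast
    have "Y \<in> \<T>" using Y(1) X elements_eq by blast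
    then show ?thesis using node_vert[OF _ that(1) Y(2)] vert_pattern_nodes[OF Y(1)] by blast
  qed
  have "pattern_nodes (new_pattern X) (tri X) \<subseteq> N - A \<and>
    (x \<in> N - A \<longrightarrow> x \<in> pattern_nodes (old_pattern X) (tri X) \<longrightarrow> x \<in> pattern_nodes (new_pattern X) (tri X))"
  proof (cases "X \<in> red_fathers")
    case True
    then have F: "children Red X \<subseteq> \<T>" by simp
    define m12 m23 m31 where m: "m12 = mid12 (tri X)" "m23 = mid23 (tri X)" "m31 = mid31 (tri X)"
    have AH: "m12 \<in> A \<or> m12 \<in> H" "m23 \<in> A \<or> m23 \<in> H" "m31 \<in> A \<or> m31 \<in> H"
      using red_mids_N_new[OF F] N_new_cases by (auto simp: mids_eq m)
    have block: "m23 \<in> H \<or> m31 \<in> H \<Longrightarrow> m12 \<in> H"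
      using red_block[OF F] by (auto simp: mids_eq m)
    \<comment> \<open>By blocking, the hanging midpoints are none, \<open>m12\<close> alone,
      \<open>m12\<close> with one other, or all three: the sets of the five patterns. So the final
      branch \<open>Red\<close> is reached only if all three hang.\<close>
    have new: "pattern_nodes (new_pattern X) (tri X) = vert X \<union> ({m12, m23, m31} \<inter> H)"
      using True AH block A_H_disjoint
      by (auto simp: new_pattern_def red_pattern_def Let_def mids_eq simp flip: m simp del: children.simps)
    have old': "pattern_nodes (old_pattern X) (tri X) = vert X \<union> {m12, m23, m31}"
      using True by (simp add: old_pattern_def mids_eq m del: children.simps)
    show ?thesis
      unfolding new old' using red_father_vert[OF F] A_H_disjoint H_nodes AH by (intro conjI impI) blast+
  next
    case nR: False
    show ?thesis
    proof (cases "X \<in> green_fathers")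
      case True
      then have F: "children Green X \<subseteq> \<T>" by simp
      define m12 where m: "m12 = mid12 (tri X)"
      have AH: "m12 \<in> A \<or> m12 \<in> H" using green_mid_N_new[OF F] N_new_cases by (simp add: m)
      have new: "pattern_nodes (new_pattern X) (tri X) = vert X \<union> ({m12} \<inter> H)"
        using nR True AH A_H_disjoint
        by (auto simp: new_pattern_def simp flip: m simp del: children.simps)
      have old': "pattern_nodes (old_pattern X) (tri X) = vert X \<union> {m12}"
        using nR True by (simp add: old_pattern_def m del: children.simps)
      show ?thesis
        unfolding new old' using green_father_vert[OF F] A_H_disjoint H_nodes AH by (intro conjI impI) blast+
    next
      case nG: False
      have pat: "new_pattern X = Unrefined" "old_pattern X = Unrefined"
        using nR nG by (simp_all add: new_pattern_def old_pattern_def del: children.simps)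
      have XT: "X \<in> kept" "X \<in> \<T>" using X nR nG by (auto simp: coarse_def kept_def)
      \<comment> \<open>An admissible vertex would place X in an unrefined pattern, but
        \<open>kept\<close> contains no element of such a pattern.\<close>
      have "v \<notin> A" if "v \<in> vert X" for v
      proof
        assume "v \<in> A"
        then have "v \<in> N_adm_init \<T>\<^sub>0 \<T> N_mark" by (simp add: N_adm_def)
        then show False using complete[OF _ XT(2) that] XT(1) unfolding kept_def by blast
      qed
      moreover have "vert X \<subseteq> N" using XT(2) by (auto simp: nodes_def)
      ultimately show ?thesis unfolding pat by auto
    qed
  qed
  then show "pattern_nodes (new_pattern X) (tri X) \<subseteq> N - A"
    "\<lbrakk>x \<in> N - A; x \<in> region X\<rbrakk> \<Longrightarrow> x \<in> pattern_nodes (new_pattern X) (tri X)"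
    using old by blast+
qed

lemma tiling_coarsen: "tiling K (coarsen \<T>\<^sub>0 \<T> N_mark)"
  unfolding coarsen_eq by (rule tiling_subdivision[OF tiling_coarse subdivision_children])

text \<open>A vertex of the output is a surviving node by one half of
  \<open>new_pattern_nodes\<close>; by the other half it is a node of the pattern that contains Y,
  and inside a pattern nothing hangs.\<close>

lemma no_hanging_coarsen: "no_hanging_nodes (coarsen \<T>\<^sub>0 \<T> N_mark)"
  unfolding no_hanging_nodes_def
proof (intro ballI subsetI)
  fix Y x assume Y: "Y \<in> coarsen \<T>\<^sub>0 \<T> N_mark" and x: "x \<in> nodes (tri ` coarsen \<T>\<^sub>0 \<T> N_mark) \<inter> region Y"
  obtain Z where Z: "Z \<in> coarsen \<T>\<^sub>0 \<T> N_mark" "x \<in> vert Z" using x by (auto simp: nodes_def)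
  then obtain X' where X': "X' \<in> coarse" "Z \<in> children (new_pattern X') X'" unfolding coarsen_eq by blast
  then have xN: "x \<in> N - A" using new_pattern_nodes(1)[OF X'(1)] vert_pattern_nodes[OF X'(2)] Z(2) by blast
  obtain X where X: "X \<in> coarse" "Y \<in> children (new_pattern X) X" using Y unfolding coarsen_eq by blast
  have "x \<in> region X"
    using subdivides_hull_subset[OF subdivides_children ccw_coarse[OF X(1)] X(2)] x by blast
  then have "x \<in> pattern_nodes (new_pattern X) (tri X)" by (rule new_pattern_nodes(2)[OF X(1) xN])
  then show "x \<in> vert Y" using pattern_no_hanging[OF ccw_coarse[OF X(1)] X(2)] x by blast
qed

end

section \<open>Shape regularity\<close>

fun ancestor :: "element \<Rightarrow> triangle" where
  "ancestor (Initial t) = t"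
| "ancestor (R1 F) = ancestor F" | "ancestor (R2 F) = ancestor F" | "ancestor (R3 F) = ancestor F" | "ancestor (R4 F) = ancestor F"
| "ancestor (G1 F) = ancestor F" | "ancestor (G2 F) = ancestor F"

lemma subdivides_ancestor: "subdivides E S \<Longrightarrow> X \<in> S \<Longrightarrow> ancestor X = ancestor E"
  by (induction rule: subdivides.induct) auto

lemma ancestor_children: "Y \<in> children p X \<Longrightarrow> ancestor Y = ancestor X"
  using subdivides_ancestor[OF subdivides_children] .

text \<open>Represents a triangle up to translation; the first vector is the reference edge.\<close>

fun edge_vectors :: "triangle \<Rightarrow> point \<times> point" where
  "edge_vectors (v1, v2, v3) = (v2 - v1, v3 - v1)"

fun green1 :: "point \<times> point \<Rightarrow> point \<times> point" where
  "green1 (a, b) = (- b, (1/2) *\<^sub>R a - b)"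

fun green2 :: "point \<times> point \<Rightarrow> point \<times> point" where
  "green2 (a, b) = (b - a, - (1/2) *\<^sub>R a)"

text \<open>The four similarity classes of newest vertex bisection. \<open>green2 (green2 s)\<close>
  is absent because it is the negative of \<open>green1 (green1 s)\<close>.\<close>

definition shapes :: "point \<times> point \<Rightarrow> (point \<times> point) set" where
  "shapes s = {s, green1 s, green2 s, green1 (green1 s)}"

lemma green_scaleR: "green1 (c *\<^sub>R s) = c *\<^sub>R green1 s" "green2 (c *\<^sub>R s) = c *\<^sub>R green2 s"
  by (cases s; simp add: algebra_simps)+

lemma green_compose:
  "green1 (green2 s) = (1/2) *\<^sub>R s" "green2 (green1 s) = (1/2) *\<^sub>R s"
  "green2 (green2 s) = (- 1) *\<^sub>R green1 (green1 s)"
  "green1 (green1 (green1 s)) = (- 1/2) *\<^sub>R green2 s"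
  "green2 (green1 (green1 s)) = (1/2) *\<^sub>R green1 s"
  by (cases s; simp add: vec_eq_iff forall_2 field_simps)+

lemma edge_vectors_children:
  "edge_vectors (tri (R1 F)) = (1/2) *\<^sub>R edge_vectors (tri F)"
  "edge_vectors (tri (R2 F)) = (1/2) *\<^sub>R edge_vectors (tri F)"
  "edge_vectors (tri (R3 F)) = (1/2) *\<^sub>R edge_vectors (tri F)"
  "edge_vectors (tri (R4 F)) = (- 1/2) *\<^sub>R edge_vectors (tri F)"
  "edge_vectors (tri (G1 F)) = green1 (edge_vectors (tri F))"
  "edge_vectors (tri (G2 F)) = green2 (edge_vectors (tri F))"
  by (cases "tri F"; simp add: tri.simps vec_eq_iff forall_2 midpoint_nth field_simps)+

text \<open>Red children multiply the edge vectors by 1/2 or -1/2. Green children apply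
  \<open>green1\<close> or \<open>green2\<close>, and the identities in \<open>green_compose\<close>
  show that four shapes are closed under both maps up to a nonzero factor; a negative factor is a
  half turn.\<close>

lemma edge_vectors_shapes:
  "\<exists>s c. s \<in> shapes (edge_vectors (ancestor X)) \<and> c \<noteq> 0 \<and> edge_vectors (tri X) = c *\<^sub>R s"
proof -
  have scale: "\<exists>s c. s \<in> S \<and> c \<noteq> 0 \<and> k *\<^sub>R e = c *\<^sub>R s"
    if ex: "\<exists>s c. s \<in> S \<and> c \<noteq> 0 \<and> e = c *\<^sub>R s" and k: "k \<noteq> 0" for S :: "(point \<times> point) set" and e k
  proof -
    obtain s c where "s \<in> S" "c \<noteq> 0" "e = c *\<^sub>R s" using ex by blast
    then show ?thesis using k by (intro exI[of _ s] exI[of _ "k * c"]) simp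
  qed
  have green: "(\<exists>s' c. s' \<in> shapes e \<and> c \<noteq> 0 \<and> green1 s = c *\<^sub>R s') \<and>
      (\<exists>s' c. s' \<in> shapes e \<and> c \<noteq> 0 \<and> green2 s = c *\<^sub>R s')" if s: "s \<in> shapes e" for s e
  proof -
    have one: "x = 1 *\<^sub>R x" for x :: "point \<times> point" by simp
    have m: "e \<in> shapes e" "green1 e \<in> shapes e" "green2 e \<in> shapes e" "green1 (green1 e) \<in> shapes e"
      by (simp_all add: shapes_def)
    consider "s = e" | "s = green1 e" | "s = green2 e" | "s = green1 (green1 e)"
      using s by (auto simp: shapes_def)
    then show ?thesis
    proof cases
      case 1
      then show ?thesis using m(2,3) one by (metis zero_neq_one)
    next
      case 2
      have "(1/2 :: real) \<noteq> 0" by simp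
      then show ?thesis using 2 m(1,4) green_compose(2)[of e] one by (metis zero_neq_one)
    next
      case 3
      have "(1/2 :: real) \<noteq> 0" "(- 1 :: real) \<noteq> 0" by simp_all
      then show ?thesis using 3 m(1,4) green_compose(1,3)[of e] by blast
    next
      case 4
      have "(1/2 :: real) \<noteq> 0" "(- 1/2 :: real) \<noteq> 0" by simp_all
      then show ?thesis using 4 m(2,3) green_compose(4,5)[of e] by blast
    qed
  qed
  have step: "(\<exists>s c. s \<in> shapes e \<and> c \<noteq> 0 \<and> green1 u = c *\<^sub>R s) \<and> (\<exists>s c. s \<in> shapes e \<and> c \<noteq> 0 \<and> green2 u = c *\<^sub>R s)"
    if ex: "\<exists>s c. s \<in> shapes e \<and> c \<noteq> 0 \<and> u = c *\<^sub>R s" for u e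
  proof -
    obtain s c where s: "s \<in> shapes e" "c \<noteq> 0" "u = c *\<^sub>R s" using ex by blast
    show ?thesis unfolding s(3) green_scaleR using scale[OF _ s(2)] green[OF s(1)] by blast
  qed
  show ?thesis
  proof (induction X)
    case (Initial t)
    then show ?case by (intro exI[of _ "edge_vectors t"] exI[of _ 1]) (simp add: shapes_def)
  next
    case (R1 F) then show ?case unfolding edge_vectors_children ancestor.simps by (intro scale) auto
  next
    case (R2 F) then show ?case unfolding edge_vectors_children ancestor.simps by (intro scale) auto
  next
    case (R3 F) then show ?case unfolding edge_vectors_children ancestor.simps by (intro scale) auto
  next
    case (R4 F) then show ?case unfolding edge_vectors_children ancestor.simps by (intro scale) auto
  next
    case (G1 F) then show ?case unfolding edge_vectors_children ancestor.simps using step by blast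
  next
    case (G2 F) then show ?case unfolding edge_vectors_children ancestor.simps using step by blast
  qed
qed

section \<open>Diameter and inscribed balls\<close>

lemma inradius_upper:
  assumes "bounded K" "0 \<le> r" "cball x r \<subseteq> K"
  shows "r \<le> inradius K"
proof -
  \<comment> \<open>The supremum in \<open>inradius\<close> is meaningful only for a bounded set of
    radii; a ball inside K has a diameter of at most that of K.\<close>
  have "bdd_above {r. 0 \<le> r \<and> (\<exists>x. cball x r \<subseteq> K)}"
  proof (rule bdd_aboveI)
    fix r assume "r \<in> {r. 0 \<le> r \<and> (\<exists>x. cball x r \<subseteq> K)}"
    then obtain x where x: "0 \<le> r" "cball x r \<subseteq> K" by blast
    have "diameter (cball x r) \<le> diameter K" by (rule diameter_subset[OF x(2) assms(1)])
    then show "r \<le> diameter K" using x(1) by simp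
  qed
  then show ?thesis unfolding inradius_def using assms by (intro cSup_upper) auto
qed

text \<open>Triangles of one shape are images of a fixed triangle K under x \<mapsto> v1 + c x, so
  diameter and inscribed balls scale by the modulus of c. Stating the bound for all larger constants
  allows a maximum over finitely many shapes.\<close>

lemma shape_constant:
  "\<exists>C. \<forall>C' \<ge> C. \<forall>t c. ccw t \<longrightarrow> edge_vectors t = c *\<^sub>R s \<longrightarrow>
     diameter (hull_of t) \<le> C' * inradius (hull_of t)"
proof -
  obtain a b where s: "s = (a, b)" by (cases s)
  define K where "K = convex hull {0, a, b}"
  have bK: "bounded K" unfolding K_def by (simp add: bounded_convex_hull)
  show ?thesis
  proof (cases "0 < orient 0 a b")
    case True
    have "interior K \<noteq> {}" unfolding K_def using interior_hull_nonempty[of "Initial (0, a, b)"] True by simp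
    \<comment> \<open>Any inscribed ball of K will do; its radius bounds the inradius from below
      after scaling.\<close>
    then obtain z r where r: "0 < r" "cball z r \<subseteq> K" by (metis ex_in_conv mem_interior_cball)
    have "diameter (hull_of t) \<le> C' * inradius (hull_of t)"
      if C': "diameter K / r \<le> C'" and t: "edge_vectors t = c *\<^sub>R s" and ccw: "ccw t" for C' c t
    proof -
      obtain v1 v2 v3 where v: "t = (v1, v2, v3)" by (metis prod_cases3)
      have v23: "v2 = v1 + c *\<^sub>R a" "v3 = v1 + c *\<^sub>R b" using t unfolding v s by (auto simp: algebra_simps)
      have c: "c \<noteq> 0" using ccw unfolding v v23 by auto
      have "hull_of t = convex hull ((\<lambda>x. v1 + c *\<^sub>R x) ` {0, a, b})" unfolding v v23 by simp
      also have "\<dots> = (\<lambda>x. v1 + c *\<^sub>R x) ` K" unfolding K_def by (rule convex_hull_affinity)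
      finally have h: "hull_of t = (\<lambda>x. v1 + c *\<^sub>R x) ` K" .
      have "norm (x - y) \<le> \<bar>c\<bar> * diameter K" if x: "x \<in> hull_of t" and y: "y \<in> hull_of t" for x y
      proof -
        obtain x' y' where xy: "x = v1 + c *\<^sub>R x'" "x' \<in> K" "y = v1 + c *\<^sub>R y'" "y' \<in> K"
          using x y unfolding h by blast
        have "norm (x - y) = \<bar>c\<bar> * norm (x' - y')"
          unfolding xy by (simp flip: scaleR_diff_right)
        also have "\<dots> \<le> \<bar>c\<bar> * diameter K"
          using diameter_bounded_bound[OF bK xy(2,4)] by (intro mult_left_mono) (simp_all add: dist_norm)
        finally show ?thesis .
      qed
      then have d: "diameter (hull_of t) \<le> \<bar>c\<bar> * diameter K"
        using diameter_ge_0[OF bK] by (intro diameter_le) auto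
      have "cball (v1 + c *\<^sub>R z) (\<bar>c\<bar> * r) \<subseteq> hull_of t"
      proof
        fix x assume x: "x \<in> cball (v1 + c *\<^sub>R z) (\<bar>c\<bar> * r)"
        define y where "y = (1 / c) *\<^sub>R (x - v1)"
        have xy: "x = v1 + c *\<^sub>R y" using c by (simp add: y_def)
        have "\<bar>c\<bar> * norm (z - y) \<le> \<bar>c\<bar> * r"
          using x unfolding xy by (simp add: dist_norm flip: scaleR_diff_right)
        then have "y \<in> cball z r" using c by (simp add: dist_norm)
        then show "x \<in> hull_of t" unfolding h xy using r(2) by blast
      qed
      moreover have "bounded (hull_of t)" by (simp add: v bounded_convex_hull)
      ultimately have i: "\<bar>c\<bar> * r \<le> inradius (hull_of t)" using r(1) by (intro inradius_upper) auto
      have "\<bar>c\<bar> * diameter K = (diameter K / r) * (\<bar>c\<bar> * r)" using r(1) by simp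
      also have "\<dots> \<le> C' * inradius (hull_of t)"
        using C' i r(1) diameter_ge_0[OF bK] by (intro mult_mono) (auto intro: order_trans[rotated])
      finally show ?thesis using d by linarith
    qed
    then show ?thesis by blast
  next
    case False
    \<comment> \<open>Scaling multiplies the orientation by the square of c, so this shape carries
      no positively oriented triangle.\<close>
    have "\<not> ccw t" if "edge_vectors t = c *\<^sub>R s" for t c
    proof -
      obtain v1 v2 v3 where v: "t = (v1, v2, v3)" by (metis prod_cases3)
      have v23: "v2 = v1 + c *\<^sub>R a" "v3 = v1 + c *\<^sub>R b" using that unfolding v s by (auto simp: algebra_simps)
      have "orient v1 v2 v3 = c * c * orient 0 a b" unfolding v23 by (simp add: orient_def algebra_simps)
      also have "\<dots> \<le> 0" using False by (intro mult_nonneg_nonpos) auto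
      finally show ?thesis by (simp add: v)
    qed
    then show ?thesis by blast
  qed
qed

lemma shape_regular_ancestors:
  assumes "finite \<T>\<^sub>0" "\<And>\<T> t. \<T> \<in> \<F> \<Longrightarrow> t \<in> \<T> \<Longrightarrow> \<exists>X. t = tri X \<and> ancestor X \<in> \<T>\<^sub>0 \<and> ccw t"
  shows "shape_regular \<F>"
proof -
  obtain C where C: "\<And>s C' t c. C s \<le> C' \<Longrightarrow> ccw t \<Longrightarrow> edge_vectors t = c *\<^sub>R s \<Longrightarrow>
      diameter (hull_of t) \<le> C' * inradius (hull_of t)"
    using shape_constant by metis
  \<comment> \<open>At most four shapes for each initial triangle; the maximum over them depends on
    the initial mesh only.\<close>
  define Sh where "Sh = (\<Union>t\<in>\<T>\<^sub>0. shapes (edge_vectors t))"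
  have fin: "finite (C ` Sh)" unfolding Sh_def using assms(1) by (simp add: shapes_def)
  have "diameter (hull_of t) \<le> Max (C ` Sh) * inradius (hull_of t)" if t: "\<T> \<in> \<F>" "t \<in> \<T>" for \<T> t
  proof -
    obtain X where X: "t = tri X" "ancestor X \<in> \<T>\<^sub>0" "ccw t" using assms(2)[OF t] by blast
    obtain s c where s: "s \<in> shapes (edge_vectors (ancestor X))" "edge_vectors (tri X) = c *\<^sub>R s"
      using edge_vectors_shapes by blast
    have "s \<in> Sh" using s(1) X(2) unfolding Sh_def by blast
    then have "C s \<le> Max (C ` Sh)" using fin by (intro Max_ge) auto
    then show ?thesis using C X(1,3) s(2) by blast
  qed
  then show ?thesis unfolding shape_regular_def by blast
qed

context coarsening
begin

lemma ancestor_elements: "X \<in> \<T> \<Longrightarrow> ancestor X \<in> \<T>\<^sub>0"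
proof -
  assume X: "X \<in> \<T>"
  obtain f where f: "\<And>E. E \<in> Initial ` \<T>\<^sub>0 \<Longrightarrow> subdivides E (f E)" and T: "\<T> = (\<Union>E\<in>Initial ` \<T>\<^sub>0. f E)"
    using initial(3) unfolding subdivision_def by blast
  obtain E where E: "E \<in> Initial ` \<T>\<^sub>0" "X \<in> f E" using X unfolding T by blast
  then show "ancestor X \<in> \<T>\<^sub>0" using subdivides_ancestor[OF f[OF E(1)] E(2)] by auto
qed

lemma ancestor_coarsen:
  assumes "Y \<in> coarsen \<T>\<^sub>0 \<T> N_mark"
  shows "ancestor Y \<in> \<T>\<^sub>0"
proof -
  obtain X where X: "X \<in> coarse" "Y \<in> children (new_pattern X) X" using assms unfolding coarsen_eq by blast
  have "ancestor X \<in> \<T>\<^sub>0"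
    using X(1) ancestor_elements[of X] ancestor_elements[of "R1 X"] ancestor_elements[of "G1 X"]
    by (auto simp: coarse_def kept_def)
  then show ?thesis using ancestor_children[OF X(2)] by simp
qed

end

section \<open>From refinement histories to coarsened meshes\<close>

lemma coarsening_if_rgb_refinement:
  assumes T0: "conforming_triangulation \<Omega> \<T>\<^sub>0" and ref: "rgb_refinement \<Omega> \<T>\<^sub>0 \<T>"
  shows "coarsening (closure \<Omega>) \<T> \<T>\<^sub>0 N_mark"
proof -
  note inv = rgb_refinement_induct[OF T0 ref]
  have ccw: "ccw (tri X)" if "X \<in> \<T>" for X using inv that by (simp add: tiling_def)
  interpret mesh "closure \<Omega>" \<T>
    using inv conforming_no_hanging_nodes[OF _ ccw] by unfold_locales blast+
  \<comment> \<open>The invariant after zero refinement steps.\<close>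
  have init: "tiling (closure \<Omega>) (Initial ` \<T>\<^sub>0) \<and> conforming (tri ` Initial ` \<T>\<^sub>0)"
    using rgb_refinement_induct[OF T0, of "Initial ` \<T>\<^sub>0"] by (simp add: rgb_refinement_def)
  have init_ccw: "ccw (tri X)" if "X \<in> Initial ` \<T>\<^sub>0" for X using init that by (auto simp: tiling_def)
  show ?thesis
  proof
    show "tiling (closure \<Omega>) (Initial ` \<T>\<^sub>0)" using init by blast
    show "no_hanging_nodes (Initial ` \<T>\<^sub>0)"
      by (rule conforming_no_hanging_nodes[OF conjunct2[OF init] init_ccw])
    show "subdivision (Initial ` \<T>\<^sub>0) \<T>" using inv by blast
    show "\<exists>F. children Red F \<subseteq> \<T> \<and> X \<in> children Red F \<and> v \<in> mids (tri F) \<or>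
        children Green F \<subseteq> \<T> \<and> X \<in> children Green F \<and> v = mid12 (tri F)"
      if v: "v \<in> N_adm_init \<T>\<^sub>0 \<T> N_mark" and X: "X \<in> \<T>" "v \<in> vert X" for v X
    proof -
      have "v \<in> nodes (tri ` \<T>) - nodes \<T>\<^sub>0" using v by (simp add: N_adm_init_def N_new_def)
      then obtain \<T>' a b where T': "tiling (closure \<Omega>) \<T>'" "subdivision \<T>' \<T>" "v = midpoint a b"
        "\<forall>E\<in>\<T>'. v \<in> region E \<longrightarrow> {a, b} \<in> sides (tri E)"
        using inv by blast
      obtain X0 where X0: "X0 \<in> \<T>" "is_newest_vertex v X0" using v by (auto simp: N_adm_init_def N_new_def)
      have "card (reduced_patch \<T> v) \<in> {2, 4}" using v by (simp add: N_adm_init_def)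
      \<comment> \<open>The stage at which v was created supplies the triangles for the count, and
        the newest vertex supplies \<open>X0\<close>.\<close>
      then obtain F S where FS: "complete_split F S a b" "S \<subseteq> \<T>" "X \<in> S"
        using admissible_complete[OF T'(2,1), of a b X0 X] T'(3,4) X0 X by blast
      show ?thesis
      proof (cases "S = children Red F \<and> {a, b} \<in> sides (tri F)")
        case True
        then have "v \<in> mids (tri F)" using T'(3) mids_sides by blast
        then show ?thesis using True FS by blast
      next
        case False
        then have S: "S = children Green F" "{a, b} = {fst (tri F), fst (snd (tri F))}"
          using FS(1) unfolding complete_split_def by blast+
        have "v = mid12 (tri F)"
          using midpoint_doubleton[OF S(2)] T'(3) by (cases "tri F") simp
        then show ?thesis using S FS by blast
      qed
    qed
  qed
qed

text \<open>The constant in shape regularity must be uniform, so it is claimed for the family of all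
  outputs obtained from one initial mesh rather than for each output separately.\<close>

theorem theorem1:
  fixes \<Omega> :: "point set" and \<T>\<^sub>0 :: "triangle set"
  assumes "polygonal_domain \<Omega>"
    and "conforming_triangulation \<Omega> \<T>\<^sub>0"
  shows "(\<forall>\<T> N_mark. rgb_refinement \<Omega> \<T>\<^sub>0 \<T> \<and> N_mark \<subseteq> nodes (tri ` \<T>) \<longrightarrow>
            conforming_triangulation \<Omega> (tri ` coarsen \<T>\<^sub>0 \<T> N_mark)) \<and>
         shape_regular {tri ` coarsen \<T>\<^sub>0 \<T> N_mark | \<T> N_mark.
            rgb_refinement \<Omega> \<T>\<^sub>0 \<T> \<and> N_mark \<subseteq> nodes (tri ` \<T>)}"
proof (intro conjI allI impI)
  fix \<T> N_mark assume "rgb_refinement \<Omega> \<T>\<^sub>0 \<T> \<and> N_mark \<subseteq> nodes (tri ` \<T>)"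
  then interpret coarsening "closure \<Omega>" \<T> \<T>\<^sub>0 N_mark
    using coarsening_if_rgb_refinement[OF assms(2)] by blast
  show "conforming_triangulation \<Omega> (tri ` coarsen \<T>\<^sub>0 \<T> N_mark)"
    unfolding conforming_triangulation_def
    using tiling_triangulation[OF tiling_coarsen]
      no_hanging_nodes_conforming[OF tiling_coarsen no_hanging_coarsen] by blast
next
  show "shape_regular {tri ` coarsen \<T>\<^sub>0 \<T> N_mark | \<T> N_mark.
            rgb_refinement \<Omega> \<T>\<^sub>0 \<T> \<and> N_mark \<subseteq> nodes (tri ` \<T>)}"
  proof (rule shape_regular_ancestors)
    show "finite \<T>\<^sub>0" using assms(2) by (simp add: conforming_triangulation_def triangulation_def)
    fix \<S> t assume "\<S> \<in> {tri ` coarsen \<T>\<^sub>0 \<T> N_mark | \<T> N_mark.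
            rgb_refinement \<Omega> \<T>\<^sub>0 \<T> \<and> N_mark \<subseteq> nodes (tri ` \<T>)}" and t: "t \<in> \<S>"
    then obtain \<T> N_mark where S: "\<S> = tri ` coarsen \<T>\<^sub>0 \<T> N_mark" and ref: "rgb_refinement \<Omega> \<T>\<^sub>0 \<T>" by blast
    interpret coarsening "closure \<Omega>" \<T> \<T>\<^sub>0 N_mark by (rule coarsening_if_rgb_refinement[OF assms(2) ref])
    obtain X where X: "X \<in> coarsen \<T>\<^sub>0 \<T> N_mark" "t = tri X" using t unfolding S by blast
    then show "\<exists>X. t = tri X \<and> ancestor X \<in> \<T>\<^sub>0 \<and> ccw t"
      using ancestor_coarsen[OF X(1)] tiling_coarsen by (auto simp: tiling_def)
  qed
qed

end
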